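(* Let $D\ge 1$ and $N>2D$ be integers, let $q$ be a prime power, let $\Gamma=J_q(N,D)$ be the Grassmann graph, let $x$ be a vertex of $\Gamma$, and let $\mathcal{N}=\mathcal{N}(x)$ be the nucleus of $\Gamma$ with respect to $x$. Then each of the following (families indexed by the subspaces $\alpha$ of $x$) forms a basis for $\mathcal{N}$: (i) $\{\alpha^{\vee}\mid \alpha\subseteq x\}$; (ii) $\{\alpha^{\mathcal{N}}\mid \alpha\subseteq x\}$.
   Context: Let $\mathbb{F}_q$ be a finite field with $q$ elements and $\mathcal{V}$ an $N$-dimensional vector space over $\mathbb{F}_q$. The Grassmann graph $\Gamma=J_q(N,D)$ has vertex set $X$ consisting of the $D$-dimensional subspaces of $\mathcal{V}$; $y,z\in X$ are adjacent iff $\dim(y\cap z)=D-1$. Let $\partial$ be the path-length distance; for $N>2D$ the diameter is $D$ and $\partial(y,z)=D-\dim(y\cap z)$. Put $[\ell]=\frac{q^\ell-1}{q-1}$. Let $A\in\mathrm{Mat}_X(\mathbb{C})$ be the adjacency matrix of $\Gamma$ and $V=\mathbb{C}^X$ the standard module (column vectors). $A$ has exactly $D+1$ distinct eigenvalues $\theta_0>\theta_1>\cdots>\theta_D$, namely $\theta_i=q[D][N-D]-[i][N-i+1]$; let $E_i$ be the orthogonal projection of $V$ onto the $\theta_i$-eigenspace of $A$. For $0\le i\le D$ let $E_i^*=E_i^*(x)$ be the diagonal matrix with $(y,y)$-entry $1$ if $\partial(x,y)=i$ and $0$ otherwise. The Terwilliger algebra $T=T(x)$ is the subalgebra of $\mathrm{Mat}_X(\mathbb{C})$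 generated by $A$ and $E_0^*,\dots,E_D^*$. A $T$-module is a subspace $W\subseteq V$ with $TW\subseteq W$; it is irreducible if it is nonzero and has no $T$-submodule other than $0$ and $W$. For an irreducible $T$-module $W$: the endpoint is $r=\min\{i: E_i^*W\ne0\}$, the dual endpoint is $t=\min\{i: E_iW\neq 0\}$, the diameter is $d=|\{i: E_i^*W\ne 0\}|-1$, and the displacement is $r+t-D+d$. The nucleus $\mathcal{N}=\mathcal{N}(x)$ is the span of all irreducible $T$-modules with displacement $0$. For $y\in X$ let $\widehat{y}\in V$ have $1$ in coordinate $y$ and $0$ elsewhere. For a subspace $\alpha\subseteq x$ define $$\alpha^{\vee}=\sum_{y\in X,\ \alpha\subseteq y}\widehat{y},\qquad \alpha^{\mathcal{N}}=\sum_{y\in X,\ y\cap x=\alpha}\widehat{y}.$$ *)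

theory Defs
  imports Complex_Main "HOL-Library.Cardinality" "HOL-Library.Function_Algebras"
begin

section \<open>The space of complex vectors indexed by a set\<close>

text \<open>
  A vector in \<open>\<complex>\<^sup>X\<close> is a function \<open>'p \<Rightarrow> complex\<close> that vanishes outside the finite set \<open>X\<close>;
  a matrix in \<open>Mat\<^sub>X(\<complex>)\<close> is a function \<open>'p \<Rightarrow> 'p \<Rightarrow> complex\<close> that vanishes outside \<open>X \<times> X\<close>.
\<close>

definition cscale :: "complex \<Rightarrow> ('p \<Rightarrow> complex) \<Rightarrow> 'p \<Rightarrow> complex" where
  "cscale c v = (\<lambda>y. c * v y)"

interpretation cfun: vector_space cscale
  by unfold_locales (auto simp: cscale_def algebra_simps fun_eq_iff)

definition std_module :: "'p set \<Rightarrow> ('p \<Rightarrow> complex) set" where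
  "std_module X = {v. \<forall>y. y \<notin> X \<longrightarrow> v y = 0}"

definition hat :: "'p \<Rightarrow> 'p \<Rightarrow> complex" where
  "hat y = (\<lambda>z. if z = y then 1 else 0)"

definition mat_vec :: "'p set \<Rightarrow> ('p \<Rightarrow> 'p \<Rightarrow> complex) \<Rightarrow> ('p \<Rightarrow> complex) \<Rightarrow> 'p \<Rightarrow> complex" where
  "mat_vec X M v = (\<lambda>y. \<Sum>z\<in>X. M y z * v z)"

definition mat_mult ::
    "'p set \<Rightarrow> ('p \<Rightarrow> 'p \<Rightarrow> complex) \<Rightarrow> ('p \<Rightarrow> 'p \<Rightarrow> complex) \<Rightarrow> 'p \<Rightarrow> 'p \<Rightarrow> complex" where
  "mat_mult X M M' = (\<lambda>y z. \<Sum>u\<in>X. M y u * M' u z)"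

definition herm :: "'p set \<Rightarrow> ('p \<Rightarrow> complex) \<Rightarrow> ('p \<Rightarrow> complex) \<Rightarrow> complex" where
  "herm X v w = (\<Sum>y\<in>X. v y * cnj (w y))"

definition orth_proj ::
    "'p set \<Rightarrow> ('p \<Rightarrow> complex) set \<Rightarrow> ('p \<Rightarrow> complex) \<Rightarrow> 'p \<Rightarrow> complex" where
  "orth_proj X U v = (THE u. u \<in> U \<and> (\<forall>w\<in>U. herm X (v - u) w = 0))"

definition is_basis_family ::
    "('i \<Rightarrow> 'p \<Rightarrow> complex) \<Rightarrow> 'i set \<Rightarrow> ('p \<Rightarrow> complex) set \<Rightarrow> bool" where
  "is_basis_family f I U \<longleftrightarrow>
     inj_on f I \<and> \<not> cfun.dependent (f ` I) \<and> cfun.span (f ` I) = U"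


section \<open>Terwilliger algebra and its modules\<close>

text \<open>A graph is given by its vertex set \<open>X\<close> and its symmetric adjacency relation \<open>R \<subseteq> X \<times> X\<close>.\<close>

definition gdist :: "('p \<times> 'p) set \<Rightarrow> 'p \<Rightarrow> 'p \<Rightarrow> nat" where
  "gdist R y z = (LEAST n. (y, z) \<in> R ^^ n)"

definition adj_mat :: "('p \<times> 'p) set \<Rightarrow> 'p \<Rightarrow> 'p \<Rightarrow> complex" where
  "adj_mat R = (\<lambda>y z. if (y, z) \<in> R then 1 else 0)"

definition dual_idem ::
    "'p set \<Rightarrow> ('p \<times> 'p) set \<Rightarrow> 'p \<Rightarrow> nat \<Rightarrow> 'p \<Rightarrow> 'p \<Rightarrow> complex" where
  "dual_idem X R x i = (\<lambda>y z. if y = z \<and> y \<in> X \<and> gdist R x y = i then 1 else 0)"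

text \<open>
  The identity matrix need not be a generator, since it is the sum of the \<open>dual_idem X R x i\<close>
  when the graph is connected with diameter \<open>D\<close>.
\<close>

inductive_set terwilliger ::
    "'p set \<Rightarrow> ('p \<times> 'p) set \<Rightarrow> nat \<Rightarrow> 'p \<Rightarrow> ('p \<Rightarrow> 'p \<Rightarrow> complex) set"
  for X R D x where
  adj: "adj_mat R \<in> terwilliger X R D x"
| dual: "i \<le> D \<Longrightarrow> dual_idem X R x i \<in> terwilliger X R D x"
| add: "M \<in> terwilliger X R D x \<Longrightarrow> M' \<in> terwilliger X R D x \<Longrightarrow>
    (\<lambda>y z. M y z + M' y z) \<in> terwilliger X R D x"
| scale: "M \<in> terwilliger X R D x \<Longrightarrow> (\<lambda>y z. c * M y z) \<in> terwilliger X R D x"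
| mult: "M \<in> terwilliger X R D x \<Longrightarrow> M' \<in> terwilliger X R D x \<Longrightarrow>
    mat_mult X M M' \<in> terwilliger X R D x"

definition T_module ::
    "'p set \<Rightarrow> ('p \<times> 'p) set \<Rightarrow> nat \<Rightarrow> 'p \<Rightarrow> ('p \<Rightarrow> complex) set \<Rightarrow> bool" where
  "T_module X R D x W \<longleftrightarrow>
     cfun.subspace W \<and> W \<subseteq> std_module X \<and>
     (\<forall>M\<in>terwilliger X R D x. \<forall>w\<in>W. mat_vec X M w \<in> W)"

definition irred_T_module ::
    "'p set \<Rightarrow> ('p \<times> 'p) set \<Rightarrow> nat \<Rightarrow> 'p \<Rightarrow> ('p \<Rightarrow> complex) set \<Rightarrow> bool" where
  "irred_T_module X R D x W \<longleftrightarrow>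
     T_module X R D x W \<and> W \<noteq> {0} \<and>
     (\<forall>U. T_module X R D x U \<and> U \<subseteq> W \<longrightarrow> U = {0} \<or> U = W)"

definition eigenspace :: "'p set \<Rightarrow> ('p \<times> 'p) set \<Rightarrow> complex \<Rightarrow> ('p \<Rightarrow> complex) set" where
  "eigenspace X R \<theta> = {v \<in> std_module X. mat_vec X (adj_mat R) v = cscale \<theta> v}"

text \<open>
  In the following, \<open>\<theta> 0, \<dots>, \<theta> D\<close> is the chosen ordering of the distinct eigenvalues of the graph,
  so \<open>orth_proj X (eigenspace X R (\<theta> i))\<close> is the primitive idempotent \<open>E\<^sub>i\<close>.
\<close>

definition dual_support ::
    "'p set \<Rightarrow> ('p \<times> 'p) set \<Rightarrow> nat \<Rightarrow> (nat \<Rightarrow> real) \<Rightarrow> ('p \<Rightarrow> complex) set \<Rightarrow> nat set" where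
  "dual_support X R D \<theta> W =
     {i. i \<le> D \<and> orth_proj X (eigenspace X R (complex_of_real (\<theta> i))) ` W \<noteq> {0}}"

definition support ::
    "'p set \<Rightarrow> ('p \<times> 'p) set \<Rightarrow> nat \<Rightarrow> 'p \<Rightarrow> ('p \<Rightarrow> complex) set \<Rightarrow> nat set" where
  "support X R D x W = {i. i \<le> D \<and> mat_vec X (dual_idem X R x i) ` W \<noteq> {0}}"

definition endpoint ::
    "'p set \<Rightarrow> ('p \<times> 'p) set \<Rightarrow> nat \<Rightarrow> 'p \<Rightarrow> ('p \<Rightarrow> complex) set \<Rightarrow> nat" where
  "endpoint X R D x W = Min (support X R D x W)"

definition dual_endpoint ::
    "'p set \<Rightarrow> ('p \<times> 'p) set \<Rightarrow> nat \<Rightarrow> (nat \<Rightarrow> real) \<Rightarrow> ('p \<Rightarrow> complex) set \<Rightarrow> nat" where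
  "dual_endpoint X R D \<theta> W = Min (dual_support X R D \<theta> W)"

definition mod_diameter ::
    "'p set \<Rightarrow> ('p \<times> 'p) set \<Rightarrow> nat \<Rightarrow> 'p \<Rightarrow> ('p \<Rightarrow> complex) set \<Rightarrow> int" where
  "mod_diameter X R D x W = int (card (support X R D x W)) - 1"

definition displacement ::
    "'p set \<Rightarrow> ('p \<times> 'p) set \<Rightarrow> nat \<Rightarrow> (nat \<Rightarrow> real) \<Rightarrow> 'p \<Rightarrow> ('p \<Rightarrow> complex) set \<Rightarrow> int" where
  "displacement X R D \<theta> x W =
     int (endpoint X R D x W) + int (dual_endpoint X R D \<theta> W) - int D + mod_diameter X R D x W"

definition nucleus ::
    "'p set \<Rightarrow> ('p \<times> 'p) set \<Rightarrow> nat \<Rightarrow> (nat \<Rightarrow> real) \<Rightarrow> 'p \<Rightarrow> ('p \<Rightarrow> complex) set" where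
  "nucleus X R D \<theta> x =
     cfun.span (\<Union> {W. irred_T_module X R D x W \<and> displacement X R D \<theta> x W = 0})"


section \<open>The Grassmann graph\<close>

text \<open>
  The ambient vector space is the whole type \<open>'v\<close>, with scalar multiplication \<open>scale\<close> over the
  finite field \<open>'k\<close>; the field has \<open>q = CARD('k)\<close> elements.
\<close>

definition grassmann_verts ::
    "('k::field \<Rightarrow> 'v::ab_group_add \<Rightarrow> 'v) \<Rightarrow> nat \<Rightarrow> 'v set set" where
  "grassmann_verts scale D = {y. module.subspace scale y \<and> vector_space.dim scale y = D}"

definition grassmann_adj ::
    "('k::field \<Rightarrow> 'v::ab_group_add \<Rightarrow> 'v) \<Rightarrow> nat \<Rightarrow> ('v set \<times> 'v set) set" where
  "grassmann_adj scale D =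
     {(y, z). y \<in> grassmann_verts scale D \<and> z \<in> grassmann_verts scale D \<and>
        vector_space.dim scale (y \<inter> z) = D - 1}"

definition q_bracket :: "nat \<Rightarrow> nat \<Rightarrow> real" where
  "q_bracket q l = (real q ^ l - 1) / (real q - 1)"

definition grassmann_eigenvalue :: "nat \<Rightarrow> nat \<Rightarrow> nat \<Rightarrow> nat \<Rightarrow> real" where
  "grassmann_eigenvalue q N D i =
     real q * q_bracket q D * q_bracket q (N - D) - q_bracket q i * q_bracket q (N - i + 1)"

definition grassmann_nucleus ::
    "('k::{field,finite} \<Rightarrow> 'v::ab_group_add \<Rightarrow> 'v) \<Rightarrow> nat \<Rightarrow> 'v set \<Rightarrow> ('v set \<Rightarrow> complex) set" where
  "grassmann_nucleus scale D x =
     nucleus (grassmann_verts scale D) (grassmann_adj scale D) D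
       (grassmann_eigenvalue CARD('k) (vector_space.dim scale UNIV) D) x"

definition vee_vec ::
    "('k::field \<Rightarrow> 'v::ab_group_add \<Rightarrow> 'v) \<Rightarrow> nat \<Rightarrow> 'v set \<Rightarrow> 'v set \<Rightarrow> complex" where
  "vee_vec scale D \<alpha> = (\<Sum>y | y \<in> grassmann_verts scale D \<and> \<alpha> \<subseteq> y. hat y)"

definition nuc_vec ::
    "('k::field \<Rightarrow> 'v::ab_group_add \<Rightarrow> 'v) \<Rightarrow> nat \<Rightarrow> 'v set \<Rightarrow> 'v set \<Rightarrow> 'v set \<Rightarrow> complex" where
  "nuc_vec scale D x \<alpha> = (\<Sum>y | y \<in> grassmann_verts scale D \<and> y \<inter> x = \<alpha>. hat y)"

end

theory Submission
  imports Defs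
begin

text \<open>
  Write \<open>b\<^sup>\<or>\<close> for the sum of all vertices containing a subspace \<open>b\<close> of the ambient space. The adjacency
  operator maps \<open>b\<^sup>\<or>\<close> to \<open>\<theta>\<^bsub>dim b\<^esub> b\<^sup>\<or>\<close> plus a multiple of \<open>\<Sum> b'\<^sup>\<or>\<close> over the hyperplanes \<open>b'\<close> of \<open>b\<close>, and the
  diagonal operator with entries \<open>q\<^bsup>dim (y \<inter> x)\<^esup>\<close> maps it to \<open>\<Sum>\<^bsub>u \<in> x\<^esub> (b + \<langle>u\<rangle>)\<^sup>\<or>\<close>. Hence the vectors \<open>b\<^sup>\<or>\<close> with
  \<open>dim b - dim (b \<inter> x) \<le> \<eta>\<close> span a \<open>T\<close>-module \<open>V\<^sub>\<eta>\<close>, and \<open>V\<^sub>0\<close> is the span of the \<open>\<alpha>\<^sup>\<or>\<close> with \<open>\<alpha> \<subseteq> x\<close>.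

  Let \<open>W\<close> be an irreducible module in \<open>V\<^sub>\<eta>\<close> orthogonal to \<open>V\<^bsub>\<eta>-1\<^esub>\<close>, let \<open>j\<close> be the least value of
  \<open>dim (y \<inter> x)\<close> on its support and \<open>t\<close> its dual endpoint, so that the displacement is \<open>t - j\<close>. Always
  \<open>t \<ge> \<eta>\<close>. If \<open>j \<ge> \<eta>\<close>, a maximum principle, which is where \<open>N > 2D\<close> enters, shows that the vectors of
  \<open>W\<close> living on level \<open>j\<close> are orthogonal to all \<open>b\<^sup>\<or>\<close> in \<open>V\<^sub>\<eta>\<close> with \<open>dim b < j + \<eta>\<close>; a split decomposition
  argument extends this to \<open>W\<close> and gives \<open>t \<ge> j + \<eta>\<close>. So displacement \<open>0\<close> forces \<open>\<eta> = 0\<close>; conversely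
  \<open>t \<le> j\<close> when \<open>\<eta> = 0\<close>. Thus the nucleus is \<open>V\<^sub>0\<close>.
\<close>

section \<open>Linear algebra in the standard module\<close>

text \<open>The diagonal operator of the overview replaces the idempotents E_i*: its entries differ
  from level to level, so invariance under it and under adjacency already gives a T-module. Unlike a
  single projection, it raises dim b by at most one. Adjacency is triangular for the filtration of
  V_\<eta> by dim b, so the two operators can be played against each other along one filtration.

  The displacement is t - j because the support of W is an interval: r + d is the largest distance
  met by W, and distance is D - dim (y \<inter> x).

  A general irreducible W need not be orthogonal to the V before it. It suffices to take the least
  \<eta> with W inside V_\<eta> and to project W away from V_(\<eta>-1): on W this projection is an
  isomorphism of modules, so support and dual support survive.

  In the maximum principle, with m = j - 1 at the start, a value times q^(D-m) [N-2D+m+1] is a sum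
  of q^(D-m) [\<eta>] other values. As \<eta> may be as large as m + 1, N > 2D is what makes the
  total weight smaller than one.\<close>

lemma cscale_apply: "cscale c v y = c * v y"
  by (simp add: cscale_def)

lemma sum_apply: "(\<Sum>i\<in>I. f i) y = (\<Sum>i\<in>I. f i y :: complex)"
  by (induction I rule: infinite_finite_induct) auto

lemmas vec_apply = cscale_apply sum_apply plus_fun_apply zero_fun_apply minus_apply uminus_apply

text \<open>
  Goals produced by induction rules contain eta-expanded vectors, which the pointwise simplification
  rules would rewrite into abstractions.
\<close>

declare plus_fun_apply [simp del] zero_fun_apply [simp del] minus_apply [simp del]
  uminus_apply [simp del]

lemma subspace_std_module: "cfun.subspace (std_module X)"
  by (auto simp: cfun.subspace_def std_module_def vec_apply)

lemma std_module_subset_span_hat: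
  assumes "finite X"
  shows "std_module X \<subseteq> cfun.span (hat ` X)"
proof
  fix v assume v: "v \<in> std_module X"
  have "(\<Sum>y\<in>X. cscale (v y) (hat y)) z = v z" for z
    using v assms by (simp add: vec_apply hat_def std_module_def if_distrib cong: if_cong)
  hence "v = (\<Sum>y\<in>X. cscale (v y) (hat y))"
    by (auto simp: fun_eq_iff)
  moreover have "(\<Sum>y\<in>X. cscale (v y) (hat y)) \<in> cfun.span (hat ` X)"
    by (blast intro: cfun.span_sum cfun.span_scale cfun.span_base)
  ultimately show "v \<in> cfun.span (hat ` X)" by simp
qed

text \<open>The type of all functions need not be finite dimensional, so finiteness of a basis is
  obtained inside \<open>std_module X\<close>, by exchange against the vectors
  \<open>hat y\<close>.\<close>

lemma finite_basis_std_subspace: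
  assumes "finite X" "cfun.subspace U" "U \<subseteq> std_module X"
  obtains B where "finite B" "B \<subseteq> U" "cfun.independent B" "cfun.span B = U" "card B = cfun.dim U"
proof -
  obtain B where B: "B \<subseteq> U" "cfun.independent B" "U \<subseteq> cfun.span B" "card B = cfun.dim U"
    by (rule cfun.basis_exists)
  have "finite B"
    using cfun.independent_span_bound[of "hat ` X" B] B assms std_module_subset_span_hat[of X] by blast
  moreover have "cfun.span B = U"
    using B cfun.span_minimal[OF B(1) assms(2)] by blast
  ultimately show thesis using that B by blast
qed

lemma dim_psubset_std:
  assumes "finite X" "cfun.subspace U" "cfun.subspace W" "W \<subseteq> std_module X" "U \<subset> W"
  shows "cfun.dim U < cfun.dim W"
proof -
  have "U \<subseteq> std_module X" using assms by blast
  then obtain B where B: "finite B" "B \<subseteq> U" "cfun.independent B" "cfun.span B = U"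
      "card B = cfun.dim U"
    by (rule finite_basis_std_subspace[OF assms(1,2)])
  obtain C where C: "finite C" "C \<subseteq> W" "cfun.span C = W" "card C = cfun.dim W"
    by (rule finite_basis_std_subspace[OF assms(1,3,4)])
  obtain w where w: "w \<in> W" "w \<notin> U" using assms by blast
  have "cfun.independent (insert w B)"
    using B w by (simp add: cfun.independent_insert)
  moreover have "insert w B \<subseteq> cfun.span C" using B C w assms by blast
  ultimately have "card (insert w B) \<le> card C"
    using cfun.independent_span_bound[of C "insert w B"] C by blast
  moreover have "w \<notin> B" using w B by blast
  ultimately show ?thesis using B C by simp
qed

lemma herm_add_left: "herm X (u + v) w = herm X u w + herm X v w"
  by (simp add: herm_def vec_apply algebra_simps sum.distrib)

lemma herm_diff_left: "herm X (u - v) w = herm X u w - herm X v w"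
  by (simp add: herm_def vec_apply algebra_simps sum_subtractf)

lemma herm_scale_left: "herm X (cscale c v) w = c * herm X v w"
  by (simp add: herm_def vec_apply algebra_simps sum_distrib_left)

lemma herm_add_right: "herm X w (u + v) = herm X w u + herm X w v"
  by (simp add: herm_def vec_apply algebra_simps sum.distrib)

lemma herm_diff_right: "herm X w (u - v) = herm X w u - herm X w v"
  by (simp add: herm_def vec_apply algebra_simps sum_subtractf)

lemma herm_scale_right: "herm X w (cscale c v) = cnj c * herm X w v"
  by (simp add: herm_def vec_apply algebra_simps sum_distrib_left)

lemma herm_zero [simp]: "herm X 0 w = 0" "herm X w 0 = 0"
  by (simp_all add: herm_def vec_apply)

lemma herm_cnj: "cnj (herm X v w) = herm X w v"
  by (simp add: herm_def mult.commute)

lemma herm_eq_0_commute: "herm X v w = 0 \<longleftrightarrow> herm X w v = 0"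
  by (metis complex_cnj_zero herm_cnj)

lemma herm_self_eq_0:
  assumes "finite X" "v \<in> std_module X" "herm X v v = 0"
  shows "v = 0"
proof -
  have "herm X v v = of_real (\<Sum>y\<in>X. (cmod (v y))\<^sup>2)"
    unfolding herm_def by (simp add: complex_norm_square del: of_real_power)
  hence "(\<Sum>y\<in>X. (cmod (v y))\<^sup>2) = 0" using assms(3) by (metis of_real_eq_0_iff)
  hence "\<forall>y\<in>X. v y = 0" using assms(1) by (simp add: sum_nonneg_eq_0_iff)
  thus ?thesis using assms(2) by (auto simp: std_module_def vec_apply fun_eq_iff)
qed

lemma subspace_herm_ortho: "cfun.subspace {v. \<forall>w\<in>U. herm X v w = 0}"
  by (auto simp: cfun.subspace_def herm_add_left herm_scale_left)

lemma herm_ortho_span: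
  assumes "\<And>w. w \<in> B \<Longrightarrow> herm X v w = 0" "w \<in> cfun.span B"
  shows "herm X v w = 0"
  using assms(2)
  by (induction rule: cfun.span_induct_alt) (auto simp: herm_add_right herm_scale_right assms(1))

lemma orthogonal_decomposition_span:
  assumes "finite X" "finite B" "B \<subseteq> std_module X"
  shows "\<exists>u\<in>cfun.span B. \<forall>w\<in>cfun.span B. herm X (v - u) w = 0"
  using assms(2,3)
proof (induction B arbitrary: v rule: finite_induct)
  case empty
  show ?case by simp
next
  case (insert b B)
  obtain p where p: "p \<in> cfun.span B" "\<forall>w\<in>cfun.span B. herm X (b - p) w = 0"
    using insert by blast
  obtain u where u: "u \<in> cfun.span B" "\<forall>w\<in>cfun.span B. herm X (v - u) w = 0"
    using insert by blast
  define b' where "b' = b - p"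
  \<comment> \<open>Gram-Schmidt step. If \<open>b\<close> already lies in the span of
    \<open>B\<close>, then \<open>b'\<close> is 0 and the value of the quotient is
    irrelevant.\<close>
  define c where "c = herm X v b' / herm X b' b'"
  have sub: "cfun.span B \<subseteq> std_module X"
    using insert.prems by (intro cfun.span_minimal subspace_std_module) auto
  have b'std: "b' \<in> std_module X"
    unfolding b'_def using p sub insert.prems subspace_std_module
    by (intro cfun.subspace_diff) auto
  have zero: "herm X w b' = 0" if "w \<in> cfun.span B" for w
    using p that herm_eq_0_commute unfolding b'_def by blast
  have vb: "herm X (v - (u + cscale c b')) b' = 0"
  proof (cases "herm X b' b' = 0")
    case True
    hence "b' = 0" using herm_self_eq_0 assms b'std by blast
    thus ?thesis by simp
  next
    case False
    thus ?thesis
      by (simp add: herm_diff_left herm_add_left herm_scale_left zero[OF u(1)] c_def)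
  qed
  have vB: "herm X (v - (u + cscale c b')) w = 0" if "w \<in> cfun.span B" for w
    using u p that
    by (simp add: herm_diff_left herm_add_left herm_scale_left b'_def)
  have "b = b' + p" by (simp add: b'_def)
  hence ins: "herm X (v - (u + cscale c b')) b = 0"
    using vb vB p(1) by (metis add_0 herm_add_right)
  have mono: "cfun.span B \<subseteq> cfun.span (insert b B)" by (simp add: cfun.span_mono subset_insertI)
  have b'in: "b' \<in> cfun.span (insert b B)"
    unfolding b'_def using p mono by (intro cfun.span_diff) (auto intro: cfun.span_base)
  have "u + cscale c b' \<in> cfun.span (insert b B)"
    using u mono b'in by (intro cfun.span_add cfun.span_scale) auto
  moreover have "\<forall>w\<in>cfun.span (insert b B). herm X (v - (u + cscale c b')) w = 0"
    using ins vB[OF cfun.span_base] herm_ortho_span[where B = "insert b B"] by blast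
  ultimately show ?case by blast
qed

lemma orth_proj_eqI:
  assumes "finite X" "cfun.subspace U" "U \<subseteq> std_module X"
    and "u \<in> U" "\<And>w. w \<in> U \<Longrightarrow> herm X (v - u) w = 0"
  shows "orth_proj X U v = u"
  unfolding orth_proj_def
proof (rule the_equality)
  show "u \<in> U \<and> (\<forall>w\<in>U. herm X (v - u) w = 0)" using assms by blast
  fix u' assume u': "u' \<in> U \<and> (\<forall>w\<in>U. herm X (v - u') w = 0)"
  have d: "u' - u \<in> U" using u' assms by (blast intro: cfun.subspace_diff)
  have "herm X ((v - u) - (v - u')) (u' - u) = 0"
    using u' d assms by (simp add: herm_diff_left)
  hence "herm X (u' - u) (u' - u) = 0" by simp
  hence "u' - u = 0" using herm_self_eq_0 d assms by blast
  thus "u' = u" by simp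
qed

lemma orth_proj:
  assumes "finite X" "cfun.subspace U" "U \<subseteq> std_module X"
  shows orth_proj_in: "orth_proj X U v \<in> U"
    and orth_proj_ortho: "w \<in> U \<Longrightarrow> herm X (v - orth_proj X U v) w = 0"
proof -
  obtain B where B: "finite B" "B \<subseteq> U" "cfun.span B = U"
    by (rule finite_basis_std_subspace[OF assms])
  obtain u where u: "u \<in> U" "\<forall>w\<in>U. herm X (v - u) w = 0"
    using orthogonal_decomposition_span[of X B v] B assms by auto
  have "orth_proj X U v = u" by (rule orth_proj_eqI) (use assms u in auto)
  thus "orth_proj X U v \<in> U" "w \<in> U \<Longrightarrow> herm X (v - orth_proj X U v) w = 0"
    using u by auto
qed

lemma is_basis_familyI:
  assumes fin: "finite I" and span: "cfun.span (f ` I) = U"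
    and indep: "\<And>c. (\<Sum>i\<in>I. cscale (c i) (f i)) = 0 \<Longrightarrow> \<forall>i\<in>I. c i = 0"
  shows "is_basis_family f I U"
proof -
  have inj: "inj_on f I"
  proof (rule inj_onI, rule ccontr)
    fix a b assume ab: "a \<in> I" "b \<in> I" "f a = f b" "a \<noteq> b"
    define c where "c = (\<lambda>i. if i = a then 1 else if i = b then -1 else (0::complex))"
    have "(\<Sum>i\<in>I. cscale (c i) (f i)) = (\<Sum>i\<in>{a,b}. cscale (c i) (f i))"
      using ab fin by (intro sum.mono_neutral_right) (auto simp: c_def vec_apply fun_eq_iff)
    also have "\<dots> = 0" using ab by (simp add: c_def vec_apply fun_eq_iff)
    finally have "c a = 0" using indep ab by blast
    thus False by (simp add: c_def)
  qed
  have "\<not> cfun.dependent (f ` I)"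
  proof
    assume "cfun.dependent (f ` I)"
    then obtain u where u: "\<exists>v\<in>f ` I. u v \<noteq> 0" "(\<Sum>v\<in>f ` I. cscale (u v) v) = 0"
      unfolding cfun.dependent_finite[OF finite_imageI[OF fin]] by blast
    have "(\<Sum>i\<in>I. cscale (u (f i)) (f i)) = 0"
      using u(2) by (simp add: sum.reindex inj)
    thus False using indep[of "u \<circ> f"] u(1) by auto
  qed
  thus ?thesis using inj span by (simp add: is_basis_family_def)
qed

section \<open>Linear operators and eigenvector decompositions\<close>

abbreviation clinear :: "(('p \<Rightarrow> complex) \<Rightarrow> ('p \<Rightarrow> complex)) \<Rightarrow> bool" where
  "clinear \<equiv> Vector_Spaces.linear cscale cscale"

lemma clinearI:
  assumes "\<And>v w. F (v + w) = F v + F w" "\<And>c v. F (cscale c v) = cscale c (F v)"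
  shows "clinear F"
  by unfold_locales (use assms in auto)

lemma
  assumes "clinear F"
  shows clinear_add: "F (v + w) = F v + F w"
    and clinear_scale: "F (cscale c v) = cscale c (F v)"
    and clinear_diff: "F (v - w) = F v - F w"
    and clinear_0: "F 0 = 0"
    and clinear_sum: "F (\<Sum>i\<in>I. g i) = (\<Sum>i\<in>I. F (g i))"
  using assms by (auto simp: Vector_Spaces.linear.axioms linear_iff_module_hom module_hom.add module_hom.scale
      module_hom.diff module_hom.zero module_hom.sum)

lemma clinear_span_into:
  assumes "clinear F" "cfun.subspace U" "\<And>b. b \<in> B \<Longrightarrow> F b \<in> U" "w \<in> cfun.span B"
  shows "F w \<in> U"
  using assms(4)
  by (induction rule: cfun.span_induct_alt)
    (auto simp: clinear_add clinear_scale clinear_0 assms cfun.subspace_0 intro!: cfun.subspace_add cfun.subspace_scale)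

text \<open>Each factor F - \<theta> n lowers the filtration by one step, so the product of all of
  them kills \<open>w\<close>; as the \<theta> n are distinct, \<open>w\<close> splits into
  eigenvectors. Invariance of \<open>W\<close> keeps the components in \<open>W\<close>, although
  the sets \<open>P n\<close> need not lie in \<open>W\<close>. The lemma serves adjacency on spans
  of eigenspaces and on \<open>Fil\<close>, and \<open>wt\<close> on levels.\<close>

lemma filtration_eigen_decomposition:
  fixes P :: "nat \<Rightarrow> ('p \<Rightarrow> complex) set" and \<theta> :: "nat \<Rightarrow> complex"
  assumes lin: "clinear F" and sub: "cfun.subspace W" and inv: "\<And>w. w \<in> W \<Longrightarrow> F w \<in> W"
    and P0: "P 0 \<subseteq> {0}"
    and step: "\<And>n w. n < m \<Longrightarrow> w \<in> P (Suc n) \<Longrightarrow> F w - cscale (\<theta> n) w \<in> P n"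
    and inj: "inj_on \<theta> {..<m}" and w: "w \<in> W" "w \<in> P m"
  shows "\<exists>u. (\<forall>i<m. u i \<in> W \<and> F (u i) = cscale (\<theta> i) (u i)) \<and> w = (\<Sum>i<m. u i)"
  using step inj w
proof (induction m arbitrary: w)
  case 0
  thus ?case using P0 by auto
next
  case (Suc n)
  define v where "v = F w - cscale (\<theta> n) w"
  have "v \<in> W" "v \<in> P n"
    using Suc.prems inv sub unfolding v_def by (auto intro!: cfun.subspace_diff cfun.subspace_scale)
  moreover have "inj_on \<theta> {..<n}"
    using Suc.prems(2) by (rule inj_on_subset) auto
  ultimately obtain u where u: "\<And>i. i < n \<Longrightarrow> u i \<in> W" "\<And>i. i < n \<Longrightarrow> F (u i) = cscale (\<theta> i) (u i)"
    "v = (\<Sum>i<n. u i)"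
    using Suc.IH[of v] Suc.prems(1) by (metis less_SucI)
  have ne: "\<theta> i \<noteq> \<theta> n" if "i < n" for i
    using Suc.prems(2) that by (auto simp: inj_on_def)
  \<comment> \<open>The sum of the \<open>u' i\<close> is a preimage of \<open>v\<close> under F -
    \<theta> n, so \<open>z\<close> is left in the eigenspace of \<theta> n.\<close>
  define u' where "u' = (\<lambda>i. cscale (1 / (\<theta> i - \<theta> n)) (u i))"
  define z where "z = w - (\<Sum>i<n. u' i)"
  have u'W: "u' i \<in> W" if "i < n" for i
    using that u sub by (simp add: u'_def cfun.subspace_scale)
  have u'e: "F (u' i) = cscale (\<theta> i) (u' i)" if "i < n" for i
    using that u lin by (simp add: u'_def clinear_scale mult.commute)
  have "F (u' i) - cscale (\<theta> n) (u' i) = u i" if "i < n" for i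
  proof -
    have "F (u' i) - cscale (\<theta> n) (u' i) = cscale ((\<theta> i - \<theta> n) * (1 / (\<theta> i - \<theta> n))) (u i)"
      unfolding u'e[OF that] cfun.scale_left_diff_distrib[symmetric] by (simp add: u'_def)
    thus ?thesis using ne[OF that] by simp
  qed
  hence "(\<Sum>i<n. F (u' i) - cscale (\<theta> n) (u' i)) = v"
    using u(3) by simp
  hence "F z - cscale (\<theta> n) z = 0"
    unfolding z_def using lin
    by (simp add: clinear_diff clinear_sum cfun.scale_right_diff_distrib cfun.scale_sum_right
        sum_subtractf v_def algebra_simps)
  hence ze: "F z = cscale (\<theta> n) z" by simp
  have zW: "z \<in> W"
    unfolding z_def using Suc.prems sub u'W by (auto intro!: cfun.subspace_diff cfun.subspace_sum)
  have "w = (\<Sum>i<Suc n. (if i = n then z else u' i))"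
    by (simp add: z_def)
  thus ?case using ze zW u'W u'e
    by (intro exI[of _ "\<lambda>i. if i = n then z else u' i"]) (auto simp: less_Suc_eq)
qed

section \<open>Modules of the Terwilliger algebra\<close>

locale terwilliger_graph =
  fixes X :: "'p set" and R :: "('p \<times> 'p) set" and D :: nat and \<theta> :: "nat \<Rightarrow> real" and x :: 'p
  assumes finite_X: "finite X"
    and R_subset: "R \<subseteq> X \<times> X"
    and sym_R: "sym R"
    and gdist_le: "\<And>y. y \<in> X \<Longrightarrow> gdist R x y \<le> D"
    and gdist_adj: "\<And>y z. (y, z) \<in> R \<Longrightarrow> gdist R x y \<le> Suc (gdist R x z)"
    and inj_\<theta>: "inj_on \<theta> {..D}"
    and spectral: "std_module X \<subseteq> cfun.span (\<Union>i\<le>D. eigenspace X R (complex_of_real (\<theta> i)))"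
begin

definition A :: "('p \<Rightarrow> complex) \<Rightarrow> 'p \<Rightarrow> complex" where
  "A = mat_vec X (adj_mat R)"

definition Es :: "nat \<Rightarrow> ('p \<Rightarrow> complex) \<Rightarrow> 'p \<Rightarrow> complex" where
  "Es i = mat_vec X (dual_idem X R x i)"

abbreviation "Tmod \<equiv> T_module X R D x"
abbreviation "irred \<equiv> irred_T_module X R D x"

definition eigvec :: "nat \<Rightarrow> ('p \<Rightarrow> complex) \<Rightarrow> bool" where
  "eigvec i v \<longleftrightarrow> A v = cscale (complex_of_real (\<theta> i)) v"

lemma A_apply: "A v y = (\<Sum>z | (y, z) \<in> R. v z)"
proof -
  have "A v y = (\<Sum>z\<in>X. if (y, z) \<in> R then v z else 0)"
    unfolding A_def mat_vec_def adj_mat_def by (intro sum.cong) auto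
  also have "\<dots> = (\<Sum>z | z \<in> X \<and> (y, z) \<in> R. v z)"
    using finite_X by (simp add: sum.inter_filter)
  also have "{z. z \<in> X \<and> (y, z) \<in> R} = {z. (y, z) \<in> R}" using R_subset by auto
  finally show ?thesis .
qed

lemma Es_apply: "Es i v y = (if y \<in> X \<and> gdist R x y = i then v y else 0)"
proof -
  have "Es i v y = (\<Sum>z\<in>X. if y = z then (if gdist R x y = i then v y else 0) else 0)"
    unfolding Es_def mat_vec_def dual_idem_def by (intro sum.cong) auto
  thus ?thesis using finite_X by (auto simp: sum.delta')
qed

lemma clinear_mat_vec: "clinear (mat_vec X M)"
  by (rule clinearI) (auto simp: mat_vec_def vec_apply fun_eq_iff algebra_simps sum.distrib sum_distrib_left)

lemma clinear_A: "clinear A" and clinear_Es: "clinear (Es i)"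
  by (simp_all add: A_def Es_def clinear_mat_vec)

lemma A_std: "A v \<in> std_module X"
  using R_subset by (auto simp: std_module_def A_apply intro!: sum.neutral)

lemma Es_std: "Es i v \<in> std_module X"
  by (auto simp: std_module_def Es_apply)

lemma sum_Es:
  assumes "v \<in> std_module X"
  shows "v = (\<Sum>i\<le>D. Es i v)"
proof
  fix y
  show "v y = (\<Sum>i\<le>D. Es i v) y"
    using assms gdist_le[of y]
    by (cases "y \<in> X") (simp_all add: sum_apply Es_apply std_module_def)
qed

lemma herm_A: "herm X (A v) w = herm X v (A w)"
proof -
  have "herm X (A v) w = (\<Sum>y\<in>X. \<Sum>z\<in>X. (if (y, z) \<in> R then v z * cnj (w y) else 0))"
    unfolding herm_def A_def mat_vec_def adj_mat_def sum_distrib_right by (intro sum.cong refl) auto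
  also have "\<dots> = (\<Sum>z\<in>X. \<Sum>y\<in>X. (if (z, y) \<in> R then v z * cnj (w y) else 0))"
    using sym_R by (subst sum.swap) (intro sum.cong refl, auto dest: symD)
  also have "\<dots> = herm X v (A w)"
    unfolding herm_def A_def mat_vec_def adj_mat_def cnj_sum sum_distrib_left
    by (intro sum.cong refl) auto
  finally show ?thesis .
qed

lemma herm_Es: "herm X (Es i v) w = herm X v (Es i w)"
  unfolding herm_def by (intro sum.cong) (auto simp: Es_apply)

lemma T_module_iff:
  "Tmod W \<longleftrightarrow> cfun.subspace W \<and> W \<subseteq> std_module X \<and> (\<forall>w\<in>W. A w \<in> W) \<and> (\<forall>i\<le>D. \<forall>w\<in>W. Es i w \<in> W)"
proof
  assume "Tmod W"
  thus "cfun.subspace W \<and> W \<subseteq> std_module X \<and> (\<forall>w\<in>W. A w \<in> W) \<and> (\<forall>i\<le>D. \<forall>w\<in>W. Es i w \<in> W)"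
    unfolding T_module_def A_def Es_def using terwilliger.adj terwilliger.dual by metis
next
  assume W: "cfun.subspace W \<and> W \<subseteq> std_module X \<and> (\<forall>w\<in>W. A w \<in> W) \<and> (\<forall>i\<le>D. \<forall>w\<in>W. Es i w \<in> W)"
  have "mat_vec X M w \<in> W" if "M \<in> terwilliger X R D x" "w \<in> W" for M w
    using that
  proof (induction arbitrary: w rule: terwilliger.induct)
    case adj
    thus ?case using W by (simp add: A_def)
  next
    case (dual i)
    thus ?case using W by (simp add: Es_def)
  next
    case (add M M')
    have "mat_vec X (\<lambda>y z. M y z + M' y z) w = mat_vec X M w + mat_vec X M' w"
      by (simp add: mat_vec_def fun_eq_iff vec_apply algebra_simps sum.distrib)
    thus ?case using add W by (metis cfun.subspace_add)
  next
    case (scale M c)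
    have "mat_vec X (\<lambda>y z. c * M y z) w = cscale c (mat_vec X M w)"
      by (simp add: mat_vec_def fun_eq_iff vec_apply algebra_simps sum_distrib_left)
    thus ?case using scale W by (metis cfun.subspace_scale)
  next
    case (mult M M')
    have "mat_vec X (mat_mult X M M') w y = mat_vec X M (mat_vec X M' w) y" for y
      unfolding mat_vec_def mat_mult_def sum_distrib_right sum_distrib_left
      by (subst sum.swap) (simp add: mult.assoc)
    hence "mat_vec X (mat_mult X M M') w = mat_vec X M (mat_vec X M' w)" by auto
    thus ?case using mult by metis
  qed
  thus "Tmod W" using W unfolding T_module_def by blast
qed

lemma
  assumes "Tmod W"
  shows T_module_subspace: "cfun.subspace W"
    and T_module_std: "W \<subseteq> std_module X"
    and T_module_A: "w \<in> W \<Longrightarrow> A w \<in> W"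
    and T_module_Es: "w \<in> W \<Longrightarrow> Es i w \<in> W"
proof -
  show "cfun.subspace W" "W \<subseteq> std_module X" "w \<in> W \<Longrightarrow> A w \<in> W"
    using assms by (auto simp: T_module_iff)
  show "Es i w \<in> W" if "w \<in> W"
  proof (cases "i \<le> D")
    case True
    thus ?thesis using assms that by (auto simp: T_module_iff)
  next
    case False
    hence "Es i w = 0" using gdist_le by (auto simp: fun_eq_iff Es_apply vec_apply)
    thus ?thesis using assms by (simp add: T_module_iff cfun.subspace_0)
  qed
qed

text \<open>The generators \<open>A\<close> and \<open>Es i\<close> are self-adjoint, so orthogonal
  complements are stable under them.\<close>

lemma T_module_ortho:
  assumes W: "Tmod W" and U: "Tmod U"
  shows "Tmod {w \<in> W. \<forall>u\<in>U. herm X w u = 0}"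
proof -
  have "cfun.subspace (W \<inter> {w. \<forall>u\<in>U. herm X w u = 0})"
    by (intro cfun.subspace_inter T_module_subspace W subspace_herm_ortho)
  thus ?thesis
    using W U unfolding T_module_iff by (auto simp: herm_A herm_Es Int_def)
qed

lemma irred_exists:
  assumes "Tmod M" "M \<noteq> {0}"
  obtains W where "irred W" "W \<subseteq> M"
proof -
  define Q where "Q W \<longleftrightarrow> Tmod W \<and> W \<noteq> {0} \<and> W \<subseteq> M" for W
  have "Q M" using assms by (simp add: Q_def)
  then obtain W where W: "Q W" "\<And>U. Q U \<Longrightarrow> cfun.dim W \<le> cfun.dim U"
    using arg_min_nat_lemma[of Q M cfun.dim] by blast
  have "U = {0} \<or> U = W" if "Tmod U" "U \<subseteq> W" for U
  proof (rule ccontr)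
    assume *: "\<not> (U = {0} \<or> U = W)"
    hence "cfun.dim U < cfun.dim W"
      using dim_psubset_std[OF finite_X] that W(1) unfolding Q_def
      by (meson T_module_std T_module_subspace psubsetI)
    moreover have "Q U" using * that W(1) by (auto simp: Q_def)
    ultimately show False using W(2) by fastforce
  qed
  hence "irred W" using W(1) by (simp add: Q_def irred_T_module_def)
  thus thesis using that W(1) by (auto simp: Q_def)
qed

lemma T_module_span_Union:
  assumes "\<And>W. W \<in> \<W> \<Longrightarrow> Tmod W"
  shows "Tmod (cfun.span (\<Union>\<W>))"
  unfolding T_module_iff
proof (intro conjI ballI allI impI)
  show "cfun.subspace (cfun.span (\<Union>\<W>))" by simp
  show "cfun.span (\<Union>\<W>) \<subseteq> std_module X"
    using assms T_module_std by (intro cfun.span_minimal subspace_std_module) blast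
  show "A w \<in> cfun.span (\<Union>\<W>)" if "w \<in> cfun.span (\<Union>\<W>)" for w
    by (rule clinear_span_into[OF clinear_A _ _ that])
      (auto intro: cfun.span_base dest: T_module_A[OF assms])
  show "Es i w \<in> cfun.span (\<Union>\<W>)" if "w \<in> cfun.span (\<Union>\<W>)" for i w
    by (rule clinear_span_into[OF clinear_Es _ _ that])
      (auto intro: cfun.span_base dest: T_module_Es[OF assms])
qed

text \<open>If the irreducible submodules spanned only a proper part \<open>K\<close>, the
  orthogonal complement of \<open>K\<close> in \<open>S\<close> would be a nonzero module and
  contain an irreducible one, which lies in \<open>K\<close> and is thus orthogonal to
  itself.\<close>

lemma completely_reducible:
  assumes S: "Tmod S"
  shows "S \<subseteq> cfun.span (\<Union>{W. irred W \<and> W \<subseteq> S})"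
proof (rule ccontr)
  define K where "K = cfun.span (\<Union>{W. irred W \<and> W \<subseteq> S})"
  assume "\<not> S \<subseteq> cfun.span (\<Union>{W. irred W \<and> W \<subseteq> S})"
  then obtain v where v: "v \<in> S" "v \<notin> K" by (auto simp: K_def)
  have K: "Tmod K" unfolding K_def by (rule T_module_span_Union) (simp add: irred_T_module_def)
  have KS: "K \<subseteq> S"
    unfolding K_def by (intro cfun.span_minimal) (auto simp: T_module_subspace[OF S])
  define M where "M = {w \<in> S. \<forall>u\<in>K. herm X w u = 0}"
  have M: "Tmod M" unfolding M_def by (rule T_module_ortho[OF S K])
  let ?p = "orth_proj X K v"
  note orth_proj_in = orth_proj_in[OF finite_X T_module_subspace[OF K] T_module_std[OF K], of v]
  have "v - ?p \<in> M"
    unfolding M_def using v orth_proj_in KS orth_proj_ortho[OF finite_X T_module_subspace[OF K] T_module_std[OF K]]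
    by (auto intro!: cfun.subspace_diff[OF T_module_subspace[OF S]])
  moreover have "v - ?p \<noteq> 0" using v orth_proj_in by auto
  ultimately have "M \<noteq> {0}" by blast
  then obtain W where W: "irred W" "W \<subseteq> M" using irred_exists[OF M] by blast
  have "W \<in> {W. irred W \<and> W \<subseteq> S}" using W by (auto simp: M_def)
  hence "W \<subseteq> K" unfolding K_def by (meson Union_upper cfun.span_superset order_trans)
  have "w = 0" if "w \<in> W" for w
  proof (rule herm_self_eq_0[OF finite_X])
    show "w \<in> std_module X" using that W T_module_std by (auto simp: irred_T_module_def)
    show "herm X w w = 0" using that W \<open>W \<subseteq> K\<close> by (auto simp: M_def)
  qed
  moreover have "0 \<in> W" using W cfun.subspace_0 T_module_subspace by (auto simp: irred_T_module_def)
  ultimately have "W = {0}" by blast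
  thus False using W by (simp add: irred_T_module_def)
qed

text \<open>On the span of the first n + 1 eigenspaces, subtracting \<theta> n removes the last one;
  this is the filtration. The gain over \<open>spectral\<close> is that the components stay in
  \<open>W\<close>.\<close>

lemma eigen_decomposition:
  assumes W: "Tmod W" and w: "w \<in> W"
  shows "\<exists>u. (\<forall>i\<le>D. u i \<in> W \<and> eigvec i (u i)) \<and> w = (\<Sum>i\<le>D. u i)"
proof -
  define P where "P n = cfun.span (\<Union>i<n. eigenspace X R (complex_of_real (\<theta> i)))" for n
  have "\<exists>u. (\<forall>i<Suc D. u i \<in> W \<and> A (u i) = cscale (complex_of_real (\<theta> i)) (u i)) \<and> w = (\<Sum>i<Suc D. u i)"
  proof (rule filtration_eigen_decomposition[where P = P])
    show "w \<in> P (Suc D)"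
      unfolding P_def lessThan_Suc_atMost using w W spectral T_module_std by blast
    show "A v - cscale (complex_of_real (\<theta> n)) v \<in> P n" if "n < Suc D" "v \<in> P (Suc n)" for n v
    proof -
      have lin: "clinear (\<lambda>v. A v - cscale (complex_of_real (\<theta> n)) v)"
        by (rule clinearI) (auto simp: clinear_add[OF clinear_A] clinear_scale[OF clinear_A]
            cfun.scale_right_distrib cfun.scale_right_diff_distrib mult.commute)
      show ?thesis
        unfolding P_def
      proof (rule clinear_span_into[OF lin cfun.subspace_span _ that(2)[unfolded P_def]])
        fix b assume "b \<in> (\<Union>i<Suc n. eigenspace X R (complex_of_real (\<theta> i)))"
        then obtain i where i: "i < Suc n" "b \<in> eigenspace X R (complex_of_real (\<theta> i))" by blast
        hence Ab: "A b = cscale (complex_of_real (\<theta> i)) b" by (simp add: eigenspace_def A_def)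
        show "A b - cscale (complex_of_real (\<theta> n)) b
            \<in> cfun.span (\<Union>i<n. eigenspace X R (complex_of_real (\<theta> i)))"
        proof (cases "i = n")
          case True
          thus ?thesis using Ab by (simp add: cfun.span_zero)
        next
          case False
          hence "b \<in> cfun.span (\<Union>i<n. eigenspace X R (complex_of_real (\<theta> i)))"
            using i by (intro cfun.span_base) auto
          thus ?thesis unfolding Ab by (intro cfun.span_diff cfun.span_scale)
        qed
      qed
    qed
    show "inj_on (\<lambda>i. complex_of_real (\<theta> i)) {..<Suc D}"
      using inj_\<theta> by (auto simp: inj_on_def lessThan_Suc_atMost)
  qed (use W w clinear_A in \<open>auto simp: T_module_iff P_def\<close>)
  thus ?thesis by (simp add: eigvec_def lessThan_Suc_atMost less_Suc_eq_le)
qed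

section \<open>Supports, dual supports and displacement\<close>

lemma eigvec_ortho:
  assumes "eigvec i v" "eigvec j w" "i \<le> D" "j \<le> D" "i \<noteq> j"
  shows "herm X v w = 0"
proof -
  have "\<theta> i * herm X v w = \<theta> j * herm X v w"
    using herm_A[of v w] assms by (simp add: eigvec_def herm_scale_left herm_scale_right)
  moreover have "\<theta> i \<noteq> \<theta> j" using inj_\<theta> assms by (auto simp: inj_on_def)
  ultimately show ?thesis by simp
qed

lemma herm_sum_left: "herm X (\<Sum>i\<in>I. f i) w = (\<Sum>i\<in>I. herm X (f i) w)"
  by (induction I rule: infinite_finite_induct) (auto simp: herm_add_left)

text \<open>The eigencomponents of a vector of \<open>W\<close> lie in \<open>W\<close> and are
  mutually orthogonal, so projecting \<open>W\<close> to an eigenspace yields just the eigenvectors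
  in \<open>W\<close>. From here on \<open>orth_proj\<close> is traded for eigenvectors.\<close>

lemma dual_support_eq:
  assumes W: "Tmod W"
  shows "dual_support X R D \<theta> W = {i. i \<le> D \<and> (\<exists>f\<in>W. f \<noteq> 0 \<and> eigvec i f)}"
proof -
  have main: "orth_proj X (eigenspace X R (complex_of_real (\<theta> i))) ` W = {f \<in> W. eigvec i f}"
    if i: "i \<le> D" for i
  proof -
    let ?E = "eigenspace X R (complex_of_real (\<theta> i))"
    have E: "?E = {v \<in> std_module X. eigvec i v}" by (simp add: eigenspace_def eigvec_def A_def)
    have sub: "cfun.subspace ?E"
      unfolding E eigvec_def cfun.subspace_def using subspace_std_module
      by (auto simp: clinear_add[OF clinear_A] clinear_scale[OF clinear_A] clinear_0[OF clinear_A]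
          cfun.scale_right_distrib mult.commute intro: cfun.subspace_add cfun.subspace_0 cfun.subspace_scale)
    have EX: "?E \<subseteq> std_module X" by (auto simp: E)
    have proj: "orth_proj X ?E (\<Sum>j\<le>D. u j) = u i"
      if u: "\<forall>j\<le>D. u j \<in> W \<and> eigvec j (u j)" for u
    proof (rule orth_proj_eqI[OF finite_X sub EX])
      show "u i \<in> ?E" using u i T_module_std[OF W] by (auto simp: E)
      fix w assume w: "w \<in> ?E"
      have "(\<Sum>j\<le>D. u j) - u i = (\<Sum>j\<in>{..D} - {i}. u j)"
        using i by (simp add: sum_diff1)
      moreover have "herm X (\<Sum>j\<in>{..D} - {i}. u j) w = 0"
        unfolding herm_sum_left using u w i by (intro sum.neutral) (auto simp: E intro: eigvec_ortho)
      ultimately show "herm X ((\<Sum>j\<le>D. u j) - u i) w = 0" by simp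
    qed
    show ?thesis
    proof (intro set_eqI iffI)
      fix f assume "f \<in> orth_proj X ?E ` W"
      then obtain w where "w \<in> W" "f = orth_proj X ?E w" by blast
      then obtain u where "\<forall>j\<le>D. u j \<in> W \<and> eigvec j (u j)" "f = u i"
        using eigen_decomposition[OF W] proj by metis
      thus "f \<in> {f \<in> W. eigvec i f}" using i by blast
    next
      fix f assume f: "f \<in> {f \<in> W. eigvec i f}"
      hence "orth_proj X ?E f = f"
        using T_module_std[OF W] by (intro orth_proj_eqI[OF finite_X sub EX]) (auto simp: E)
      thus "f \<in> orth_proj X ?E ` W" using f by (metis (lifting) image_eqI mem_Collect_eq)
    qed
  qed
  have "0 \<in> {f \<in> W. eigvec i f}" for i
    using W cfun.subspace_0 by (auto simp: T_module_iff eigvec_def clinear_0[OF clinear_A])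
  hence "{f \<in> W. eigvec i f} \<noteq> {0} \<longleftrightarrow> (\<exists>f\<in>W. f \<noteq> 0 \<and> eigvec i f)" for i by blast
  thus ?thesis unfolding dual_support_def using main by (simp cong: conj_cong)
qed

lemma support_eq:
  assumes W: "Tmod W"
  shows "support X R D x W = {i. i \<le> D \<and> (\<exists>w\<in>W. Es i w \<noteq> 0)}"
proof -
  have "0 \<in> Es i ` W" for i
    using T_module_subspace[OF W] clinear_0[OF clinear_Es, of i] cfun.subspace_0 by (metis imageI)
  thus ?thesis unfolding support_def Es_def by blast
qed

lemma finite_support: "finite (support X R D x W)" "finite (dual_support X R D \<theta> W)"
  by (rule finite_subset[of _ "{..D}"], auto simp: support_def dual_support_def)+

lemma support_nonempty:
  assumes "irred W"
  shows "support X R D x W \<noteq> {}" "dual_support X R D \<theta> W \<noteq> {}"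
proof -
  have W: "Tmod W" using assms by (simp add: irred_T_module_def)
  have "0 \<in> W" using cfun.subspace_0[OF T_module_subspace[OF W]] .
  then obtain w where w: "w \<in> W" "w \<noteq> 0" using assms by (auto simp: irred_T_module_def)
  have "w = (\<Sum>i\<le>D. Es i w)" using sum_Es w T_module_std[OF W] by blast
  then obtain i where "i \<le> D" "Es i w \<noteq> 0" using w by (metis atMost_iff sum.neutral)
  thus "support X R D x W \<noteq> {}" using w by (auto simp: support_eq[OF W])
  obtain u where u: "\<forall>i\<le>D. u i \<in> W \<and> eigvec i (u i)" "w = (\<Sum>i\<le>D. u i)"
    using eigen_decomposition[OF W w(1)] by blast
  then obtain i where "i \<le> D" "u i \<noteq> 0" using w by (metis atMost_iff sum.neutral)
  thus "dual_support X R D \<theta> W \<noteq> {}" using u by (auto simp: dual_support_eq[OF W])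
qed

text \<open>Adjacency changes the distance from \<open>x\<close> by at most one. If distance i were
  skipped, the vectors of \<open>W\<close> vanishing from i outwards would be a proper nonzero
  submodule, since nothing can cross the gap.\<close>

lemma support_interval:
  assumes W: "irred W"
  shows "support X R D x W = {Min (support X R D x W)..Max (support X R D x W)}"
proof -
  let ?S = "support X R D x W"
  have T: "Tmod W" using W by (simp add: irred_T_module_def)
  have mm: "Min ?S \<in> ?S" "Max ?S \<in> ?S"
    using finite_support support_nonempty[OF W] by (auto intro: Min_in Max_in)
  have "i \<in> ?S" if "Min ?S < i" "i < Max ?S" for i
  proof (rule ccontr)
    assume i: "i \<notin> ?S"
    have iD: "i \<le> D" using that mm(2) by (auto simp: support_def)
    define U where "U = {w \<in> W. \<forall>y\<in>X. i \<le> gdist R x y \<longrightarrow> w y = 0}"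
    have zero: "w y = 0" if "w \<in> W" "y \<in> X" "gdist R x y = i" for w y
      using i iD that Es_apply[of i w y] by (auto simp: support_eq[OF T] zero_fun_apply)
    have "Tmod U"
      unfolding T_module_iff
    proof (intro conjI ballI allI impI)
      show "cfun.subspace U"
        using T_module_subspace[OF T] unfolding U_def cfun.subspace_def by (auto simp: vec_apply)
      show "U \<subseteq> std_module X" using T_module_std[OF T] by (auto simp: U_def)
      show "Es j w \<in> U" if "w \<in> U" for j w
        using that T_module_Es[OF T] by (auto simp: U_def Es_apply)
      fix w assume w: "w \<in> U"
      have "A w y = 0" if y: "y \<in> X" "i \<le> gdist R x y" for y
      proof (cases "gdist R x y = i")
        case True
        thus ?thesis using zero T_module_A[OF T] w y by (simp add: U_def)
      next
        case False
        have "w z = 0" if "(y, z) \<in> R" for z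
        proof -
          have "z \<in> X" using that R_subset by auto
          moreover have "i \<le> gdist R x z" using gdist_adj[OF that] False y by simp
          ultimately show ?thesis using w by (simp add: U_def)
        qed
        thus ?thesis by (simp add: A_apply)
      qed
      thus "A w \<in> U" using w T_module_A[OF T] by (simp add: U_def)
    qed
    moreover have "U \<subseteq> W" by (auto simp: U_def)
    ultimately have "U = {0} \<or> U = W" using W by (simp add: irred_T_module_def)
    moreover have "U \<noteq> {0}"
    proof -
      obtain w where "w \<in> W" "Es (Min ?S) w \<noteq> 0" using mm(1) by (auto simp: support_eq[OF T])
      moreover from this have "Es (Min ?S) w \<in> U"
        using T_module_Es[OF T] that by (auto simp: U_def Es_apply)
      ultimately show ?thesis by blast
    qed
    moreover have "U \<noteq> W"
    proof
      assume UW: "U = W"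
      obtain w where w: "w \<in> W" "Es (Max ?S) w \<noteq> 0" using mm(2) by (auto simp: support_eq[OF T])
      have "Es (Max ?S) w = 0"
        using w(1) that unfolding UW[symmetric] by (auto simp: U_def Es_apply fun_eq_iff vec_apply)
      thus False using w by simp
    qed
    ultimately show False by blast
  qed
  hence "{Min ?S..Max ?S} \<subseteq> ?S" using mm by (force simp: le_less)
  thus ?thesis using finite_support by auto
qed

text \<open>Since the support is an interval, endpoint plus diameter is its maximum.\<close>

lemma displacement_eq:
  assumes W: "irred W"
  shows "displacement X R D \<theta> x W =
    int (Max (support X R D x W)) + int (Min (dual_support X R D \<theta> W)) - int D"
proof -
  let ?S = "support X R D x W"
  have "Min ?S \<le> Max ?S" using finite_support support_nonempty[OF W] by (simp add: Min_le_iff)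
  moreover have "card ?S = Suc (Max ?S) - Min ?S"
    by (subst support_interval[OF W]) simp
  ultimately show ?thesis
    by (simp add: displacement_def endpoint_def dual_endpoint_def mod_diameter_def)
qed

text \<open>
  An irreducible module that is not contained in \<open>U\<close> meets \<open>U\<close> trivially, so the projection onto the
  orthogonal complement of \<open>U\<close> is an isomorphism of modules on it.
\<close>

lemma irred_projection:
  assumes W: "irred W" and U: "Tmod U" and WU: "\<not> W \<subseteq> U"
  obtains W' where "irred W'" "\<And>w u. w \<in> W' \<Longrightarrow> u \<in> U \<Longrightarrow> herm X w u = 0"
    "\<And>V. Tmod V \<Longrightarrow> W \<subseteq> V \<Longrightarrow> U \<subseteq> V \<Longrightarrow> W' \<subseteq> V"
    "support X R D x W' = support X R D x W" "dual_support X R D \<theta> W' = dual_support X R D \<theta> W"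
proof -
  have T: "Tmod W" using W by (simp add: irred_T_module_def)
  note Us = T_module_subspace[OF U] and Ws = T_module_subspace[OF T]
  note op = orth_proj_in[OF finite_X Us T_module_std[OF U]]
    orth_proj_ortho[OF finite_X Us T_module_std[OF U]]
  define \<phi> where "\<phi> w = w - orth_proj X U w" for w
  \<comment> \<open>Linearity of \<open>\<phi>\<close> and its commutation with \<open>A\<close> and
    \<open>Es i\<close> all follow from this characterization, because \<open>U\<close> and its
    complement are stable.\<close>
  have uniq: "\<phi> w = v" if "w - v \<in> U" "\<And>u. u \<in> U \<Longrightarrow> herm X v u = 0" for w v
  proof -
    have "orth_proj X U w = w - v"
      by (rule orth_proj_eqI[OF finite_X Us T_module_std[OF U]]) (use that in auto)
    thus ?thesis by (simp add: \<phi>_def)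
  qed
  have d: "w - \<phi> w \<in> U" and o: "u \<in> U \<Longrightarrow> herm X (\<phi> w) u = 0" for w u
    using op by (auto simp: \<phi>_def)
  have lin: "clinear \<phi>"
  proof (rule clinearI)
    fix v w c
    show "\<phi> (v + w) = \<phi> v + \<phi> w"
    proof (rule uniq)
      have "(v - \<phi> v) + (w - \<phi> w) \<in> U" using d Us by (blast intro: cfun.subspace_add)
      thus "v + w - (\<phi> v + \<phi> w) \<in> U" by (simp add: algebra_simps)
    qed (simp add: herm_add_left o)
    show "\<phi> (cscale c v) = cscale c (\<phi> v)"
    proof (rule uniq)
      have "cscale c (v - \<phi> v) \<in> U" using d Us by (blast intro: cfun.subspace_scale)
      thus "cscale c v - cscale c (\<phi> v) \<in> U" by (simp add: cfun.scale_right_diff_distrib)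
    qed (simp add: herm_scale_left o)
  qed
  have \<phi>A: "\<phi> (A w) = A (\<phi> w)" for w
  proof (rule uniq)
    show "A w - A (\<phi> w) \<in> U" using T_module_A[OF U d] by (simp add: clinear_diff[OF clinear_A])
  qed (simp add: herm_A o T_module_A[OF U])
  have \<phi>E: "\<phi> (Es i w) = Es i (\<phi> w)" for i w
  proof (rule uniq)
    show "Es i w - Es i (\<phi> w) \<in> U" using T_module_Es[OF U d] by (simp add: clinear_diff[OF clinear_Es])
  qed (simp add: herm_Es o T_module_Es[OF U])
  have "Tmod (W \<inter> U)"
    using T U by (auto simp: T_module_iff cfun.subspace_inter)
  hence WU0: "W \<inter> U = {0}" using W WU by (auto simp: irred_T_module_def)
  have ker: "w = 0" if "w \<in> W" "\<phi> w = 0" for w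
    using d[of w] that WU0 by auto
  have img: "Tmod (\<phi> ` V)" if V: "Tmod V" for V
    unfolding T_module_iff
  proof (intro conjI ballI allI impI)
    show "cfun.subspace (\<phi> ` V)"
      unfolding cfun.subspace_def
    proof (intro conjI ballI allI)
      show "0 \<in> \<phi> ` V"
        using clinear_0[OF lin] cfun.subspace_0[OF T_module_subspace[OF V]] by (metis imageI)
      show "a + b \<in> \<phi> ` V" if "a \<in> \<phi> ` V" "b \<in> \<phi> ` V" for a b
        using that cfun.subspace_add[OF T_module_subspace[OF V]]
        by (auto simp: clinear_add[OF lin, symmetric])
      show "cscale c a \<in> \<phi> ` V" if "a \<in> \<phi> ` V" for a c
        using that cfun.subspace_scale[OF T_module_subspace[OF V]]
        by (auto simp: clinear_scale[OF lin, symmetric])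
    qed
    show "\<phi> ` V \<subseteq> std_module X"
      using T_module_std[OF V] T_module_std[OF U] op(1) unfolding \<phi>_def
      by (auto intro!: cfun.subspace_diff[OF subspace_std_module])
    show "A w \<in> \<phi> ` V" if "w \<in> \<phi> ` V" for w
      using that T_module_A[OF V] by (auto simp: \<phi>A[symmetric])
    show "Es i w \<in> \<phi> ` V" if "w \<in> \<phi> ` V" for w i
      using that T_module_Es[OF V] by (auto simp: \<phi>E[symmetric])
  qed
  show thesis
  proof
    show "herm X w u = 0" if "w \<in> \<phi> ` W" "u \<in> U" for w u
      using that o by auto
    show "\<phi> ` W \<subseteq> V" if "Tmod V" "W \<subseteq> V" "U \<subseteq> V" for V
      using that op(1) unfolding \<phi>_def by (auto intro!: cfun.subspace_diff[OF T_module_subspace])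
    show "irred (\<phi> ` W)"
      unfolding irred_T_module_def
    proof (intro conjI allI impI)
      show "Tmod (\<phi> ` W)" using img T by blast
      show "\<phi> ` W \<noteq> {0}"
      proof
        assume "\<phi> ` W = {0}"
        hence "W \<subseteq> {0}" using ker by blast
        thus False using WU cfun.subspace_0[OF Us] by auto
      qed
      fix Y assume Y: "Tmod Y \<and> Y \<subseteq> \<phi> ` W"
      \<comment> \<open>Pulling a submodule of the image back to \<open>W\<close> reduces
        irreducibility of the image to that of \<open>W\<close>.\<close>
      define Z where "Z = {w \<in> W. \<phi> w \<in> Y}"
      have YZ: "Y = \<phi> ` Z" using Y by (auto simp: Z_def)
      have "Tmod Z"
        unfolding T_module_iff
      proof (intro conjI ballI allI impI)
        show "cfun.subspace Z"
          using Ws T_module_subspace[of Y] Y unfolding Z_def cfun.subspace_def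
          by (auto simp: clinear_add[OF lin] clinear_scale[OF lin] clinear_0[OF lin])
        show "Z \<subseteq> std_module X" using T_module_std[OF T] by (auto simp: Z_def)
        show "A w \<in> Z" if "w \<in> Z" for w
          using that Y T_module_A T by (auto simp: Z_def \<phi>A)
        show "Es i w \<in> Z" if "w \<in> Z" for w i
          using that Y T_module_Es T by (auto simp: Z_def \<phi>E)
      qed
      hence "Z = {0} \<or> Z = W" using W by (auto simp: irred_T_module_def Z_def)
      thus "Y = {0} \<or> Y = \<phi> ` W" using YZ clinear_0[OF lin] by auto
    qed
    have "Es i (\<phi> w) = 0 \<longleftrightarrow> Es i w = 0" if "w \<in> W" for i w
      using ker[OF T_module_Es[OF T that], of i] clinear_0[OF lin] by (auto simp: \<phi>E[symmetric])
    thus "support X R D x (\<phi> ` W) = support X R D x W"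
      by (auto simp: support_eq[OF T] support_eq[OF img[OF T]])
    have "eigvec i (\<phi> w) \<longleftrightarrow> eigvec i w" if "w \<in> W" for i w
    proof -
      have "\<phi> (A w - cscale (\<theta> i) w) = A (\<phi> w) - cscale (\<theta> i) (\<phi> w)"
        by (simp add: clinear_diff[OF lin] clinear_scale[OF lin] \<phi>A)
      moreover have "A w - cscale (\<theta> i) w \<in> W"
        using that Ws T_module_A[OF T] by (intro cfun.subspace_diff cfun.subspace_scale) auto
      ultimately show ?thesis
        using ker clinear_0[OF lin] unfolding eigvec_def by (metis eq_iff_diff_eq_0)
    qed
    moreover have "\<phi> w = 0 \<longleftrightarrow> w = 0" if "w \<in> W" for w
      using ker[OF that] clinear_0[OF lin] by blast
    ultimately show "dual_support X R D \<theta> (\<phi> ` W) = dual_support X R D \<theta> W"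
      by (auto simp: dual_support_eq[OF T] dual_support_eq[OF img[OF T]])
  qed
qed

end

section \<open>Counting subspaces of a finite vector space\<close>

locale finite_vector_space = finite_dimensional_vector_space scale Basis
  for scale :: "'k::{field,finite} \<Rightarrow> 'v::ab_group_add \<Rightarrow> 'v" (infixr \<open>*s\<close> 75) and Basis +
  fixes q :: nat
  assumes q_eq: "q = CARD('k)"
begin

abbreviation join :: "'v set \<Rightarrow> 'v set \<Rightarrow> 'v set" (infixl \<open>\<squnion>\<close> 65) where
  "a \<squnion> b \<equiv> span (a \<union> b)"

definition hyps :: "'v set \<Rightarrow> 'v set \<Rightarrow> 'v set set" where
  "hyps b y = {h. subspace h \<and> b \<subseteq> h \<and> h \<subseteq> y \<and> Suc (dim h) = dim y}"

definition exts :: "'v set \<Rightarrow> 'v set \<Rightarrow> 'v set \<Rightarrow> 'v set set" where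
  "exts x h y = {z. subspace z \<and> h \<subseteq> z \<and> z \<subseteq> y \<and> dim z = Suc (dim h) \<and> z \<inter> x = h \<inter> x}"

lemma q_ge_2: "2 \<le> q"
proof -
  have "card {0, 1 :: 'k} \<le> CARD('k)" by (rule card_mono) auto
  thus ?thesis by (simp add: q_eq)
qed

lemma in_span_scale:
  assumes "k *s p \<in> span b" "k \<noteq> 0"
  shows "p \<in> span b"
  using span_scale[OF assms(1), of "inverse k"] assms(2) by simp

lemma finite_card_span:
  assumes "finite B" "independent B"
  shows "finite (span B) \<and> card (span B) = q ^ card B"
  using assms
proof (induction B rule: finite_induct)
  case empty
  show ?case by simp
next
  case (insert p B)
  hence p: "p \<notin> span B" and IH: "finite (span B)" "card (span B) = q ^ card B"
    by (auto simp: independent_insert)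
  define f where "f = (\<lambda>(k::'k, h). k *s p + h)"
  have inj: "inj_on f (UNIV \<times> span B)"
  proof (rule inj_onI, clarsimp simp: f_def)
    fix k k' h h' assume h: "h \<in> span B" "h' \<in> span B" and eq: "k *s p + h = k' *s p + h'"
    have "(k - k') *s p = h' - h" using eq by (simp add: scale_left_diff_distrib algebra_simps)
    hence "(k - k') *s p \<in> span B" using h span_diff by metis
    hence "k = k'" using p in_span_scale[of "k - k'" p B] by auto
    thus "k = k' \<and> h = h'" using eq by simp
  qed
  have img: "f ` (UNIV \<times> span B) = span (insert p B)"
  proof (intro set_eqI iffI)
    fix v assume "v \<in> f ` (UNIV \<times> span B)"
    then obtain k h where "h \<in> span B" "v = k *s p + h" by (auto simp: f_def)
    thus "v \<in> span (insert p B)" unfolding span_insert by (auto intro: exI[of _ k])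
  next
    fix v assume "v \<in> span (insert p B)"
    then obtain k where "v - k *s p \<in> span B" by (auto simp: span_insert)
    thus "v \<in> f ` (UNIV \<times> span B)"
      by (intro image_eqI[of _ _ "(k, v - k *s p)"]) (auto simp: f_def)
  qed
  have "finite (span (insert p B))" using IH img by (metis finite finite_SigmaI finite_imageI)
  moreover have "card (span (insert p B)) = q * card (span B)"
    using card_image[OF inj] by (simp add: img card_cartesian_product q_eq)
  ultimately show ?case using insert IH by simp
qed

lemma finite_univ: "finite (UNIV :: 'v set)"
  using finite_card_span[OF finite_Basis independent_Basis] span_Basis by simp

lemma finite_sets [simp]: "finite (S :: 'v set)" "finite (\<S> :: 'v set set)"
  using finite_univ by (auto intro: finite_subset[OF subset_UNIV] finite_subset[OF _ finite_Pow_iff[THEN iffD2]])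

lemma card_subspace:
  assumes "subspace S"
  shows "card S = q ^ dim S"
proof -
  obtain B where B: "B \<subseteq> S" "independent B" "S \<subseteq> span B" "card B = dim S"
    by (rule basis_exists)
  have "span B = S" using B span_minimal[OF B(1) assms] by blast
  thus ?thesis using finite_card_span[of B] B by auto
qed

lemma subspace_eqI:
  assumes "subspace a" "subspace b" "a \<subseteq> b" "dim b \<le> dim a"
  shows "a = b"
  using assms by (rule subspace_dim_equal)

lemma dim_join_Int:
  assumes "subspace a" "subspace b"
  shows "dim (a \<squnion> b) + dim (a \<inter> b) = dim a + dim b"
  using dim_sums_Int[OF assms] by (simp add: span_Un span_eq_iff[THEN iffD2] assms)

lemma in_joinE:
  assumes "v \<in> a \<squnion> b" "subspace a" "subspace b"
  obtains u w where "u \<in> a" "w \<in> b" "v = u + w"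
  using assms unfolding span_Un by (auto simp: span_eq_iff[THEN iffD2])

lemma join_least: "subspace c \<Longrightarrow> a \<subseteq> c \<Longrightarrow> b \<subseteq> c \<Longrightarrow> a \<squnion> b \<subseteq> c"
  by (simp add: span_minimal)

lemma join_upper: "a \<subseteq> a \<squnion> b" "b \<subseteq> a \<squnion> b"
  by (auto intro: span_base)

lemma modular_law:
  assumes "subspace a" "subspace b" "subspace c" "b \<subseteq> c"
  shows "(a \<squnion> b) \<inter> c = (a \<inter> c) \<squnion> b"
proof
  show "(a \<squnion> b) \<inter> c \<subseteq> (a \<inter> c) \<squnion> b"
  proof
    fix v assume v: "v \<in> (a \<squnion> b) \<inter> c"
    then obtain u w where uw: "u \<in> a" "w \<in> b" "v = u + w" using assms in_joinE by blast
    hence "u = v - w" by simp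
    hence "u \<in> c" using v uw assms by (metis IntD2 subsetD subspace_diff)
    thus "v \<in> (a \<inter> c) \<squnion> b" using uw by (auto intro: span_add span_base)
  qed
  show "(a \<inter> c) \<squnion> b \<subseteq> (a \<squnion> b) \<inter> c"
    using assms by (intro join_least subspace_inter) (auto intro: span_base)
qed

lemma dim_insert_subspace:
  assumes "subspace h" "p \<notin> h"
  shows "dim (insert p h) = Suc (dim h)"
  using assms by (simp add: dim_insert span_eq_iff[THEN iffD2])

lemma dim_span_insert:
  assumes "subspace h" "p \<notin> h"
  shows "dim (span (insert p h)) = Suc (dim h)"
  using dim_insert_subspace[OF assms] by simp

lemma span_insert_eq:
  assumes "subspace h" "subspace z" "h \<subseteq> z" "dim z \<le> Suc (dim h)" "p \<in> z" "p \<notin> h"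
  shows "span (insert p h) = z"
  using assms span_minimal[of "insert p h" z]
  by (intro subspace_eqI) (simp_all add: dim_insert_subspace)

lemma in_span_insertE:
  assumes "v \<in> span (insert p h)" "subspace h"
  obtains k u where "u \<in> h" "v = k *s p + u"
proof -
  obtain k where "v - k *s p \<in> h" using assms by (auto simp: span_insert span_eq_iff[THEN iffD2])
  thus thesis using that[of "v - k *s p" k] by simp
qed

text \<open>A vector k p + u of \<open>x\<close> with u in \<open>h\<close> and k nonzero puts p
  into the join of \<open>h\<close> and \<open>x\<close>; conversely p = u + w with w in
  \<open>x\<close> puts w into the extended space.\<close>

lemma span_insert_Int_iff:
  assumes h: "subspace h" and x: "subspace x" and p: "p \<notin> h"
  shows "span (insert p h) \<inter> x = h \<inter> x \<longleftrightarrow> p \<notin> h \<squnion> x"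
proof
  assume eq: "span (insert p h) \<inter> x = h \<inter> x"
  show "p \<notin> h \<squnion> x"
  proof
    assume "p \<in> h \<squnion> x"
    then obtain u w where uw: "u \<in> h" "w \<in> x" "p = u + w" using h x in_joinE by blast
    hence "w = p - u" by simp
    moreover have "p \<in> span (insert p h)" "u \<in> span (insert p h)" using uw by (auto intro: span_base)
    ultimately have "w \<in> span (insert p h)" by (simp only: span_diff)
    hence "w \<in> h" using eq uw by blast
    thus False using uw p h by (simp add: subspace_add)
  qed
next
  assume p': "p \<notin> h \<squnion> x"
  have "v \<in> h" if "v \<in> span (insert p h)" "v \<in> x" for v
  proof -
    obtain k u where ku: "u \<in> h" "v = k *s p + u"
      by (rule in_span_insertE[OF \<open>v \<in> span (insert p h)\<close> h])
    have "k = 0"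
    proof (rule ccontr)
      assume "k \<noteq> 0"
      have "k *s p = v - u" using ku by simp
      moreover have "v \<in> h \<squnion> x" "u \<in> h \<squnion> x" using ku(1) that(2) by (auto intro: span_base)
      ultimately have "k *s p \<in> h \<squnion> x" by (simp only: span_diff)
      thus False using p' \<open>k \<noteq> 0\<close> in_span_scale by blast
    qed
    thus ?thesis using ku by simp
  qed
  thus "span (insert p h) \<inter> x = h \<inter> x" by (auto intro: span_base)
qed

lemma of_nat_card_Diff_subspace:
  assumes "subspace a" "subspace b" "a \<subseteq> b"
  shows "real (card (b - a)) = real q ^ dim b - real q ^ dim a"
  using assms dim_subset[of a b] q_ge_2
  by (simp add: card_Diff_subset card_subspace of_nat_diff power_increasing)

text \<open>Removing \<open>h\<close> from the members of \<open>exts x h y\<close> gives a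
  partition of y minus the join of \<open>h\<close> and \<open>x\<close>, with q^(dim h + 1) -
  q^(dim h) vectors in each part.\<close>

lemma card_exts:
  assumes h: "subspace h" and x: "subspace x" and y: "subspace y" and "h \<subseteq> y" "x \<subseteq> y"
  shows "real (card (exts x h y)) * (real q ^ Suc (dim h) - real q ^ dim h) =
    real q ^ dim y - real q ^ dim (h \<squnion> x)"
proof -
  have hx: "h \<squnion> x \<subseteq> y" using assms by (intro join_least) auto
  have "y - (h \<squnion> x) = (\<Union>z\<in>exts x h y. z - h)"
  proof (intro set_eqI iffI)
    fix p assume p: "p \<in> y - (h \<squnion> x)"
    hence ph: "p \<notin> h" by (auto intro: span_base)
    have "span (insert p h) \<in> exts x h y"
      using p ph assms span_insert_Int_iff[OF h x ph]
      by (auto simp: exts_def dim_insert_subspace intro: span_base subsetD[OF span_minimal, rotated 2])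
    moreover have "p \<in> span (insert p h)" by (auto intro: span_base)
    ultimately show "p \<in> (\<Union>z\<in>exts x h y. z - h)" using ph by blast
  next
    fix p assume "p \<in> (\<Union>z\<in>exts x h y. z - h)"
    then obtain z where z: "z \<in> exts x h y" "p \<in> z" "p \<notin> h" by blast
    hence "span (insert p h) = z" using h by (intro span_insert_eq) (auto simp: exts_def)
    hence "p \<notin> h \<squnion> x" using z span_insert_Int_iff[OF h x z(3)] by (simp add: exts_def)
    thus "p \<in> y - (h \<squnion> x)" using z by (auto simp: exts_def)
  qed
  also have "card \<dots> = (\<Sum>z\<in>exts x h y. card (z - h))"
  proof (rule card_UN_disjoint)
    show "\<forall>z\<in>exts x h y. \<forall>z'\<in>exts x h y. z \<noteq> z' \<longrightarrow> (z - h) \<inter> (z' - h) = {}"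
    proof (intro ballI impI, rule ccontr)
      fix z z' assume z: "z \<in> exts x h y" "z' \<in> exts x h y" "z \<noteq> z'" "(z - h) \<inter> (z' - h) \<noteq> {}"
      then obtain p where "p \<in> z" "p \<in> z'" "p \<notin> h" by blast
      hence "span (insert p h) = z" "span (insert p h) = z'"
        using z(1,2) span_insert_eq[OF h] by (simp_all add: exts_def)
      thus False using z by simp
    qed
  qed auto
  finally have "real (card (y - (h \<squnion> x))) = (\<Sum>z\<in>exts x h y. real (card (z - h)))" by simp
  also have "\<dots> = (\<Sum>z\<in>exts x h y. real q ^ Suc (dim h) - real q ^ dim h)"
  proof (intro sum.cong refl)
    fix z assume "z \<in> exts x h y"
    thus "real (card (z - h)) = real q ^ Suc (dim h) - real q ^ dim h"
      using of_nat_card_Diff_subspace[of h z] h by (simp add: exts_def)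
  qed
  finally show ?thesis
    using of_nat_card_Diff_subspace[of "h \<squnion> x" y] hx y by simp
qed

lemma q_bracket_simps: "q_bracket q 0 = 0" "q_bracket q 1 = 1"
  using q_ge_2 by (auto simp: q_bracket_def)

text \<open>
  The recursion \<open>h(n + 2) (q\<^sup>n\<^sup>+\<^sup>1 - 1) = (q\<^sup>n\<^sup>+\<^sup>2 - 1) h(n + 1)\<close> for the number \<open>h(n)\<close> of hyperplanes
  comes from counting pairs of a hyperplane and a vector on it that lies outside \<open>b\<close>.
\<close>

lemma card_hyps:
  assumes "subspace b" "subspace y" "b \<subseteq> y"
  shows "real (card (hyps b y)) = q_bracket q (dim y - dim b)"
  using assms
proof (induction "dim y - dim b" arbitrary: b)
  case 0
  have "hyps b y = {}"
  proof (rule ccontr)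
    assume "hyps b y \<noteq> {}"
    then obtain h where "b \<subseteq> h" "Suc (dim h) = dim y" by (auto simp: hyps_def)
    thus False using dim_subset[of b h] 0 by simp
  qed
  thus ?case using 0 by (simp add: q_bracket_simps)
next
  case (Suc n)
  show ?case
  \<comment> \<open>In codimension one the double count is void: the only hyperplane is
    \<open>b\<close> itself, so it carries no vector outside \<open>b\<close>.\<close>
  proof (cases n)
    case 0
    have "hyps b y = {b}"
    proof (intro set_eqI iffI)
      fix h assume "h \<in> hyps b y"
      hence h: "subspace h" "b \<subseteq> h" "Suc (dim h) = dim y" by (auto simp: hyps_def)
      hence "b = h" using Suc 0 by (intro subspace_eqI) auto
      thus "h \<in> {b}" by simp
    qed (use Suc 0 in \<open>auto simp: hyps_def\<close>)
    hence "card (hyps b y) = 1" by simp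
    moreover have "dim y - dim b = 1" using Suc.hyps(2) 0 by simp
    ultimately show ?thesis by (simp only: q_bracket_simps of_nat_1)
  next
    case n: (Suc m)
    have dy: "dim y = dim b + Suc (Suc m)" using Suc.hyps(2) n by simp
    have "(\<Sum>h\<in>hyps b y. \<Sum>v\<in>h - b. 1 :: real) = (\<Sum>h\<in>hyps b y. \<Sum>v | v \<in> y - b \<and> v \<in> h. 1)"
      by (intro sum.cong refl) (auto simp: hyps_def)
    also have "\<dots> = (\<Sum>v\<in>y - b. \<Sum>h | h \<in> hyps b y \<and> v \<in> h. 1)"
      by (rule sum.swap_restrict) auto
    also have "\<dots> = (\<Sum>v\<in>y - b. q_bracket q (Suc m))"
    proof (intro sum.cong refl)
      fix v assume v: "v \<in> y - b"
      let ?b = "span (insert v b)"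
      have "{h. h \<in> hyps b y \<and> v \<in> h} = hyps ?b y"
      proof (intro set_eqI iffI)
        fix h assume "h \<in> {h. h \<in> hyps b y \<and> v \<in> h}"
        thus "h \<in> hyps ?b y" using span_minimal[of "insert v b" h] by (auto simp: hyps_def)
      next
        fix h assume "h \<in> hyps ?b y"
        thus "h \<in> {h. h \<in> hyps b y \<and> v \<in> h}"
          using span_superset[of "insert v b"] by (auto simp: hyps_def)
      qed
      moreover have "dim ?b = Suc (dim b)" using dim_span_insert Suc.prems v by blast
      moreover have "real (card (hyps ?b y)) = q_bracket q (dim y - dim ?b)"
        using Suc.prems v dy \<open>dim ?b = Suc (dim b)\<close> n span_minimal[of "insert v b" y]
        by (intro Suc.hyps) auto
      ultimately show "(\<Sum>h | h \<in> hyps b y \<and> v \<in> h. 1) = q_bracket q (Suc m)"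
        using dy by simp
    qed
    finally have "(\<Sum>h\<in>hyps b y. real (card (h - b))) = real (card (y - b)) * q_bracket q (Suc m)" by simp
    moreover have "real (card (h - b)) = real q ^ dim b * (real q ^ Suc m - 1)" if "h \<in> hyps b y" for h
      using of_nat_card_Diff_subspace[of b h] that Suc.prems dy
      by (auto simp: hyps_def power_add algebra_simps)
    moreover have "real (card (y - b)) = real q ^ dim b * (real q ^ Suc (Suc m) - 1)"
      using of_nat_card_Diff_subspace[of b y] Suc.prems dy by (auto simp: power_add algebra_simps)
    ultimately have eq: "real (card (hyps b y)) * (real q ^ dim b * (real q ^ Suc m - 1)) =
        real q ^ dim b * (real q ^ Suc (Suc m) - 1) * q_bracket q (Suc m)"
      by simp
    have "real q ^ Suc m > 1" using q_ge_2 by (intro one_less_power) auto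
    hence "real q ^ dim b * (real q ^ Suc m - 1) \<noteq> 0" using q_ge_2 by simp
    moreover have "real (card (hyps b y)) * (real q ^ dim b * (real q ^ Suc m - 1)) =
        (real q ^ Suc (Suc m) - 1) / (real q - 1) * (real q ^ dim b * (real q ^ Suc m - 1))"
      unfolding eq q_bracket_def by (simp del: power_Suc)
    ultimately have "real (card (hyps b y)) = (real q ^ Suc (Suc m) - 1) / (real q - 1)"
      using mult_right_cancel by blast
    thus ?thesis using dy by (simp add: q_bracket_def)
  qed
qed

lemma q_bracket_pos: "0 < n \<Longrightarrow> 0 < q_bracket q n"
  using q_ge_2 by (auto simp: q_bracket_def intro!: divide_pos_pos one_less_power)

lemma hyps_nonempty:
  assumes "subspace b" "subspace y" "b \<subseteq> y" "b \<noteq> y"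
  shows "hyps b y \<noteq> {}"
proof -
  have "dim b < dim y" using assms subspace_eqI[of b y] by (meson not_less)
  hence "card (hyps b y) > 0" using card_hyps[OF assms(1-3)] q_bracket_pos[of "dim y - dim b"]
    by (metis of_nat_0_less_iff zero_less_diff)
  thus ?thesis by auto
qed

end

section \<open>The Grassmann graph\<close>

locale grassmann = finite_vector_space scale Basis q
  for scale :: "'k::{field,finite} \<Rightarrow> 'v::ab_group_add \<Rightarrow> 'v" (infixr \<open>*s\<close> 75) and Basis and q +
  fixes N D :: nat and x :: "'v set"
  assumes dim_UNIV_eq: "dim UNIV = N"
    and D_pos: "1 \<le> D"
    and N_gt: "2 * D < N"
    and subspace_x: "subspace x"
    and dim_x: "dim x = D"
begin

abbreviation X :: "'v set set" where "X \<equiv> grassmann_verts scale D"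
abbreviation R :: "('v set \<times> 'v set) set" where "R \<equiv> grassmann_adj scale D"
abbreviation \<theta> :: "nat \<Rightarrow> real" where "\<theta> \<equiv> grassmann_eigenvalue q N D"
abbreviation vee :: "'v set \<Rightarrow> 'v set \<Rightarrow> complex" where "vee \<equiv> vee_vec scale D"

definition lev :: "'v set \<Rightarrow> nat" where "lev y = dim (y \<inter> x)"

definition ip :: "('v set \<Rightarrow> complex) \<Rightarrow> 'v set \<Rightarrow> complex" where
  "ip f b = (\<Sum>y | y \<in> X \<and> b \<subseteq> y. f y)"

definition adj :: "('v set \<Rightarrow> complex) \<Rightarrow> 'v set \<Rightarrow> complex" where
  "adj f y = (\<Sum>z | (y, z) \<in> R. f z)"

text \<open>The entry equals q^(\<open>lev y\<close>), which separates levels. As a cardinality it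
  expands into a sum over the vectors of \<open>x\<close>, which yields
  \<open>wt_vee\<close>.\<close>

definition wt :: "('v set \<Rightarrow> complex) \<Rightarrow> 'v set \<Rightarrow> complex" where
  "wt f y = of_nat (card (y \<inter> x)) * f y"

abbreviation br :: "nat \<Rightarrow> complex" where "br n \<equiv> complex_of_real (q_bracket q n)"

lemma X_iff: "y \<in> X \<longleftrightarrow> subspace y \<and> dim y = D"
  by (simp add: grassmann_verts_def)

text \<open>\<open>D_pos\<close> turns the truncated D - 1 of \<open>grassmann_adj\<close> into an
  honest predecessor.\<close>

lemma R_iff: "(y, z) \<in> R \<longleftrightarrow> y \<in> X \<and> z \<in> X \<and> Suc (dim (y \<inter> z)) = D"
  using D_pos by (auto simp: grassmann_adj_def)

lemma R_subset': "R \<subseteq> X \<times> X"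
  by (auto simp: R_iff)

lemma sym_R': "sym R"
  by (auto simp: sym_def R_iff Int_commute)

lemma vee_apply: "vee b y = (if y \<in> X \<and> b \<subseteq> y then 1 else 0)"
  by (simp add: vee_vec_def vec_apply hat_def if_distrib cong: if_cong)

lemma vee_std: "vee b \<in> std_module X"
  by (simp add: std_module_def vee_apply)

lemma herm_vee: "herm X f (vee b) = ip f b"
  unfolding herm_def ip_def by (intro sum.mono_neutral_cong_right) (auto simp: vee_apply)

lemma vee_eq_0:
  assumes "D < dim b"
  shows "vee b = 0"
proof
  fix y
  have "\<not> (y \<in> X \<and> b \<subseteq> y)" using assms dim_subset[of b y] by (auto simp: X_iff)
  thus "vee b y = 0 y" by (simp only: vee_apply if_False zero_fun_apply)
qed

lemma mat_vec_adj: "mat_vec X (adj_mat R) f = adj f"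
proof
  fix y
  have "mat_vec X (adj_mat R) f y = (\<Sum>z\<in>X. if (y, z) \<in> R then f z else 0)"
    unfolding mat_vec_def adj_mat_def by (intro sum.cong) auto
  also have "\<dots> = (\<Sum>z | z \<in> X \<and> (y, z) \<in> R. f z)" by (simp add: sum.inter_filter)
  also have "{z. z \<in> X \<and> (y, z) \<in> R} = {z. (y, z) \<in> R}" by (auto simp: R_iff)
  finally show "mat_vec X (adj_mat R) f y = adj f y" by (simp add: adj_def)
qed

section \<open>The adjacency operator on the vectors \<open>vee b\<close>\<close>

lemma subspace_ge_0: "subspace h \<Longrightarrow> {0} \<subseteq> h"
  by (simp add: subspace_0)

lemma hyps_0_iff: "h \<in> hyps {0} y \<longleftrightarrow> subspace h \<and> h \<subseteq> y \<and> Suc (dim h) = dim y"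
  by (auto simp: hyps_def subspace_0)

lemma card_hyps_br:
  assumes "subspace b" "subspace y" "b \<subseteq> y"
  shows "of_nat (card (hyps b y)) = br (dim y - dim b)"
  using card_hyps[OF assms] by (metis of_real_of_nat_eq)

text \<open>Going down to a hyperplane of \<open>y\<close> and up again reaches each neighbour
  exactly once, through its intersection with \<open>y\<close>, and returns to \<open>y\<close> in
  [D] ways. So adjacency reduces to incidence with (D-1)-spaces.\<close>

lemma sum_down_up:
  assumes y: "y \<in> X"
  shows "(\<Sum>h\<in>hyps {0} y. ip f h) = adj f y + br D * f y"
proof -
  have ys: "subspace y" "dim y = D" using y by (auto simp: X_iff)
  have ne: "{h \<in> hyps {0} y. h \<subseteq> z} = (if (y, z) \<in> R then {y \<inter> z} else {})"
    if z: "z \<in> X" "z \<noteq> y" for z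
  proof -
    have zs: "subspace z" "dim z = D" using z by (auto simp: X_iff)
    have yz: "subspace (y \<inter> z)" using ys zs by (simp add: subspace_inter)
    have "dim (y \<inter> z) \<noteq> D"
    proof
      assume "dim (y \<inter> z) = D"
      hence "y \<inter> z = y" "y \<inter> z = z"
        using subspace_eqI[OF yz ys(1)] subspace_eqI[OF yz zs(1)] ys(2) zs(2) by auto
      thus False using z by auto
    qed
    hence less: "dim (y \<inter> z) < D" using dim_subset[of "y \<inter> z" y] ys by simp
    have "h = y \<inter> z \<and> (y, z) \<in> R" if h: "h \<in> hyps {0} y" "h \<subseteq> z" for h
    proof -
      have "subspace h" "h \<subseteq> y \<inter> z" "Suc (dim h) = D" using h ys by (auto simp: hyps_0_iff)
      moreover from this have "h = y \<inter> z" using yz less by (intro subspace_eqI) auto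
      ultimately show ?thesis using y z by (simp add: R_iff)
    qed
    moreover have "y \<inter> z \<in> hyps {0} y" if "(y, z) \<in> R"
      using that yz ys by (simp add: hyps_0_iff R_iff)
    ultimately show ?thesis by auto
  qed
  have "(\<Sum>h\<in>hyps {0} y. ip f h) = (\<Sum>z\<in>X. \<Sum>h | h \<in> hyps {0} y \<and> h \<subseteq> z. f z)"
    unfolding ip_def by (rule sum.swap_restrict) auto
  also have "\<dots> = (\<Sum>z\<in>X. of_nat (card {h \<in> hyps {0} y. h \<subseteq> z}) * f z)"
    by simp
  also have "\<dots> = of_nat (card {h \<in> hyps {0} y. h \<subseteq> y}) * f y +
      (\<Sum>z\<in>X - {y}. of_nat (card {h \<in> hyps {0} y. h \<subseteq> z}) * f z)"
    using y by (simp add: sum.remove)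
  also have "{h \<in> hyps {0} y. h \<subseteq> y} = hyps {0} y" by (auto simp: hyps_0_iff)
  also have "of_nat (card (hyps {0} y)) = br D"
    using card_hyps_br[of "{0}" y] ys subspace_ge_0[of y] by simp
  also have "(\<Sum>z\<in>X - {y}. of_nat (card {h \<in> hyps {0} y. h \<subseteq> z}) * f z) =
      (\<Sum>z\<in>X - {y}. if (y, z) \<in> R then f z else 0)"
    by (intro sum.cong refl) (simp add: ne)
  also have "\<dots> = adj f y"
    unfolding adj_def using ys by (subst sum.inter_filter[symmetric]) (auto intro!: sum.cong simp: R_iff X_iff)
  finally show ?thesis by simp
qed

text \<open>A vertex above \<open>h\<close> is one dimension larger. It contains \<open>b\<close>
  automatically if b lies in \<open>h\<close>, is forced to be the join if \<open>b\<close> sticks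
  out by one dimension, and cannot exist otherwise.\<close>

lemma card_above_hyperplane:
  assumes h: "subspace h" "Suc (dim h) = D" and b: "subspace b"
  shows "ip (vee b) h = (if b \<subseteq> h then br (Suc (N - D)) else if Suc (dim (b \<inter> h)) = dim b then 1 else 0)"
proof -
  let ?Z = "{z \<in> X. h \<subseteq> z \<and> b \<subseteq> z}"
  have ip: "ip (vee b) h = of_nat (card ?Z)"
    unfolding ip_def by (subst card_eq_sum) (auto simp: vee_apply sum.If_cases intro!: arg_cong[where f = card])
  have hb: "subspace (h \<squnion> b)" "dim (h \<squnion> b) + dim (b \<inter> h) = dim h + dim b"
    using dim_join_Int[OF h(1) b] by (simp_all add: Int_commute)
  have le: "dim (b \<inter> h) \<le> dim b" by (simp add: dim_subset)
  consider "b \<subseteq> h" | "\<not> b \<subseteq> h" "Suc (dim (b \<inter> h)) = dim b" | "\<not> b \<subseteq> h" "Suc (dim (b \<inter> h)) \<noteq> dim b" by blast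
  thus ?thesis
  proof cases
    case 1
    \<comment> \<open>With the zero subspace in the place of \<open>x\<close>, the condition of
      \<open>exts\<close> on intersections is void.\<close>
    have Z: "?Z = exts {0} h UNIV"
      using 1 h by (auto simp: exts_def X_iff subspace_0)
    have "h \<union> {0} = h" using h by (auto simp: subspace_0)
    hence "real (card ?Z) * (real q ^ D - real q ^ dim h) = real q ^ N - real q ^ dim h"
      using card_exts[OF h(1), of "{0}" UNIV] h(2) unfolding Z by (simp add: dim_UNIV_eq del: dim_UNIV)
    moreover have "D = dim h + 1" "N = dim h + Suc (N - D)" using h(2) N_gt by auto
    hence "real q ^ D = real q ^ dim h * real q" "real q ^ N = real q ^ dim h * real q ^ Suc (N - D)"
      by (metis power_add power_one_right, metis power_add)
    ultimately have "real (card ?Z) * (real q ^ dim h * (real q - 1)) = real q ^ dim h * (real q ^ Suc (N - D) - 1)"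
      by (simp add: algebra_simps)
    hence "real (card ?Z) * (real q - 1) = real q ^ Suc (N - D) - 1"
      using q_ge_2 by (simp add: mult.left_commute[of _ "real q ^ dim h"])
    hence "real (card ?Z) = q_bracket q (Suc (N - D))"
      using q_ge_2 unfolding q_bracket_def by (simp add: eq_divide_eq)
    hence "of_nat (card ?Z) = br (Suc (N - D))" by (metis of_real_of_nat_eq)
    thus ?thesis unfolding ip using 1 by simp
  next
    case 2
    have "?Z = {h \<squnion> b}"
    proof (intro set_eqI iffI)
      fix z assume z: "z \<in> ?Z"
      hence zs: "subspace z" "dim z = D" "h \<squnion> b \<subseteq> z" using join_least[of z h b] by (auto simp: X_iff)
      moreover have "dim (h \<squnion> b) = D" using hb(2) 2 h(2) by simp
      ultimately have "h \<squnion> b = z" using hb(1) subspace_eqI by (metis order_refl)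
      thus "z \<in> {h \<squnion> b}" by simp
    next
      fix z assume "z \<in> {h \<squnion> b}"
      moreover have "dim (h \<squnion> b) = D" using hb(2) 2 h(2) by simp
      ultimately show "z \<in> ?Z" using hb(1) join_upper[of h b] join_upper[of b h] by (simp add: X_iff)
    qed
    thus ?thesis unfolding ip using 2 by simp
  next
    case 3
    have "?Z = {}"
    proof (rule ccontr)
      assume "?Z \<noteq> {}"
      then obtain z where z: "z \<in> X" "h \<subseteq> z" "b \<subseteq> z" by blast
      hence "dim (h \<squnion> b) \<le> D" using join_least[of z h b] dim_subset[of "h \<squnion> b" z] by (auto simp: X_iff)
      hence "dim b \<le> Suc (dim (b \<inter> h))" using hb h(2) by simp
      hence "dim (b \<inter> h) = dim b" using 3 le by simp
      hence "b \<inter> h = b" using b h by (intro subspace_eqI) (auto simp: subspace_inter)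
      thus False using 3 by blast
    qed
    thus ?thesis unfolding ip using 3 by simp
  qed
qed

lemma Suc_dim_Int_hyperplane:
  assumes "subspace b" "h \<in> hyps {0} y" "subspace y" "b \<subseteq> y" "\<not> b \<subseteq> h"
  shows "Suc (dim (b \<inter> h)) = dim b"
proof -
  have h: "subspace h" "h \<subseteq> y" "Suc (dim h) = dim y" using assms by (auto simp: hyps_0_iff)
  have "dim h < dim (h \<squnion> b)"
  proof (rule ccontr)
    assume "\<not> dim h < dim (h \<squnion> b)"
    hence "h = h \<squnion> b" using h join_upper(1) by (intro subspace_eqI) auto
    thus False using assms join_upper(2)[of b h] by auto
  qed
  moreover have "dim (h \<squnion> b) \<le> dim y" using assms h by (intro dim_subset join_least) auto
  ultimately have "dim (h \<squnion> b) = Suc (dim h)" using h by simp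
  thus ?thesis using dim_join_Int[OF h(1) assms(1)] by (simp add: Int_commute)
qed

text \<open>The left side is the entry of \<open>adj (vee b)\<close> at a vertex above
  \<open>b\<close>, where i = dim b. The last product is the share of the [i] hyperplanes of
  \<open>b\<close>, all of which lie below that vertex.\<close>

lemma eigenvalue_identity:
  assumes "i \<le> D"
  shows "q_bracket q (D - i) * q_bracket q (Suc (N - D)) - q_bracket q (D - i) =
    \<theta> i + q_bracket q (Suc (D - i)) * q_bracket q i"
proof -
  define a b c where "a = real q ^ (D - i)" and "b = real q ^ i" and "c = real q ^ (N - D)"
  have p: "real q ^ D = a * b" "real q ^ Suc (N - D) = c * real q"
    "real q ^ (N - i + 1) = c * a * real q" "real q ^ Suc (D - i) = a * real q"
    using assms N_gt by (simp_all add: a_def b_def c_def flip: power_add power_Suc2)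
  have "real q - 1 \<noteq> 0" using q_ge_2 by simp
  thus ?thesis
    unfolding grassmann_eigenvalue_def q_bracket_def p a_def[symmetric] b_def[symmetric] c_def[symmetric]
    by (simp add: divide_simps) (simp add: algebra_simps)
qed

text \<open>By \<open>sum_down_up\<close>, the entry at \<open>y\<close> is a count over the
  hyperplanes of \<open>y\<close>, and it depends only on whether \<open>b \<inter> y\<close> is all
  of \<open>b\<close>, a hyperplane of \<open>b\<close>, or smaller. In the second case
  \<open>b \<inter> y\<close> is the only hyperplane of \<open>b\<close> below \<open>y\<close>; in
  the third both sides vanish.\<close>

lemma adj_vee:
  assumes b: "subspace b" and i: "dim b \<le> D"
  shows "adj (vee b) = cscale (\<theta> (dim b)) (vee b) + cscale (br (Suc (D - dim b))) (\<Sum>b'\<in>hyps {0} b. vee b')"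
proof
  fix y
  let ?i = "dim b"
  have S: "(\<Sum>b'\<in>hyps {0} b. vee b') y = of_nat (card {b' \<in> hyps {0} b. b' \<subseteq> y})" if "y \<in> X"
    using that by (simp add: sum_apply vee_apply flip: sum.inter_filter)
  show "adj (vee b) y = (cscale (\<theta> ?i) (vee b) + cscale (br (Suc (D - ?i))) (\<Sum>b'\<in>hyps {0} b. vee b')) y"
  proof (cases "y \<in> X")
    case False
    hence "adj (vee b) y = 0" by (auto simp: adj_def R_iff)
    thus ?thesis using False by (simp add: vec_apply vee_apply)
  next
    case True
    hence y: "subspace y" "dim y = D" by (auto simp: X_iff)
    have bys: "subspace (b \<inter> y)" using b y by (simp add: subspace_inter)
    have hd: "subspace h" "Suc (dim h) = D" "h \<subseteq> y" if "h \<in> hyps {0} y" for h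
      using that y by (auto simp: hyps_0_iff)
    have ht: "of_nat (card (hyps b' y)) = br (D - dim b')" if "subspace b'" "b' \<subseteq> y" for b'
      using card_hyps_br[of b' y] that y by simp
    have hb: "hyps b' y = {h \<in> hyps {0} y. b' \<subseteq> h}" if "subspace b'" for b'
      by (auto simp: hyps_def subspace_0)
    consider "b \<subseteq> y" | "\<not> b \<subseteq> y" "Suc (dim (b \<inter> y)) = ?i" | "\<not> b \<subseteq> y" "Suc (dim (b \<inter> y)) \<noteq> ?i" by blast
    thus ?thesis
    proof cases
      case 1
      have "(\<Sum>h\<in>hyps {0} y. ip (vee b) h) = (\<Sum>h\<in>hyps {0} y. 1 + (if b \<subseteq> h then br (Suc (N - D)) - 1 else 0))"
        using card_above_hyperplane[OF hd(1,2) b] Suc_dim_Int_hyperplane[OF b _ y(1) 1]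
        by (intro sum.cong) auto
      also have "\<dots> = of_nat (card (hyps {0} y)) + of_nat (card (hyps b y)) * (br (Suc (N - D)) - 1)"
        by (simp add: sum.distrib hb[OF b] flip: sum.inter_filter)
      also have "\<dots> = br D + br (D - ?i) * (br (Suc (N - D)) - 1)"
        using ht[of "{0}"] ht[OF b 1] y by (simp add: subspace_0)
      finally have "adj (vee b) y = br (D - ?i) * (br (Suc (N - D)) - 1)"
        using sum_down_up[OF True, of "vee b"] 1 True by (simp add: vee_apply)
      also have "\<dots> = of_real (q_bracket q (D - ?i) * q_bracket q (Suc (N - D)) - q_bracket q (D - ?i))"
        by (simp add: algebra_simps)
      also have "\<dots> = \<theta> ?i + br (Suc (D - ?i)) * br ?i"
        unfolding eigenvalue_identity[OF i] by simp
      finally have lhs: "adj (vee b) y = \<theta> ?i + br (Suc (D - ?i)) * br ?i" .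
      have "{b' \<in> hyps {0} b. b' \<subseteq> y} = hyps {0} b"
        using 1 hyps_0_iff[of _ b] by (blast intro: order_trans)
      moreover have "of_nat (card (hyps {0} b)) = br ?i"
        using card_hyps_br[OF subspace_single_0 b subspace_ge_0[OF b]] by (simp only: dim_singleton if_True diff_zero simp_thms)
      ultimately have "(\<Sum>b'\<in>hyps {0} b. vee b') y = br ?i" using S[OF True] by simp
      moreover have "vee b y = 1" using 1 True by (simp add: vee_apply)
      ultimately show ?thesis by (simp only: plus_fun_apply cscale_apply lhs mult_1_right)
    next
      case 2
      have vy: "vee b y = 0" using 2 by (simp add: vee_apply)
      have iff: "Suc (dim (b \<inter> h)) = ?i \<longleftrightarrow> b \<inter> y \<subseteq> h" if h: "h \<in> hyps {0} y" for h
      proof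
        assume "Suc (dim (b \<inter> h)) = ?i"
        moreover have "b \<inter> h \<subseteq> b \<inter> y" "subspace (b \<inter> h)" using hd[OF h] b by (auto simp: subspace_inter)
        ultimately have "b \<inter> h = b \<inter> y" using 2 bys by (intro subspace_eqI) auto
        thus "b \<inter> y \<subseteq> h" by blast
      next
        assume "b \<inter> y \<subseteq> h"
        hence "b \<inter> h = b \<inter> y" using hd[OF h] by blast
        thus "Suc (dim (b \<inter> h)) = ?i" using 2 by simp
      qed
      have "\<not> b \<subseteq> h" if "h \<in> hyps {0} y" for h using 2 hd[OF that] by blast
      hence "(\<Sum>h\<in>hyps {0} y. ip (vee b) h) = (\<Sum>h\<in>hyps {0} y. if b \<inter> y \<subseteq> h then 1 else 0)"
        using card_above_hyperplane[OF hd(1,2) b] iff by (intro sum.cong) auto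
      also have "\<dots> = of_nat (card (hyps (b \<inter> y) y))"
        by (simp add: hb[OF bys] flip: sum.inter_filter)
      also have "\<dots> = br (D - dim (b \<inter> y))"
        using ht[OF bys] by simp
      also have "D - dim (b \<inter> y) = Suc (D - ?i)" using 2 i by simp
      finally have lhs: "adj (vee b) y = br (Suc (D - ?i))"
        using sum_down_up[OF True, of "vee b"] vy by simp
      have "{b' \<in> hyps {0} b. b' \<subseteq> y} = {b \<inter> y}"
      proof (intro set_eqI iffI)
        fix b' assume "b' \<in> {b' \<in> hyps {0} b. b' \<subseteq> y}"
        hence "subspace b'" "b' \<subseteq> b \<inter> y" "Suc (dim b') = ?i" by (auto simp: hyps_0_iff)
        hence "b' = b \<inter> y" using 2(2) bys subspace_eqI[of b' "b \<inter> y"] by linarith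
        thus "b' \<in> {b \<inter> y}" by simp
      next
        fix b' assume "b' \<in> {b \<inter> y}"
        thus "b' \<in> {b' \<in> hyps {0} b. b' \<subseteq> y}" using 2(2) bys by (simp add: hyps_0_iff)
      qed
      hence "(\<Sum>b'\<in>hyps {0} b. vee b') y = 1" using S[OF True] by simp
      thus ?thesis by (simp only: plus_fun_apply cscale_apply lhs vy) simp
    next
      case 3
      have vy: "vee b y = 0" using 3 by (simp add: vee_apply)
      have lt: "Suc (dim (b \<inter> y)) < ?i"
      proof -
        have "dim (b \<inter> y) \<noteq> ?i" using 3 subspace_eqI[OF bys b] by auto
        thus ?thesis using 3 dim_subset[of "b \<inter> y" b] by simp
      qed
      have "ip (vee b) h = 0" if h: "h \<in> hyps {0} y" for h
      proof -
        have "dim (b \<inter> h) \<le> dim (b \<inter> y)" using hd[OF h] by (intro dim_subset) auto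
        thus ?thesis using card_above_hyperplane[OF hd(1,2)[OF h] b] lt 3 hd[OF h] by auto
      qed
      hence lhs: "adj (vee b) y = 0" using sum_down_up[OF True, of "vee b"] vy by simp
      have "{b' \<in> hyps {0} b. b' \<subseteq> y} = {}"
      proof (rule ccontr)
        assume "{b' \<in> hyps {0} b. b' \<subseteq> y} \<noteq> {}"
        then obtain b' where "b' \<subseteq> b \<inter> y" "Suc (dim b') = ?i" by (auto simp: hyps_0_iff)
        thus False using dim_subset[of b' "b \<inter> y"] lt by simp
      qed
      hence "(\<Sum>b'\<in>hyps {0} b. vee b') y = 0" using S[OF True] by simp
      thus ?thesis by (simp only: plus_fun_apply cscale_apply lhs vy) simp
    qed
  qed
qed

text \<open>The difference dim b - dim (b \<inter> x) is the dimension of the image of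
  \<open>b\<close> modulo \<open>x\<close>, hence monotone; the additive form avoids truncated
  subtraction. \<open>Fil\<close> bounds this quantity.\<close>

lemma codim_mono:
  assumes "subspace a" "subspace b" "a \<subseteq> b"
  shows "dim a + dim (b \<inter> x) \<le> dim b + dim (a \<inter> x)"
proof -
  have "subspace (b \<inter> x)" using assms subspace_x by (simp add: subspace_inter)
  moreover have "a \<inter> (b \<inter> x) = a \<inter> x" using assms by blast
  moreover have "dim (a \<squnion> (b \<inter> x)) \<le> dim b" using assms by (intro dim_subset join_least) auto
  ultimately show ?thesis using dim_join_Int[of a "b \<inter> x"] assms by simp
qed

section \<open>Distance from the base vertex\<close>

lemma lev_le: "lev y \<le> D"
  unfolding lev_def using dim_subset[of "y \<inter> x" x] dim_x by simp

lemma lev_adj: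
  assumes "(y, z) \<in> R"
  shows "lev z \<le> Suc (lev y)"
proof -
  have yz: "subspace y" "subspace z" "dim z = D" "Suc (dim (y \<inter> z)) = D" using assms by (auto simp: R_iff X_iff)
  hence "dim (y \<inter> z) + lev z \<le> D + dim (y \<inter> z \<inter> x)"
    using codim_mono[of "y \<inter> z" z] by (simp add: lev_def subspace_inter)
  moreover have "dim (y \<inter> z \<inter> x) \<le> lev y" unfolding lev_def by (intro dim_subset) auto
  ultimately show ?thesis using yz by simp
qed

text \<open>Keep a hyperplane of \<open>y\<close> that contains \<open>y \<inter> x\<close> and
  trade the lost dimension for a vector of \<open>x\<close> outside \<open>y\<close>.\<close>

lemma exists_closer:
  assumes y: "y \<in> X" and lt: "lev y < D"
  shows "\<exists>z. (z, y) \<in> R \<and> lev y < lev z"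
proof -
  have ys: "subspace y" "dim y = D" using y by (auto simp: X_iff)
  have yx: "subspace (y \<inter> x)" using ys subspace_x by (simp add: subspace_inter)
  have "\<not> x \<subseteq> y" using lt dim_x by (auto simp: lev_def Int_absorb1)
  then obtain p where p: "p \<in> x" "p \<notin> y" by blast
  have "y \<inter> x \<noteq> y" using lt ys by (auto simp: lev_def)
  then obtain h where h: "h \<in> hyps (y \<inter> x) y" using hyps_nonempty[OF yx ys(1)] by blast
  hence hs: "subspace h" "y \<inter> x \<subseteq> h" "h \<subseteq> y" "Suc (dim h) = D" using ys by (auto simp: hyps_def)
  let ?z = "span (insert p h)"
  have ph: "p \<notin> h" using p hs by blast
  have pz: "p \<in> ?z" "h \<subseteq> ?z" by (auto intro: span_base)
  have dz: "dim ?z = D" using dim_span_insert[OF hs(1) ph] hs by simp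
  have zy: "subspace (?z \<inter> y)" using ys by (simp add: subspace_inter)
  have "dim (?z \<inter> y) \<noteq> D"
  proof
    assume "dim (?z \<inter> y) = D"
    hence "?z \<inter> y = ?z" using zy dz by (intro subspace_eqI) auto
    thus False using p pz by blast
  qed
  moreover have "dim (?z \<inter> y) \<le> D" using ys dim_subset[of "?z \<inter> y" y] by simp
  moreover have "dim h \<le> dim (?z \<inter> y)" using hs pz by (intro dim_subset) auto
  ultimately have "Suc (dim (?z \<inter> y)) = D" using hs by simp
  hence "(?z, y) \<in> R" using y dz by (simp only: R_iff X_iff) simp
  moreover have "Suc (lev y) \<le> lev ?z"
  proof -
    have "dim (span (insert p (y \<inter> x))) = Suc (lev y)"
      unfolding lev_def using yx p by (intro dim_span_insert) auto
    moreover have "span (insert p (y \<inter> x)) \<subseteq> ?z \<inter> x"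
      using p hs pz subspace_x by (intro span_minimal subspace_inter) auto
    ultimately show ?thesis unfolding lev_def by (metis dim_subset)
  qed
  ultimately show ?thesis by auto
qed

lemma path_exists:
  assumes "y \<in> X"
  shows "\<exists>k\<le>D - lev y. (x, y) \<in> R ^^ k"
  using assms
proof (induction "D - lev y" arbitrary: y rule: less_induct)
  case less
  have ys: "subspace y" "dim y = D" using less.prems by (auto simp: X_iff)
  show ?case
  proof (cases "lev y < D")
    case True
    then obtain z where z: "(z, y) \<in> R" "lev y < lev z" using exists_closer less.prems by blast
    moreover have "z \<in> X" using z by (simp add: R_iff)
    ultimately obtain k where "k \<le> D - lev z" "(x, z) \<in> R ^^ k"
      using less.hyps[of z] True diff_less_mono2[OF z(2) True] by blast
    hence "(x, y) \<in> R ^^ Suc k" "Suc k \<le> D - lev y" using z True by (auto intro: relpow_Suc_I)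
    thus ?thesis by blast
  next
    case False
    hence d: "dim (y \<inter> x) = D" using lev_le[of y] by (simp add: lev_def)
    have yx: "subspace (y \<inter> x)" using ys subspace_x by (simp add: subspace_inter)
    have "y \<inter> x = y" "y \<inter> x = x"
      using subspace_eqI[OF yx ys(1)] subspace_eqI[OF yx subspace_x] d ys(2) dim_x by auto
    hence "(x, y) \<in> R ^^ 0" by auto
    thus ?thesis by blast
  qed
qed

lemma path_length_ge:
  assumes "(x, y) \<in> R ^^ k"
  shows "D \<le> lev y + k"
  using assms
proof (induction k arbitrary: y)
  case 0
  hence "y = x" by simp
  thus ?case by (simp only: lev_def dim_x Int_absorb add_0_right order_refl)
next
  case (Suc k)
  then obtain z where "(x, z) \<in> R ^^ k" "(z, y) \<in> R" by (auto elim: relpow_Suc_E)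
  moreover from this have "(y, z) \<in> R" using sym_R' by (blast dest: symD)
  ultimately show ?case using Suc.IH lev_adj[of y z] by fastforce
qed

lemma gdist_eq:
  assumes "y \<in> X"
  shows "gdist R x y = D - lev y"
proof -
  obtain k where k: "k \<le> D - lev y" "(x, y) \<in> R ^^ k" using path_exists[OF assms] by blast
  hence "k = D - lev y" using path_length_ge[OF k(2)] by simp
  thus ?thesis unfolding gdist_def using k path_length_ge by (intro Least_equality) fastforce+
qed

lemma \<theta>_strict_antimono:
  assumes "i < j" "j \<le> D"
  shows "\<theta> j < \<theta> i"
proof -
  \<comment> \<open>In these variables the difference of the two products of brackets is (b - 1) (c
    - a) / (q - 1)^2, and a < c because i < N - j + 1.\<close>
  define a b c where "a = real q ^ i" and "b = real q ^ (j - i)" and "c = real q ^ (N - j + 1)"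
  have p: "real q ^ j = a * b" "real q ^ (N - i + 1) = c * b"
    using assms N_gt by (simp_all add: a_def b_def c_def flip: power_add power_Suc)
  have "1 < b" using assms q_ge_2 by (simp add: b_def one_less_power)
  moreover have "a < c" unfolding a_def c_def using assms N_gt q_ge_2 by (intro power_strict_increasing) auto
  ultimately have "0 < (b - 1) * (c - a)" by simp
  hence "(a - 1) * (c * b - 1) < (a * b - 1) * (c - 1)" by (simp add: algebra_simps)
  moreover have "0 < (real q - 1) * (real q - 1)" using q_ge_2 by simp
  ultimately have "q_bracket q i * q_bracket q (N - i + 1) < q_bracket q j * q_bracket q (N - j + 1)"
    unfolding q_bracket_def p a_def[symmetric] c_def[symmetric] by (simp add: divide_strict_right_mono)
  thus ?thesis by (simp add: grassmann_eigenvalue_def)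
qed

lemma inj_\<theta>': "inj_on \<theta> {..D}"
proof (rule inj_onI)
  fix i j assume ij: "i \<in> {..D}" "j \<in> {..D}" "\<theta> i = \<theta> j"
  show "i = j"
    using \<theta>_strict_antimono[of i j] \<theta>_strict_antimono[of j i] ij by (cases i j rule: linorder_cases) auto
qed

section \<open>The filtration by dimension and by dimension modulo \<open>x\<close>\<close>

lemma clinear_adj: "clinear adj"
  by (rule clinearI) (auto simp: adj_def vec_apply fun_eq_iff sum.distrib sum_distrib_left)

lemma clinear_wt: "clinear wt"
  by (rule clinearI) (auto simp: wt_def vec_apply fun_eq_iff algebra_simps)

text \<open>The module V_\<eta> of the overview is \<open>Fil (Suc \<eta>) (Suc D)\<close>. The
  strict inequalities make \<open>Fil 0 n\<close> and \<open>Fil \<eta> 0\<close> zero, so that the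
  space before V_0 needs no special treatment; \<open>n\<close> is the filtration by dimension
  inside the module.\<close>

definition Fil :: "nat \<Rightarrow> nat \<Rightarrow> ('v set \<Rightarrow> complex) set" where
  "Fil \<eta> n = cfun.span {vee b |b. subspace b \<and> dim b < dim (b \<inter> x) + \<eta> \<and> dim b < n}"

lemma subspace_Fil: "cfun.subspace (Fil \<eta> n)"
  by (simp add: Fil_def)

lemma vee_in_Fil: "subspace b \<Longrightarrow> dim b < dim (b \<inter> x) + \<eta> \<Longrightarrow> dim b < n \<Longrightarrow> vee b \<in> Fil \<eta> n"
  unfolding Fil_def by (intro cfun.span_base) blast

lemma Fil_into:
  assumes "clinear F" "cfun.subspace U" "f \<in> Fil \<eta> n"
    and "\<And>b. subspace b \<Longrightarrow> dim b < dim (b \<inter> x) + \<eta> \<Longrightarrow> dim b < n \<Longrightarrow> F (vee b) \<in> U"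
  shows "F f \<in> U"
  by (rule clinear_span_into[OF assms(1,2) _ assms(3)[unfolded Fil_def]]) (use assms(4) in blast)

lemma Fil_subset:
  assumes "cfun.subspace U"
    and "\<And>b. subspace b \<Longrightarrow> dim b < dim (b \<inter> x) + \<eta> \<Longrightarrow> dim b < n \<Longrightarrow> vee b \<in> U"
  shows "Fil \<eta> n \<subseteq> U"
  unfolding Fil_def using assms by (intro cfun.span_minimal) auto

lemma Fil_mono: "\<eta> \<le> \<eta>' \<Longrightarrow> n \<le> n' \<Longrightarrow> Fil \<eta> n \<subseteq> Fil \<eta>' n'"
  by (intro Fil_subset subspace_Fil vee_in_Fil) auto

lemma Fil_std: "Fil \<eta> n \<subseteq> std_module X"
  by (intro Fil_subset subspace_std_module vee_std)

lemma Fil_0: "Fil \<eta> 0 = {0}" "Fil 0 n = {0}"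
proof -
  have "dim (b \<inter> x) \<le> dim b" for b by (intro dim_subset) auto
  hence "{vee b |b. subspace b \<and> dim b < dim (b \<inter> x) + 0 \<and> dim b < n} = {}"
    by (auto simp: not_less)
  thus "Fil 0 n = {0}" unfolding Fil_def by (simp only: cfun.span_empty)
qed (simp add: Fil_def)

text \<open>No vertex contains a space of dimension above \<open>D\<close>, so the corresponding
  \<open>vee b\<close> are zero and the bound \<open>n\<close> saturates at
  \<open>Suc D\<close>.\<close>

lemma Fil_Suc_trivial:
  assumes "D < n"
  shows "Fil \<eta> n \<subseteq> Fil \<eta> (Suc D)"
proof (rule Fil_subset[OF subspace_Fil])
  fix b assume b: "subspace b" "dim b < dim (b \<inter> x) + \<eta>"
  show "vee b \<in> Fil \<eta> (Suc D)"
  proof (cases "dim b \<le> D")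
    case True
    thus ?thesis using b by (intro vee_in_Fil) auto
  next
    case False
    thus ?thesis using vee_eq_0[of b] cfun.subspace_0[OF subspace_Fil] by simp
  qed
qed

lemma adj_vee_hyps_in_Fil:
  assumes b: "subspace b" "dim b < dim (b \<inter> x) + \<eta>" "dim b \<le> D"
  shows "adj (vee b) - cscale (\<theta> (dim b)) (vee b) \<in> Fil \<eta> (dim b)"
proof -
  have "vee b' \<in> Fil \<eta> (dim b)" if "b' \<in> hyps {0} b" for b'
  proof (rule vee_in_Fil)
    have *: "subspace b'" "b' \<subseteq> b" "Suc (dim b') = dim b" using that by (auto simp: hyps_0_iff)
    thus "subspace b'" "dim b' < dim b" by auto
    show "dim b' < dim (b' \<inter> x) + \<eta>" using codim_mono[OF *(1) b(1) *(2)] b by simp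
  qed
  hence "cscale c (\<Sum>b'\<in>hyps {0} b. vee b') \<in> Fil \<eta> (dim b)" for c
    by (intro cfun.subspace_scale[OF subspace_Fil] cfun.subspace_sum[OF subspace_Fil])
  thus ?thesis unfolding adj_vee[OF b(1,3)] by simp
qed

text \<open>Adjacency is triangular in dim b with diagonal entries \<open>\<theta> (dim b)\<close>,
  and by \<open>codim_mono\<close> the hyperplanes of \<open>b\<close> respect the bound \<eta>.
  Subtracting \<open>\<theta> n\<close> therefore cancels the generators of top dimension n.\<close>

lemma adj_shift_Fil:
  assumes f: "f \<in> Fil \<eta> (Suc n)" and n: "n \<le> D"
  shows "adj f - cscale (\<theta> n) f \<in> Fil \<eta> n"
proof (rule Fil_into[OF _ subspace_Fil f])
  show "clinear (\<lambda>f. adj f - cscale (\<theta> n) f)"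
    by (rule clinearI) (auto simp: clinear_add[OF clinear_adj] clinear_scale[OF clinear_adj]
            cfun.scale_right_distrib cfun.scale_right_diff_distrib mult.commute)
  fix b assume b: "subspace b" "dim b < dim (b \<inter> x) + \<eta>" "dim b < Suc n"
  have shift: "adj (vee b) - cscale (\<theta> (dim b)) (vee b) \<in> Fil \<eta> (dim b)"
    using b n by (intro adj_vee_hyps_in_Fil) auto
  show "adj (vee b) - cscale (\<theta> n) (vee b) \<in> Fil \<eta> n"
  proof (cases "dim b = n")
    case True
    thus ?thesis using shift by simp
  next
    case False
    hence "vee b \<in> Fil \<eta> n" using b by (intro vee_in_Fil) auto
    moreover have "adj (vee b) - cscale (\<theta> (dim b)) (vee b) \<in> Fil \<eta> n"
      using shift b Fil_mono[of \<eta> \<eta> "dim b" n] by auto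
    ultimately have "(adj (vee b) - cscale (\<theta> (dim b)) (vee b)) +
        (cscale (\<theta> (dim b)) (vee b) - cscale (\<theta> n) (vee b)) \<in> Fil \<eta> n"
      by (blast intro: cfun.subspace_diff[OF subspace_Fil] cfun.subspace_add[OF subspace_Fil]
          cfun.subspace_scale[OF subspace_Fil])
    thus ?thesis by simp
  qed
qed

lemma adj_Fil:
  assumes f: "f \<in> Fil \<eta> n" and n: "n \<le> Suc D"
  shows "adj f \<in> Fil \<eta> n"
proof (cases n)
  case 0
  thus ?thesis using f by (simp add: Fil_0 clinear_0[OF clinear_adj])
next
  case (Suc m)
  hence "adj f - cscale (\<theta> m) f \<in> Fil \<eta> n"
    using adj_shift_Fil[of f \<eta> m] f n Fil_mono[of \<eta> \<eta> m n] by auto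
  hence "(adj f - cscale (\<theta> m) f) + cscale (\<theta> m) f \<in> Fil \<eta> n"
    using f by (intro cfun.subspace_add[OF subspace_Fil] cfun.subspace_scale[OF subspace_Fil])
  thus ?thesis by simp
qed

text \<open>For a vertex \<open>y\<close> above \<open>b\<close>, the factor counts the vectors u of
  \<open>x\<close> in \<open>y\<close>, that is, those for which \<open>y\<close> contains the span
  of \<open>b\<close> and u.\<close>

lemma wt_vee: "wt (vee b) = (\<Sum>u\<in>x. vee (span (insert u b)))"
proof
  fix y
  show "wt (vee b) y = (\<Sum>u\<in>x. vee (span (insert u b))) y"
  proof (cases "y \<in> X \<and> b \<subseteq> y")
    case True
    hence "span (insert u b) \<subseteq> y \<longleftrightarrow> u \<in> y" for u
      using span_minimal[of "insert u b" y] span_base[of u "insert u b"] by (auto simp: X_iff)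
    moreover have "{u \<in> x. u \<in> y} = y \<inter> x" by auto
    ultimately show ?thesis using True
      by (simp add: wt_def vee_apply sum_apply flip: sum.inter_filter)
  next
    case False
    hence "\<not> (y \<in> X \<and> span (insert u b) \<subseteq> y)" for u
      using span_superset[of "insert u b"] by blast
    hence "vee (span (insert u b)) y = 0" for u by (simp only: vee_apply if_False)
    moreover have "vee b y = 0" using False by (simp only: vee_apply if_False)
    ultimately show ?thesis by (simp add: wt_def sum_apply)
  qed
qed

text \<open>A vector of \<open>x\<close> adds nothing modulo \<open>x\<close>. Hence
  \<open>wt\<close> preserves the bound \<eta> and only raises the dimension.\<close>

lemma codim_insert:
  assumes b: "subspace b" and u: "u \<in> x"
  shows "dim (span (insert u b)) + dim (b \<inter> x) \<le> dim b + dim (span (insert u b) \<inter> x)"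
    and "u \<notin> b \<Longrightarrow> dim (span (insert u b) \<inter> x) = Suc (dim (b \<inter> x))"
proof -
  have bx: "subspace (b \<inter> x)" using b subspace_x by (simp add: subspace_inter)
  have eq: "dim (span (insert u b)) = Suc (dim b)" "dim (span (insert u b) \<inter> x) = Suc (dim (b \<inter> x))"
    if ub: "u \<notin> b"
  proof -
    show d: "dim (span (insert u b)) = Suc (dim b)" using b ub by (rule dim_span_insert)
    have "dim (span (insert u (b \<inter> x))) = Suc (dim (b \<inter> x))" using bx ub by (intro dim_span_insert) auto
    moreover have "span (insert u (b \<inter> x)) \<subseteq> span (insert u b) \<inter> x"
      using u subspace_x by (intro span_minimal subspace_inter) (auto intro: span_base)
    ultimately have ge: "Suc (dim (b \<inter> x)) \<le> dim (span (insert u b) \<inter> x)" by (metis dim_subset)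
    have "dim b + dim (span (insert u b) \<inter> x) \<le> dim (span (insert u b)) + dim (b \<inter> x)"
      using b by (intro codim_mono) (auto intro: span_base)
    thus "dim (span (insert u b) \<inter> x) = Suc (dim (b \<inter> x))" using ge d by simp
  qed
  thus "u \<notin> b \<Longrightarrow> dim (span (insert u b) \<inter> x) = Suc (dim (b \<inter> x))" by blast
  show "dim (span (insert u b)) + dim (b \<inter> x) \<le> dim b + dim (span (insert u b) \<inter> x)"
  proof (cases "u \<in> b")
    case True
    hence "span (insert u b) = b" using b by (simp add: insert_absorb)
    thus ?thesis by (simp only: order_refl)
  next
    case False
    thus ?thesis using eq by simp
  qed
qed

lemma wt_Fil:
  assumes f: "f \<in> Fil \<eta> n"
  shows "wt f \<in> Fil \<eta> (Suc n)"
proof (rule Fil_into[OF clinear_wt subspace_Fil f])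
  fix b assume b: "subspace b" "dim b < dim (b \<inter> x) + \<eta>" "dim b < n"
  show "wt (vee b) \<in> Fil \<eta> (Suc n)"
    unfolding wt_vee
  proof (intro cfun.subspace_sum[OF subspace_Fil] vee_in_Fil)
    fix u assume u: "u \<in> x"
    show "subspace (span (insert u b))" by simp
    show "dim (span (insert u b)) < dim (span (insert u b) \<inter> x) + \<eta>"
      using codim_insert(1)[OF b(1) u] b by simp
    show "dim (span (insert u b)) < Suc n" using b by (simp add: dim_insert)
  qed
qed

lemma wt_Fil_top: "f \<in> Fil \<eta> (Suc D) \<Longrightarrow> wt f \<in> Fil \<eta> (Suc D)"
  using wt_Fil[of f \<eta> "Suc D"] Fil_Suc_trivial[of "Suc (Suc D)" \<eta>] by auto

lemma hat_eq_vee: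
  assumes "y \<in> X"
  shows "hat y = vee y"
proof
  fix z
  have "y \<subseteq> z \<longleftrightarrow> z = y" if "z \<in> X"
    using that assms subspace_eqI[of y z] by (auto simp: X_iff)
  thus "hat y z = vee y z" using assms by (auto simp: hat_def vee_apply)
qed

text \<open>A vertex has dimension \<open>D\<close>, so at \<open>Suc D\<close> both bounds are void
  for it, and its \<open>vee\<close> is its own \<open>hat\<close>.\<close>

lemma Fil_top: "Fil (Suc D) (Suc D) = std_module X"
proof
  show "std_module X \<subseteq> Fil (Suc D) (Suc D)"
  proof (rule order_trans[OF std_module_subset_span_hat])
    show "cfun.span (hat ` X) \<subseteq> Fil (Suc D) (Suc D)"
      by (intro cfun.span_minimal subspace_Fil) (auto simp: hat_eq_vee X_iff intro!: vee_in_Fil)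
  qed simp
qed (rule Fil_std)

lemma wt_eq: "f \<in> std_module X \<Longrightarrow> wt f y = of_nat q ^ lev y * f y"
  using subspace_x by (cases "y \<in> X") (auto simp: wt_def lev_def std_module_def X_iff card_subspace subspace_inter)

text \<open>The whole standard module is the top of the filtration on which \<open>adj\<close> is
  triangular with distinct diagonal entries \<theta> 0, ..., \<theta> D. So the spectrum comes out
  without any multiplicities.\<close>

lemma spectral': "std_module X \<subseteq> cfun.span (\<Union>i\<le>D. eigenspace X R (complex_of_real (\<theta> i)))"
proof
  fix w assume w: "w \<in> std_module X"
  have adj_std: "adj v \<in> std_module X" for v
    by (auto simp: std_module_def adj_def R_iff intro!: sum.neutral)
  have "\<exists>u. (\<forall>i<Suc D. u i \<in> std_module X \<and> adj (u i) = cscale (complex_of_real (\<theta> i)) (u i))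
      \<and> w = (\<Sum>i<Suc D. u i)"
  proof (rule filtration_eigen_decomposition[OF clinear_adj subspace_std_module, where P = "Fil (Suc D)"])
    show "inj_on (\<lambda>i. complex_of_real (\<theta> i)) {..<Suc D}"
      using inj_\<theta>' by (auto simp: inj_on_def lessThan_Suc_atMost)
    show "adj v - cscale (complex_of_real (\<theta> n)) v \<in> Fil (Suc D) n"
      if "n < Suc D" "v \<in> Fil (Suc D) (Suc n)" for n v
      using adj_shift_Fil[OF that(2)] that(1) by simp
  qed (use w adj_std Fil_0 Fil_top in auto)
  then obtain u where u: "\<And>i. i < Suc D \<Longrightarrow> u i \<in> eigenspace X R (complex_of_real (\<theta> i))" "w = (\<Sum>i<Suc D. u i)"
    unfolding eigenspace_def mat_vec_adj by blast
  show "w \<in> cfun.span (\<Union>i\<le>D. eigenspace X R (complex_of_real (\<theta> i)))"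
    unfolding u(2) using u(1) by (intro cfun.span_sum cfun.span_base) (auto simp: less_Suc_eq_le)
qed

sublocale terwilliger_graph X R D \<theta> x
proof
  show "finite X" by simp
  show "R \<subseteq> X \<times> X" by (rule R_subset')
  show "sym R" by (rule sym_R')
  show "gdist R x y \<le> D" if "y \<in> X" for y using that by (simp add: gdist_eq)
  show "gdist R x y \<le> Suc (gdist R x z)" if "(y, z) \<in> R" for y z
    using that lev_adj[OF that] lev_adj[of z y] by (auto simp: gdist_eq R_iff Int_commute)
  show "inj_on \<theta> {..D}" by (rule inj_\<theta>')
  show "std_module X \<subseteq> cfun.span (\<Union>i\<le>D. eigenspace X R (complex_of_real (\<theta> i)))" by (rule spectral')
qed

lemma A_eq: "A = adj"
  by (simp add: A_def mat_vec_adj fun_eq_iff)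

lemma Es_eq: "i \<le> D \<Longrightarrow> Es i f y = (if y \<in> X \<and> lev y = D - i then f y else 0)"
  using lev_le[of y] by (auto simp: Es_apply gdist_eq)

text \<open>On level m, \<open>wt\<close> is multiplication by q^m, and these numbers are distinct.
  So a \<open>wt\<close>-invariant space contains the level components of its vectors, which are
  their images under the \<open>Es i\<close>.\<close>

lemma T_moduleI:
  assumes W: "cfun.subspace W" "W \<subseteq> std_module X"
    and adj: "\<And>w. w \<in> W \<Longrightarrow> adj w \<in> W" and wt: "\<And>w. w \<in> W \<Longrightarrow> wt w \<in> W"
  shows "Tmod W"
  unfolding T_module_iff
proof (intro conjI ballI allI impI)
  show "A w \<in> W" if "w \<in> W" for w using that adj by (simp add: A_eq)
  fix i w assume i: "i \<le> D" and w: "w \<in> W"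
  define P where "P n = {v \<in> std_module X. \<forall>y. n \<le> lev y \<longrightarrow> v y = 0}" for n
  have "\<exists>u. (\<forall>m<Suc D. u m \<in> W \<and> wt (u m) = cscale (of_nat q ^ m) (u m)) \<and> w = (\<Sum>m<Suc D. u m)"
  proof (rule filtration_eigen_decomposition[where P = P, OF clinear_wt W(1) wt])
    show "P 0 \<subseteq> {0}" by (auto simp: P_def fun_eq_iff vec_apply)
    show "inj_on (\<lambda>m. of_nat q ^ m :: complex) {..<Suc D}"
    proof (rule inj_onI)
      fix a b assume "of_nat q ^ a = (of_nat q ^ b :: complex)"
      hence "q ^ a = q ^ b" by (metis of_nat_eq_iff of_nat_power)
      thus "a = b" using q_ge_2 by (simp add: power_inject_exp)
    qed
    show "w \<in> P (Suc D)" using w W(2) lev_le by (force simp: P_def not_less_eq_eq[symmetric])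
    show "wt v - cscale (of_nat q ^ n) v \<in> P n" if "n < Suc D" "v \<in> P (Suc n)" for n v
    proof -
      have v: "v \<in> std_module X" using that by (simp add: P_def)
      hence "(wt v - cscale (of_nat q ^ n) v) y = 0" if "y \<notin> X \<or> n \<le> lev y" for y
        using that \<open>v \<in> P (Suc n)\<close>
        by (cases "lev y = n") (auto simp: vec_apply wt_eq P_def std_module_def)
      thus ?thesis by (auto simp: P_def std_module_def)
    qed
  qed (use w in auto)
  then obtain u where u: "\<And>m. m < Suc D \<Longrightarrow> u m \<in> W"
    "\<And>m. m < Suc D \<Longrightarrow> wt (u m) = cscale (of_nat q ^ m) (u m)" "w = (\<Sum>m<Suc D. u m)"
    by blast
  have u0: "u m y = 0" if "m < Suc D" "lev y \<noteq> m" for m y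
  proof -
    have "of_nat q ^ lev y * u m y = of_nat q ^ m * u m y"
      using u(1,2)[OF that(1)] W(2) wt_eq[of "u m" y] by (auto simp: vec_apply)
    moreover have "q ^ lev y \<noteq> q ^ m" using that q_ge_2 by (simp add: power_inject_exp)
    hence "of_nat q ^ lev y \<noteq> (of_nat q ^ m :: complex)" by (metis of_nat_eq_iff of_nat_power)
    ultimately show ?thesis by simp
  qed
  have "Es i w = u (D - i)"
  proof
    fix y
    have wy: "w y = u (lev y) y"
    proof -
      have "w y = (\<Sum>m<Suc D. if m = lev y then u m y else 0)"
        unfolding u(3) sum_apply using u0 by (intro sum.cong) auto
      thus ?thesis using lev_le[of y] by simp
    qed
    show "Es i w y = u (D - i) y"
    proof (cases "y \<in> X \<and> lev y = D - i")
      case True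
      thus ?thesis using i wy by (auto simp: Es_eq)
    next
      case False
      moreover have "u (D - i) \<in> std_module X" using u(1) W(2) by auto
      ultimately have "u (D - i) y = 0" using u0[of "D - i" y] by (auto simp: std_module_def)
      thus ?thesis using False i by (auto simp: Es_eq)
    qed
  qed
  thus "Es i w \<in> W" using u(1)[of "D - i"] by simp
qed (use W in auto)

lemma Tmod_Fil: "Tmod (Fil \<eta> (Suc D))"
  by (rule T_moduleI[OF subspace_Fil Fil_std]) (auto intro: adj_Fil wt_Fil_top)

section \<open>Vectors supported on one level\<close>

definition hyps_at :: "'v set \<Rightarrow> 'v set set" where
  "hyps_at a = {H. subspace H \<and> Suc (dim H) = D \<and> H \<inter> x = a}"

text \<open>Up to a scalar this is \<open>ip h \<xi>\<close> for \<open>h\<close> supported one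
  level above \<xi> (see \<open>hsum_eq\<close>). Spread over (D-1)-spaces, it can be compared with
  the identities of \<open>sum_down_up\<close>.\<close>

definition hsum :: "('v set \<Rightarrow> complex) \<Rightarrow> 'v set \<Rightarrow> complex" where
  "hsum h \<xi> = (\<Sum>H | H \<in> hyps_at (\<xi> \<inter> x) \<and> \<xi> \<subseteq> H. ip h H)"

lemma q_bracket_strict_mono: "a < b \<Longrightarrow> q_bracket q a < q_bracket q b"
  using q_ge_2 unfolding q_bracket_def by (intro divide_strict_right_mono) (auto intro: power_strict_increasing)

lemma hyps_join_eq:
  "hyps (b \<squnion> c) y = {H \<in> hyps b y. c \<subseteq> H}"
proof (intro set_eqI iffI)
  fix H assume "H \<in> hyps (b \<squnion> c) y"
  thus "H \<in> {H \<in> hyps b y. c \<subseteq> H}" using join_upper[of b c] join_upper[of c b] by (auto simp: hyps_def)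
next
  fix H assume "H \<in> {H \<in> hyps b y. c \<subseteq> H}"
  thus "H \<in> hyps (b \<squnion> c) y" using join_least[of H b c] by (auto simp: hyps_def)
qed

text \<open>Since \<open>\<xi> \<inter> x\<close> is a hyperplane of \<open>y \<inter> x\<close>, a
  hyperplane of \<open>y\<close> above \<xi> meets \<open>x\<close> in
  \<open>\<xi> \<inter> x\<close> unless it contains all of \<open>y \<inter> x\<close>. The count
  is the total minus the hyperplanes above the join of \<xi> and
  \<open>y \<inter> x\<close>.\<close>

lemma card_hyps_avoiding:
  assumes \<xi>: "subspace \<xi>" and y: "y \<in> X" "\<xi> \<subseteq> y" "lev y = Suc (dim (\<xi> \<inter> x))"
  shows "of_nat (card {H \<in> hyps \<xi> y. H \<inter> x = \<xi> \<inter> x}) = br (D - dim \<xi>) - br (D - Suc (dim \<xi>))"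
proof -
  have ys: "subspace y" "dim y = D" using y by (auto simp: X_iff)
  have yx: "subspace (y \<inter> x)" using ys subspace_x by (simp add: subspace_inter)
  have "H \<inter> x = \<xi> \<inter> x \<longleftrightarrow> \<not> y \<inter> x \<subseteq> H" if H: "H \<in> hyps \<xi> y" for H
  proof -
    have Hs: "subspace H" "\<xi> \<subseteq> H" "H \<subseteq> y" using H by (auto simp: hyps_def)
    have Hx: "subspace (H \<inter> x)" "subspace (\<xi> \<inter> x)" using Hs \<xi> subspace_x by (auto simp: subspace_inter)
    show ?thesis
    proof
      assume eq: "H \<inter> x = \<xi> \<inter> x"
      show "\<not> y \<inter> x \<subseteq> H"
      proof
        assume "y \<inter> x \<subseteq> H"
        hence "y \<inter> x = \<xi> \<inter> x" using eq Hs by blast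
        thus False using y(3) by (simp add: lev_def)
      qed
    next
      assume "\<not> y \<inter> x \<subseteq> H"
      hence "H \<inter> x \<noteq> y \<inter> x" by blast
      hence "\<not> dim (y \<inter> x) \<le> dim (H \<inter> x)" using subspace_eqI[OF Hx(1) yx] Hs by blast
      hence "dim (H \<inter> x) \<le> dim (\<xi> \<inter> x)" using y(3) by (simp add: lev_def)
      thus "H \<inter> x = \<xi> \<inter> x" using subspace_eqI[OF Hx(2,1)] Hs by blast
    qed
  qed
  hence "{H \<in> hyps \<xi> y. H \<inter> x = \<xi> \<inter> x} = hyps \<xi> y - hyps (\<xi> \<squnion> (y \<inter> x)) y"
    unfolding hyps_join_eq by blast
  moreover have sub: "hyps (\<xi> \<squnion> (y \<inter> x)) y \<subseteq> hyps \<xi> y" unfolding hyps_join_eq by blast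
  ultimately have "(of_nat (card {H \<in> hyps \<xi> y. H \<inter> x = \<xi> \<inter> x}) :: complex) =
      of_nat (card (hyps \<xi> y)) - of_nat (card (hyps (\<xi> \<squnion> (y \<inter> x)) y))"
    by (simp add: card_Diff_subset of_nat_diff card_mono)
  moreover have "of_nat (card (hyps \<xi> y)) = br (D - dim \<xi>)"
    using card_hyps_br[OF \<xi> ys(1) y(2)] ys by simp
  moreover have "of_nat (card (hyps (\<xi> \<squnion> (y \<inter> x)) y)) = br (D - dim (\<xi> \<squnion> (y \<inter> x)))"
    using card_hyps_br[of "\<xi> \<squnion> (y \<inter> x)" y] join_least[OF ys(1) y(2), of "y \<inter> x"] ys by simp
  moreover have "dim (\<xi> \<squnion> (y \<inter> x)) = Suc (dim \<xi>)"
  proof -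
    have "\<xi> \<inter> (y \<inter> x) = \<xi> \<inter> x" using y by blast
    thus ?thesis using dim_join_Int[OF \<xi> yx] y(3) by (simp add: lev_def)
  qed
  ultimately show ?thesis by simp
qed

text \<open>
  The number of \<open>z \<supseteq> H\<close> in \<open>X\<close> with \<open>\<xi> \<subseteq> z\<close> and \<open>z \<inter> x = H \<inter> x\<close> depends on whether \<open>\<xi> \<subseteq> H \<squnion> x\<close>.
  The correction by the subspaces \<open>\<xi>'' \<subseteq> H\<close> with \<open>\<xi>'' \<squnion> x = \<xi> \<squnion> x\<close> removes this dependence.
\<close>

lemma card_above_hyperplane_at:
  assumes \<xi>: "subspace \<xi>" and H: "H \<in> hyps_at (\<xi> \<inter> x)"
  shows "card {z \<in> X. \<xi> \<subseteq> z \<and> z \<inter> x = \<xi> \<inter> x \<and> H \<subseteq> z} +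
      (\<Sum>\<xi>'\<in>hyps (\<xi> \<inter> x) \<xi>. card {\<xi>'' \<in> exts x \<xi>' (\<xi> \<squnion> x). \<xi>'' \<subseteq> H}) =
    (if \<xi> \<subseteq> H then card (exts x H UNIV) else 0) + card {\<xi>' \<in> hyps (\<xi> \<inter> x) \<xi>. \<xi>' \<subseteq> H}"
proof -
  let ?a = "\<xi> \<inter> x"
  let ?E = "\<lambda>\<xi>'. {\<xi>'' \<in> exts x \<xi>' (\<xi> \<squnion> x). \<xi>'' \<subseteq> H}"
  let ?Z = "{z \<in> X. \<xi> \<subseteq> z \<and> z \<inter> x = ?a \<and> H \<subseteq> z}"
  have Hs: "subspace H" "Suc (dim H) = D" "H \<inter> x = ?a" using H by (auto simp: hyps_at_def)
  have \<xi>H: "subspace (\<xi> \<inter> H)" using \<xi> Hs by (simp add: subspace_inter)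
  have \<xi>': "subspace \<xi>'" "?a \<subseteq> \<xi>'" "\<xi>' \<subseteq> \<xi>" "Suc (dim \<xi>') = dim \<xi>" "\<xi>' \<inter> x = ?a"
    if "\<xi>' \<in> hyps ?a \<xi>" for \<xi>'
    using that by (auto simp: hyps_def)
  have notin: "?E \<xi>' = {}" if "\<not> \<xi>' \<subseteq> H" for \<xi>' using that by (auto simp: exts_def)
  have \<xi>'_eq: "\<xi>' = \<xi> \<inter> H" if "\<not> \<xi> \<subseteq> H" "\<xi>' \<in> hyps ?a \<xi>" "\<xi>' \<subseteq> H" for \<xi>'
  proof -
    have "dim (\<xi> \<inter> H) < dim \<xi>"
      using that(1) subspace_eqI[OF \<xi>H \<xi>] by (meson Int_lower1 inf.absorb_iff1 not_less)
    thus ?thesis using \<xi>'[OF that(2)] that(3) \<xi>H by (intro subspace_eqI) auto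
  qed
  consider "\<xi> \<subseteq> H" | "\<not> \<xi> \<subseteq> H" "Suc (dim (\<xi> \<inter> H)) = dim \<xi>" | "\<not> \<xi> \<subseteq> H" "Suc (dim (\<xi> \<inter> H)) \<noteq> dim \<xi>"
    by blast
  thus ?thesis
  proof cases
    case 1
    have "?Z = exts x H UNIV" using 1 Hs by (auto simp: exts_def X_iff)
    \<comment> \<open>By the modular law the join of \<xi> and \<open>x\<close> meets
      \<open>H\<close> in \<xi> only, so every \<xi>' contributes exactly \<xi> itself.\<close>
    moreover have "?E \<xi>' = {\<xi>}" if h: "\<xi>' \<in> hyps ?a \<xi>" for \<xi>'
    proof (intro set_eqI iffI)
      fix \<xi>'' assume e: "\<xi>'' \<in> ?E \<xi>'"
      have "(x \<squnion> \<xi>) \<inter> H = (x \<inter> H) \<squnion> \<xi>" using modular_law[OF subspace_x \<xi> Hs(1) 1] .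
      also have "x \<inter> H \<union> \<xi> = \<xi>" using Hs(3) by blast
      finally have "(\<xi> \<squnion> x) \<inter> H = \<xi>" using \<xi> by (simp add: Un_commute)
      moreover have "\<xi>'' \<subseteq> (\<xi> \<squnion> x) \<inter> H" "subspace \<xi>''" "dim \<xi>'' = dim \<xi>"
        using e \<xi>'[OF h] by (auto simp: exts_def)
      ultimately have "\<xi>'' = \<xi>" using \<xi> by (intro subspace_eqI) auto
      thus "\<xi>'' \<in> {\<xi>}" by simp
    next
      fix \<xi>'' assume "\<xi>'' \<in> {\<xi>}"
      thus "\<xi>'' \<in> ?E \<xi>'" using \<xi>'[OF h] 1 \<xi> join_upper(1)[of \<xi> x] by (auto simp: exts_def)
    qed
    moreover have "{\<xi>' \<in> hyps ?a \<xi>. \<xi>' \<subseteq> H} = hyps ?a \<xi>" using 1 \<xi>'(3) by blast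
    ultimately show ?thesis using 1 by simp
  next
    case 2
    have h: "\<xi> \<inter> H \<in> hyps ?a \<xi>" using 2 \<xi>H Hs(3) by (auto simp: hyps_def)
    have Q: "{\<xi>' \<in> hyps ?a \<xi>. \<xi>' \<subseteq> H} = {\<xi> \<inter> H}"
    proof (intro set_eqI iffI)
      fix \<xi>' assume "\<xi>' \<in> {\<xi>' \<in> hyps ?a \<xi>. \<xi>' \<subseteq> H}"
      thus "\<xi>' \<in> {\<xi> \<inter> H}" using \<xi>'_eq[OF 2(1)] by blast
    next
      fix \<xi>' assume "\<xi>' \<in> {\<xi> \<inter> H}"
      thus "\<xi>' \<in> {\<xi>' \<in> hyps ?a \<xi>. \<xi>' \<subseteq> H}" using h by simp
    qed
    have "(\<Sum>\<xi>'\<in>hyps ?a \<xi>. card (?E \<xi>')) = (\<Sum>\<xi>'\<in>{\<xi> \<inter> H}. card (?E \<xi>'))"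
    proof (rule sum.mono_neutral_right)
      show "\<forall>\<xi>'\<in>hyps ?a \<xi> - {\<xi> \<inter> H}. card (?E \<xi>') = 0"
      proof
        fix \<xi>' assume "\<xi>' \<in> hyps ?a \<xi> - {\<xi> \<inter> H}"
        hence "\<not> \<xi>' \<subseteq> H" using \<xi>'_eq[OF 2(1)] by blast
        thus "card (?E \<xi>') = 0" using notin by (metis card.empty)
      qed
    qed (use h in auto)
    hence P: "(\<Sum>\<xi>'\<in>hyps ?a \<xi>. card (?E \<xi>')) = card (?E (\<xi> \<inter> H))" by simp
    obtain p where p: "p \<in> \<xi>" "p \<notin> H" using 2 by blast
    have \<xi>eq: "span (insert p (\<xi> \<inter> H)) = \<xi>"
      using p \<xi>H \<xi> 2 by (intro span_insert_eq) auto
    have Zsub: "?Z \<subseteq> {span (insert p H)}"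
    proof
      fix z assume z: "z \<in> ?Z"
      hence "span (insert p H) = z" using p Hs by (intro span_insert_eq) (auto simp: X_iff)
      thus "z \<in> {span (insert p H)}" by simp
    qed
    have dimz: "dim (span (insert p H)) = D" using dim_span_insert[OF Hs(1) p(2)] Hs(2) by simp
    have \<xi>z: "\<xi> \<subseteq> span (insert p H)"
      using span_mono[of "insert p (\<xi> \<inter> H)" "insert p H"] \<xi>eq by blast
    have \<xi>x_dim: "dim (\<xi> \<squnion> x) + dim ?a = dim \<xi> + D" using dim_join_Int[OF \<xi> subspace_x] dim_x by simp
    \<comment> \<open>Exactly one of two things happens. If p is outside the join of
      \<open>H\<close> and \<open>x\<close>, adjoining p to \<open>H\<close> gives the one vertex
      and no \<xi>'' fits. Otherwise that vertex meets \<open>x\<close> in too much, and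
      \<open>H \<inter> (\<xi> \<squnion> x)\<close> is the one \<xi>''.\<close>
    have card_sum: "card ?Z + card (?E (\<xi> \<inter> H)) = 1"
    proof (cases "p \<in> H \<squnion> x")
      case True
      have "?Z = {}"
      proof (rule ccontr)
        assume "?Z \<noteq> {}"
        then obtain z where z: "z \<in> ?Z" by blast
        hence "z = span (insert p H)" using Zsub by blast
        hence "span (insert p H) \<inter> x = H \<inter> x" using z Hs(3) by auto
        thus False using True span_insert_Int_iff[OF Hs(1) subspace_x p(2)] by blast
      qed
      moreover have "?E (\<xi> \<inter> H) = {H \<inter> (\<xi> \<squnion> x)}"
      proof -
        let ?G = "H \<inter> (\<xi> \<squnion> x)"
        have Gs: "subspace ?G" using Hs by (simp add: subspace_inter)
        have "insert p (\<xi> \<inter> H) \<subseteq> H \<squnion> x" using True join_upper(1)[of H x] by blast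
        hence "\<xi> \<subseteq> H \<squnion> x" using \<xi>eq span_minimal[of "insert p (\<xi> \<inter> H)" "H \<squnion> x"] by simp
        hence "\<xi> \<squnion> x \<subseteq> H \<squnion> x" using join_upper(2)[of x H] by (intro join_least) auto
        hence "(H \<squnion> x) \<inter> (\<xi> \<squnion> x) = \<xi> \<squnion> x" by blast
        moreover have "(H \<squnion> x) \<inter> (\<xi> \<squnion> x) = ?G \<squnion> x"
          using modular_law[OF Hs(1) subspace_x subspace_span, of "\<xi> \<union> x"] join_upper(2)[of x \<xi>] by simp
        ultimately have "dim (?G \<squnion> x) = dim (\<xi> \<squnion> x)" by simp
        moreover have Gx: "?G \<inter> x = ?a" using Hs(3) join_upper(2)[of x \<xi>] by blast
        ultimately have dG: "dim ?G = dim \<xi>"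
          using dim_join_Int[OF Gs subspace_x] \<xi>x_dim dim_x by simp
        show ?thesis
        proof (intro set_eqI iffI)
          fix \<xi>'' assume "\<xi>'' \<in> ?E (\<xi> \<inter> H)"
          hence "subspace \<xi>''" "\<xi>'' \<subseteq> ?G" "dim \<xi>'' = dim \<xi>" using 2 by (auto simp: exts_def)
          hence "\<xi>'' = ?G" using dG Gs by (intro subspace_eqI) auto
          thus "\<xi>'' \<in> {?G}" by simp
        next
          fix \<xi>'' assume "\<xi>'' \<in> {?G}"
          moreover have "\<xi> \<inter> H \<inter> x = ?a" "\<xi> \<inter> H \<subseteq> ?G" using Hs(3) join_upper(1)[of \<xi> x] by blast+
          ultimately show "\<xi>'' \<in> ?E (\<xi> \<inter> H)" using 2 dG Gs Gx by (simp add: exts_def)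
        qed
      qed
      ultimately show ?thesis by simp
    next
      case False
      have "span (insert p H) \<in> ?Z"
        using \<xi>z dimz span_insert_Int_iff[OF Hs(1) subspace_x p(2)] False Hs(3) span_superset[of "insert p H"]
        by (simp only: X_iff mem_Collect_eq subspace_span) auto
      hence "?Z = {span (insert p H)}" using Zsub by blast
      moreover have "?E (\<xi> \<inter> H) = {}"
      proof (rule ccontr)
        assume "?E (\<xi> \<inter> H) \<noteq> {}"
        then obtain \<xi>'' where e: "subspace \<xi>''" "\<xi>'' \<subseteq> \<xi> \<squnion> x" "dim \<xi>'' = dim \<xi>" "\<xi>'' \<inter> x = ?a" "\<xi>'' \<subseteq> H"
          using 2 Hs(3) by (auto simp: exts_def)
        have "\<xi>'' \<squnion> x \<subseteq> \<xi> \<squnion> x" using e(2) join_upper(2)[of x \<xi>] by (intro join_least) auto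
        moreover have "dim (\<xi>'' \<squnion> x) = dim (\<xi> \<squnion> x)"
          using dim_join_Int[OF e(1) subspace_x] e \<xi>x_dim dim_x by simp
        ultimately have "\<xi>'' \<squnion> x = \<xi> \<squnion> x" by (intro subspace_eqI) auto
        hence "p \<in> \<xi>'' \<squnion> x" using p join_upper(1)[of \<xi> x] by blast
        moreover have "\<xi>'' \<squnion> x \<subseteq> H \<squnion> x" using e(5) by (intro span_mono) auto
        ultimately show False using False by blast
      qed
      ultimately show ?thesis by simp
    qed
    show ?thesis unfolding P Q using card_sum 2(1) by simp
  next
    case 3
    have none: "\<not> \<xi>' \<subseteq> H" if "\<xi>' \<in> hyps ?a \<xi>" for \<xi>'
      using \<xi>'_eq[OF 3(1) that] \<xi>'[OF that] 3(2) by auto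
    have "?Z = {}"
    proof (rule ccontr)
      assume "?Z \<noteq> {}"
      then obtain z where z: "subspace z" "dim z = D" "\<xi> \<subseteq> z" "H \<subseteq> z" by (auto simp: X_iff)
      have "H \<in> hyps {0} z" using z Hs by (simp add: hyps_0_iff)
      thus False using Suc_dim_Int_hyperplane[OF \<xi> _ z(1,3) 3(1)] 3(2) by blast
    qed
    moreover have "(\<Sum>\<xi>'\<in>hyps ?a \<xi>. card (?E \<xi>')) = 0"
    proof (rule sum.neutral, rule ballI)
      fix \<xi>' assume "\<xi>' \<in> hyps ?a \<xi>"
      thus "card (?E \<xi>') = 0" using notin[OF none] by (metis card.empty)
    qed
    moreover have "{\<xi>' \<in> hyps ?a \<xi>. \<xi>' \<subseteq> H} = {}" using none by blast
    ultimately show ?thesis using 3(1) by (simp only: card.empty if_False)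
  qed
qed

text \<open>The exponent N - 2D + m + 1 is the codimension of the join of \<open>H\<close> and
  \<open>x\<close> in the whole space.\<close>

lemma card_exts_at:
  assumes H: "H \<in> hyps_at a" and a: "dim a = m" "m < D"
  shows "real (card (exts x H UNIV)) = real q ^ (D - m) * q_bracket q (N - 2 * D + Suc m)"
proof -
  have Hs: "subspace H" "Suc (dim H) = D" "H \<inter> x = a" using H by (auto simp: hyps_at_def)
  have "dim (H \<squnion> x) = dim H + (D - m)" using dim_join_Int[OF Hs(1) subspace_x] Hs a dim_x by simp
  moreover have "N = dim H + (D - m) + (N - 2 * D + Suc m)" using Hs(2) N_gt a by simp
  ultimately have p: "real q ^ N = real q ^ dim H * real q ^ (D - m) * real q ^ (N - 2 * D + Suc m)"
    "real q ^ dim (H \<squnion> x) = real q ^ dim H * real q ^ (D - m)"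
    by (metis power_add, metis power_add)
  have "real (card (exts x H UNIV)) * (real q ^ Suc (dim H) - real q ^ dim H) = real q ^ N - real q ^ dim (H \<squnion> x)"
    using card_exts[OF Hs(1) subspace_x subspace_UNIV] dim_UNIV_eq by simp
  hence "real q ^ dim H * (real (card (exts x H UNIV)) * (real q - 1)) =
      real q ^ dim H * (real q ^ (D - m) * (real q ^ (N - 2 * D + Suc m) - 1))"
    unfolding p by (simp add: algebra_simps)
  hence "real (card (exts x H UNIV)) * (real q - 1) = real q ^ (D - m) * (real q ^ (N - 2 * D + Suc m) - 1)"
    using q_ge_2 mult_left_cancel[of "real q ^ dim H"] by simp
  thus ?thesis using q_ge_2 by (simp add: q_bracket_def eq_divide_eq)
qed

lemma card_exts_join:
  assumes \<xi>: "subspace \<xi>" and \<xi>': "\<xi>' \<in> hyps (\<xi> \<inter> x) \<xi>" and m: "dim (\<xi> \<inter> x) = m" "m \<le> D"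
  shows "real (card (exts x \<xi>' (\<xi> \<squnion> x))) = real q ^ (D - m)"
proof -
  have s: "subspace \<xi>'" "\<xi>' \<subseteq> \<xi>" "Suc (dim \<xi>') = dim \<xi>" "\<xi>' \<inter> x = \<xi> \<inter> x" using \<xi>' by (auto simp: hyps_def)
  have "dim (\<xi>' \<squnion> x) = dim \<xi>' + (D - m)" "dim (\<xi> \<squnion> x) = Suc (dim \<xi>') + (D - m)"
    using dim_join_Int[OF s(1) subspace_x] dim_join_Int[OF \<xi> subspace_x] s m dim_x by auto
  hence p: "real q ^ dim (\<xi> \<squnion> x) = real q ^ Suc (dim \<xi>') * real q ^ (D - m)"
    "real q ^ dim (\<xi>' \<squnion> x) = real q ^ dim \<xi>' * real q ^ (D - m)"
    by (metis power_add, metis power_add)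
  have "\<xi>' \<subseteq> \<xi> \<squnion> x" "x \<subseteq> \<xi> \<squnion> x" using s join_upper(1)[of \<xi> x] join_upper(2)[of x \<xi>] by auto
  hence "real (card (exts x \<xi>' (\<xi> \<squnion> x))) * (real q ^ Suc (dim \<xi>') - real q ^ dim \<xi>') =
      real q ^ (D - m) * (real q ^ Suc (dim \<xi>') - real q ^ dim \<xi>')"
    using card_exts[OF s(1) subspace_x subspace_span] p by (simp add: algebra_simps)
  moreover have "real q ^ Suc (dim \<xi>') - real q ^ dim \<xi>' \<noteq> 0" using q_ge_2 by simp
  ultimately show ?thesis using mult_right_cancel by blast
qed

text \<open>After exchanging the sums, every vertex above \<xi> in the support of \<open>h\<close>
  lies above the same number of the spaces H, by \<open>card_hyps_avoiding\<close>.\<close>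

lemma hsum_eq:
  assumes supp: "\<And>y. h y \<noteq> 0 \<Longrightarrow> y \<in> X \<and> lev y = Suc m"
    and \<xi>: "subspace \<xi>" "dim (\<xi> \<inter> x) = m"
  shows "hsum h \<xi> = (br (D - dim \<xi>) - br (D - Suc (dim \<xi>))) * ip h \<xi>"
proof -
  have "hsum h \<xi> = (\<Sum>y\<in>X. \<Sum>H | H \<in> {H. H \<in> hyps_at (\<xi> \<inter> x) \<and> \<xi> \<subseteq> H} \<and> H \<subseteq> y. h y)"
    unfolding hsum_def ip_def by (rule sum.swap_restrict) auto
  also have "\<dots> = (\<Sum>y\<in>X. if \<xi> \<subseteq> y then (br (D - dim \<xi>) - br (D - Suc (dim \<xi>))) * h y else 0)"
  proof (rule sum.cong[OF refl])
    fix y assume y: "y \<in> X"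
    let ?S = "{H. H \<in> {H. H \<in> hyps_at (\<xi> \<inter> x) \<and> \<xi> \<subseteq> H} \<and> H \<subseteq> y}"
    show "(\<Sum>H\<in>?S. h y) = (if \<xi> \<subseteq> y then (br (D - dim \<xi>) - br (D - Suc (dim \<xi>))) * h y else 0)"
    proof (cases "h y = 0")
      case False
      hence lev: "lev y = Suc (dim (\<xi> \<inter> x))" using supp \<xi> by blast
      show ?thesis
      proof (cases "\<xi> \<subseteq> y")
        case True
        have "?S = {H \<in> hyps \<xi> y. H \<inter> x = \<xi> \<inter> x}"
          using y by (auto simp: hyps_at_def hyps_def X_iff)
        thus ?thesis using card_hyps_avoiding[OF \<xi>(1) y True lev] True by simp
      next
        case False
        hence "?S = {}" by blast
        thus ?thesis using False by (simp only: sum.empty if_False)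
      qed
    qed simp
  qed
  also have "\<dots> = (br (D - dim \<xi>) - br (D - Suc (dim \<xi>))) * ip h \<xi>"
    unfolding ip_def by (simp add: sum_distrib_left flip: sum.inter_filter)
  finally show ?thesis .
qed

text \<open>At a vertex z above \<xi> with \<open>z \<inter> x = \<xi> \<inter> x\<close> both
  \<open>h\<close> and \<open>adj h\<close> vanish, so by \<open>sum_down_up\<close> the values of
  \<open>ip h\<close> on the hyperplanes of z add up to 0. Hyperplanes with a smaller intersection
  drop out, as no vertex above them reaches level m + 1. Summing over all z and regrouping by H with
  \<open>card_above_hyperplane_at\<close> gives the recurrence.\<close>

lemma hsum_recurrence:
  assumes supp: "\<And>y. h y \<noteq> 0 \<Longrightarrow> y \<in> X \<and> lev y = Suc m"
    and low: "\<And>z. z \<in> X \<Longrightarrow> lev z = m \<Longrightarrow> adj h z = 0"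
    and ip0: "\<And>b. subspace b \<Longrightarrow> dim b < dim (b \<inter> x) + \<eta> \<Longrightarrow> ip h b = 0"
    and \<xi>: "subspace \<xi>" "dim (\<xi> \<inter> x) = m" "dim \<xi> = m + \<eta>" and m: "m < D"
  shows "of_real (real q ^ (D - m) * q_bracket q (N - 2 * D + Suc m)) * hsum h \<xi> =
    (\<Sum>\<xi>'\<in>hyps (\<xi> \<inter> x) \<xi>. \<Sum>\<xi>''\<in>exts x \<xi>' (\<xi> \<squnion> x). hsum h \<xi>'')"
proof -
  let ?a = "\<xi> \<inter> x" and ?n = "complex_of_real (real q ^ (D - m) * q_bracket q (N - 2 * D + Suc m))"
  define Z where "Z = {z \<in> X. \<xi> \<subseteq> z \<and> z \<inter> x = ?a}"
  have sum0: "(\<Sum>H | H \<in> hyps_at ?a \<and> H \<subseteq> z. ip h H) = 0" if z: "z \<in> Z" for z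
  proof -
    have zs: "z \<in> X" "subspace z" "dim z = D" "z \<inter> x = ?a" using z by (auto simp: Z_def X_iff)
    have lev: "lev z = m" using zs \<xi> by (simp add: lev_def)
    hence "h z = 0" using supp[of z] by auto
    hence "(\<Sum>H\<in>hyps {0} z. ip h H) = 0" using sum_down_up[OF zs(1), of h] low[OF zs(1) lev] by simp
    moreover have "(\<Sum>H | H \<in> hyps_at ?a \<and> H \<subseteq> z. ip h H) = (\<Sum>H\<in>hyps {0} z. ip h H)"
    proof (rule sum.mono_neutral_left)
      show "{H. H \<in> hyps_at ?a \<and> H \<subseteq> z} \<subseteq> hyps {0} z"
        using zs by (auto simp: hyps_at_def hyps_0_iff)
      show "\<forall>H\<in>hyps {0} z - {H. H \<in> hyps_at ?a \<and> H \<subseteq> z}. ip h H = 0"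
      proof
        fix H assume "H \<in> hyps {0} z - {H. H \<in> hyps_at ?a \<and> H \<subseteq> z}"
        hence Hs: "subspace H" "H \<subseteq> z" "Suc (dim H) = D" "H \<inter> x \<noteq> ?a"
          using zs by (auto simp: hyps_at_def hyps_0_iff)
        have "dim (H \<inter> x) < m"
        proof (rule ccontr)
          assume "\<not> dim (H \<inter> x) < m"
          moreover have "H \<inter> x \<subseteq> ?a" using Hs zs(4) by blast
          moreover have "subspace (H \<inter> x)" "subspace ?a"
            using Hs \<xi> subspace_x by (auto simp: subspace_inter)
          ultimately have "H \<inter> x = ?a" using \<xi>(2) by (intro subspace_eqI) auto
          thus False using Hs by blast
        qed
        moreover have "lev y \<le> Suc (dim (H \<inter> x))" if "y \<in> X" "H \<subseteq> y" for y
          using codim_mono[of H y] that Hs by (auto simp: X_iff lev_def)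
        ultimately have "h y = 0" if "y \<in> X" "H \<subseteq> y" for y using supp[of y] that by fastforce
        thus "ip h H = 0" unfolding ip_def by (intro sum.neutral) auto
      qed
    qed simp
    ultimately show ?thesis by simp
  qed
  have hsum_alt: "hsum h \<zeta> = (\<Sum>H\<in>hyps_at ?a. if \<zeta> \<subseteq> H then ip h H else 0)" if "\<zeta> \<inter> x = ?a" for \<zeta>
    unfolding hsum_def that by (simp flip: sum.inter_filter)
  have "0 = (\<Sum>z\<in>Z. \<Sum>H | H \<in> hyps_at ?a \<and> H \<subseteq> z. ip h H)" using sum0 by simp
  also have "\<dots> = (\<Sum>H\<in>hyps_at ?a. \<Sum>z | z \<in> Z \<and> H \<subseteq> z. ip h H)"
    by (rule sum.swap_restrict) auto
  also have "\<dots> = (\<Sum>H\<in>hyps_at ?a. of_nat (card {z \<in> Z. H \<subseteq> z}) * ip h H)" by simp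
  finally have N0: "(\<Sum>H\<in>hyps_at ?a. of_nat (card {z \<in> Z. H \<subseteq> z}) * ip h H) = 0" by simp
  have P: "(\<Sum>H\<in>hyps_at ?a. of_nat (\<Sum>\<xi>'\<in>hyps ?a \<xi>. card {\<xi>'' \<in> exts x \<xi>' (\<xi> \<squnion> x). \<xi>'' \<subseteq> H}) * ip h H) =
      (\<Sum>\<xi>'\<in>hyps ?a \<xi>. \<Sum>\<xi>''\<in>exts x \<xi>' (\<xi> \<squnion> x). hsum h \<xi>'')"
  proof -
    have "(\<Sum>\<xi>''\<in>exts x \<xi>' (\<xi> \<squnion> x). hsum h \<xi>'') =
        (\<Sum>H\<in>hyps_at ?a. of_nat (card {\<xi>'' \<in> exts x \<xi>' (\<xi> \<squnion> x). \<xi>'' \<subseteq> H}) * ip h H)"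
      if "\<xi>' \<in> hyps ?a \<xi>" for \<xi>'
    proof -
      have "\<xi>'' \<inter> x = ?a" if "\<xi>'' \<in> exts x \<xi>' (\<xi> \<squnion> x)" for \<xi>''
        using that \<open>\<xi>' \<in> hyps ?a \<xi>\<close> by (auto simp: exts_def hyps_def)
      hence "(\<Sum>\<xi>''\<in>exts x \<xi>' (\<xi> \<squnion> x). hsum h \<xi>'') =
          (\<Sum>\<xi>''\<in>exts x \<xi>' (\<xi> \<squnion> x). \<Sum>H\<in>hyps_at ?a. if \<xi>'' \<subseteq> H then ip h H else 0)"
        by (intro sum.cong refl hsum_alt)
      also have "\<dots> = (\<Sum>H\<in>hyps_at ?a. \<Sum>\<xi>''\<in>exts x \<xi>' (\<xi> \<squnion> x). if \<xi>'' \<subseteq> H then ip h H else 0)"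
        by (rule sum.swap)
      finally show ?thesis by (simp flip: sum.inter_filter)
    qed
    hence "(\<Sum>\<xi>'\<in>hyps ?a \<xi>. \<Sum>\<xi>''\<in>exts x \<xi>' (\<xi> \<squnion> x). hsum h \<xi>'') =
      (\<Sum>\<xi>'\<in>hyps ?a \<xi>. \<Sum>H\<in>hyps_at ?a. of_nat (card {\<xi>'' \<in> exts x \<xi>' (\<xi> \<squnion> x). \<xi>'' \<subseteq> H}) * ip h H)"
      by (rule sum.cong[OF refl])
    also have "\<dots> = (\<Sum>H\<in>hyps_at ?a. \<Sum>\<xi>'\<in>hyps ?a \<xi>. of_nat (card {\<xi>'' \<in> exts x \<xi>' (\<xi> \<squnion> x). \<xi>'' \<subseteq> H}) * ip h H)"
      by (rule sum.swap)
    finally show ?thesis by (simp add: sum_distrib_right)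
  qed
  \<comment> \<open>The correction through the hyperplanes \<xi>' of \<xi> disappears because their
    dimension modulo \<open>x\<close> is \<eta> - 1, where \<open>ip0\<close> applies.\<close>
  have Q: "(\<Sum>H\<in>hyps_at ?a. of_nat (card {\<xi>' \<in> hyps ?a \<xi>. \<xi>' \<subseteq> H}) * ip h H) = 0"
  proof -
    have "hsum h \<xi>' = 0" if "\<xi>' \<in> hyps ?a \<xi>" for \<xi>'
    proof -
      have s: "subspace \<xi>'" "\<xi>' \<inter> x = ?a" "Suc (dim \<xi>') = dim \<xi>" using that by (auto simp: hyps_def)
      have "ip h \<xi>' = 0" using ip0[OF s(1)] s \<xi> by simp
      thus ?thesis using hsum_eq[of h m \<xi>'] supp s \<xi> by simp
    qed
    hence "0 = (\<Sum>\<xi>'\<in>hyps ?a \<xi>. hsum h \<xi>')" by simp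
    also have "\<dots> = (\<Sum>\<xi>'\<in>hyps ?a \<xi>. \<Sum>H\<in>hyps_at ?a. if \<xi>' \<subseteq> H then ip h H else 0)"
      by (intro sum.cong refl hsum_alt) (auto simp: hyps_def)
    also have "\<dots> = (\<Sum>H\<in>hyps_at ?a. \<Sum>\<xi>'\<in>hyps ?a \<xi>. if \<xi>' \<subseteq> H then ip h H else 0)"
      by (rule sum.swap)
    finally show ?thesis by (simp flip: sum.inter_filter)
  qed
  have n: "of_nat (if \<xi> \<subseteq> H then card (exts x H UNIV) else 0) = (if \<xi> \<subseteq> H then ?n else 0)"
    if "H \<in> hyps_at ?a" for H
    using card_exts_at[OF that \<xi>(2) m] by (metis of_nat_0 of_real_of_nat_eq)
  have "(\<Sum>\<xi>'\<in>hyps ?a \<xi>. \<Sum>\<xi>''\<in>exts x \<xi>' (\<xi> \<squnion> x). hsum h \<xi>'') =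
      (\<Sum>H\<in>hyps_at ?a. of_nat (card {z \<in> Z. H \<subseteq> z} +
        (\<Sum>\<xi>'\<in>hyps ?a \<xi>. card {\<xi>'' \<in> exts x \<xi>' (\<xi> \<squnion> x). \<xi>'' \<subseteq> H})) * ip h H)"
    using N0 P by (simp only: of_nat_add distrib_right sum.distrib add_0_left)
  also have "\<dots> = (\<Sum>H\<in>hyps_at ?a. of_nat ((if \<xi> \<subseteq> H then card (exts x H UNIV) else 0) +
        card {\<xi>' \<in> hyps ?a \<xi>. \<xi>' \<subseteq> H}) * ip h H)"
  proof (rule sum.cong[OF refl])
    fix H assume H: "H \<in> hyps_at ?a"
    have "{z \<in> Z. H \<subseteq> z} = {z \<in> X. \<xi> \<subseteq> z \<and> z \<inter> x = ?a \<and> H \<subseteq> z}" by (auto simp: Z_def)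
    thus "of_nat (card {z \<in> Z. H \<subseteq> z} +
        (\<Sum>\<xi>'\<in>hyps ?a \<xi>. card {\<xi>'' \<in> exts x \<xi>' (\<xi> \<squnion> x). \<xi>'' \<subseteq> H})) * ip h H =
      of_nat ((if \<xi> \<subseteq> H then card (exts x H UNIV) else 0) + card {\<xi>' \<in> hyps ?a \<xi>. \<xi>' \<subseteq> H}) * ip h H"
      using card_above_hyperplane_at[OF \<xi>(1) H] by presburger
  qed
  also have "\<dots> = (\<Sum>H\<in>hyps_at ?a. of_nat (if \<xi> \<subseteq> H then card (exts x H UNIV) else 0) * ip h H)"
    using Q by (simp only: of_nat_add distrib_right sum.distrib add_0_right)
  also have "\<dots> = (\<Sum>H\<in>hyps_at ?a. ?n * (if \<xi> \<subseteq> H then ip h H else 0))"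
    using n by (intro sum.cong refl) (auto simp del: of_real_mult of_real_power)
  also have "\<dots> = ?n * hsum h \<xi>"
    unfolding hsum_alt[OF refl] by (rule sum_distrib_left[symmetric])
  finally show ?thesis by simp
qed

text \<open>
  By the recurrence, a value of \<open>hsum h\<close> of maximal modulus is an average of other values with
  total weight less than one.
\<close>

lemma ip_eq_0_below:
  assumes supp: "\<And>y. h y \<noteq> 0 \<Longrightarrow> y \<in> X \<and> lev y = Suc m"
    and low: "\<And>z. z \<in> X \<Longrightarrow> lev z = m \<Longrightarrow> adj h z = 0"
    and ip0: "\<And>b. subspace b \<Longrightarrow> dim b < dim (b \<inter> x) + \<eta> \<Longrightarrow> ip h b = 0"
    and \<eta>: "\<eta> \<le> Suc m" and m: "m < D"
    and \<xi>: "subspace \<xi>" "dim (\<xi> \<inter> x) = m" "dim \<xi> = m + \<eta>"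
  shows "ip h \<xi> = 0"
proof -
  define \<Xi> where "\<Xi> = {\<xi>. subspace \<xi> \<and> dim (\<xi> \<inter> x) = m \<and> dim \<xi> = m + \<eta>}"
  define M where "M = Max ((\<lambda>\<xi>. cmod (hsum h \<xi>)) ` \<Xi>)"
  have "\<xi> \<in> \<Xi>" using \<xi> by (simp add: \<Xi>_def)
  hence "M \<in> (\<lambda>\<xi>. cmod (hsum h \<xi>)) ` \<Xi>" unfolding M_def by (intro Max_in) auto
  then obtain \<zeta> where \<zeta>: "\<zeta> \<in> \<Xi>" "M = cmod (hsum h \<zeta>)" by blast
  have M: "cmod (hsum h \<xi>) \<le> M" if "\<xi> \<in> \<Xi>" for \<xi>
    unfolding M_def using that by (intro Max_ge) auto
  have \<zeta>s: "subspace \<zeta>" "dim (\<zeta> \<inter> x) = m" "dim \<zeta> = m + \<eta>" using \<zeta> by (auto simp: \<Xi>_def)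
  let ?r = "real q ^ (D - m)"
  let ?n = "?r * q_bracket q (N - 2 * D + Suc m)"
  have n_pos: "0 < ?n" using q_bracket_pos[of "N - 2 * D + Suc m"] q_ge_2 by simp
  have ax: "subspace (\<zeta> \<inter> x)" using \<zeta>s subspace_x by (simp add: subspace_inter)
  have "?n * M = cmod (of_real ?n * hsum h \<zeta>)"
    using n_pos \<zeta>(2) by (simp only: norm_mult norm_of_real abs_of_pos)
  also have "\<dots> = cmod (\<Sum>\<xi>'\<in>hyps (\<zeta> \<inter> x) \<zeta>. \<Sum>\<xi>''\<in>exts x \<xi>' (\<zeta> \<squnion> x). hsum h \<xi>'')"
    by (rule arg_cong[where f = cmod], rule hsum_recurrence[OF supp low ip0 \<zeta>s m])
  also have "\<dots> \<le> (\<Sum>\<xi>'\<in>hyps (\<zeta> \<inter> x) \<zeta>. \<Sum>\<xi>''\<in>exts x \<xi>' (\<zeta> \<squnion> x). cmod (hsum h \<xi>''))"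
    by (intro order_trans[OF norm_sum] sum_mono norm_sum)
  also have "\<dots> \<le> (\<Sum>\<xi>'\<in>hyps (\<zeta> \<inter> x) \<zeta>. \<Sum>\<xi>''\<in>exts x \<xi>' (\<zeta> \<squnion> x). M)"
  proof (intro sum_mono M)
    fix \<xi>' \<xi>'' assume h: "\<xi>' \<in> hyps (\<zeta> \<inter> x) \<zeta>" "\<xi>'' \<in> exts x \<xi>' (\<zeta> \<squnion> x)"
    have "\<xi>' \<inter> x = \<zeta> \<inter> x" "Suc (dim \<xi>') = m + \<eta>" using h(1) \<zeta>s by (auto simp: hyps_def)
    thus "\<xi>'' \<in> \<Xi>" using h(2) \<zeta>s by (simp add: \<Xi>_def exts_def)
  qed
  also have "\<dots> = (\<Sum>\<xi>'\<in>hyps (\<zeta> \<inter> x) \<zeta>. ?r * M)"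
    using card_exts_join[OF \<zeta>s(1) _ \<zeta>s(2)] m by (intro sum.cong) auto
  also have "\<dots> = q_bracket q \<eta> * ?r * M"
    using card_hyps[OF ax \<zeta>s(1)] \<zeta>s by simp
  finally have "?n * M \<le> q_bracket q \<eta> * ?r * M" .
  \<comment> \<open>Here \<eta> <= m + 1 < N - 2D + m + 1, the last inequality by N > 2D.\<close>
  moreover have "q_bracket q \<eta> * ?r < ?n"
    using q_bracket_strict_mono[of \<eta> "N - 2 * D + Suc m"] \<eta> N_gt q_ge_2 by (simp add: mult.commute)
  moreover have "0 \<le> M" using \<zeta> by simp
  ultimately have "M = 0" using mult_strict_right_mono[of "q_bracket q \<eta> * ?r" ?n M] by linarith
  hence "hsum h \<xi> = 0" using M[OF \<open>\<xi> \<in> \<Xi>\<close>] by simp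
  hence *: "(br (D - dim \<xi>) - br (D - Suc (dim \<xi>))) * ip h \<xi> = 0"
    using hsum_eq[of h m \<xi>] supp \<xi> by simp
  \<comment> \<open>From dimension \<open>D\<close> on the scalar in \<open>hsum_eq\<close> is 0 and
    says nothing. But then only \<xi> itself could be a vertex above \<xi>, and it lies on level m,
    outside the support of \<open>h\<close>.\<close>
  show ?thesis
  proof (cases "dim \<xi> < D")
    case True
    hence "q_bracket q (D - Suc (dim \<xi>)) < q_bracket q (D - dim \<xi>)" by (intro q_bracket_strict_mono) auto
    thus ?thesis using * by simp
  next
    case False
    have "h y = 0" if "y \<in> X" "\<xi> \<subseteq> y" for y
    proof -
      have "\<xi> = y" using that False \<xi> by (intro subspace_eqI) (auto simp: X_iff)
      hence "lev y \<noteq> Suc m" using \<xi> by (simp add: lev_def)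
      thus ?thesis using supp[of y] by blast
    qed
    thus ?thesis unfolding ip_def by (intro sum.neutral) auto
  qed
qed

section \<open>The nucleus\<close>

lemma herm_wt: "herm X (wt f) g = herm X f (wt g)"
  by (simp add: herm_def wt_def ac_simps)

text \<open>Converse to the use of \<open>wt\<close> in \<open>T_moduleI\<close>: \<open>wt\<close>
  is a linear combination of the \<open>Es i\<close>.\<close>

lemma T_module_wt:
  assumes W: "Tmod W" and w: "w \<in> W"
  shows "wt w \<in> W"
proof -
  have ws: "w \<in> std_module X" using T_module_std[OF W] w by blast
  have "wt w = wt (\<Sum>i\<le>D. Es i w)" using sum_Es[OF ws] by simp
  also have "\<dots> = (\<Sum>i\<le>D. wt (Es i w))" by (rule clinear_sum[OF clinear_wt])
  also have "\<dots> = (\<Sum>i\<le>D. cscale (of_nat q ^ (D - i)) (Es i w))"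
  proof (rule sum.cong[OF refl])
    fix i assume i: "i \<in> {..D}"
    show "wt (Es i w) = cscale (of_nat q ^ (D - i)) (Es i w)"
    proof
      fix y
      show "wt (Es i w) y = cscale (of_nat q ^ (D - i)) (Es i w) y"
        using i by (simp add: wt_eq[OF Es_std] cscale_apply Es_eq)
    qed
  qed
  finally show ?thesis
    using T_module_Es[OF W w] T_module_subspace[OF W]
    by (auto intro!: cfun.subspace_sum cfun.subspace_scale)
qed

lemma vee_in_Fil_top:
  assumes "subspace b" "dim b < dim (b \<inter> x) + \<eta>"
  shows "vee b \<in> Fil \<eta> (Suc D)"
proof -
  have "vee b \<in> Fil \<eta> (Suc (D + dim b))" using assms by (intro vee_in_Fil) auto
  thus ?thesis using Fil_Suc_trivial[of "Suc (D + dim b)" \<eta>] by auto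
qed

text \<open>For n > t, subtracting \<open>\<theta> n\<close> from \<open>adj\<close> multiplies
  \<open>f\<close> by the nonzero number \<theta> t - \<theta> n and moves it one step down the
  filtration; the descent stops at \<open>Suc t\<close>.\<close>

lemma eigvec_in_Fil:
  assumes e: "eigvec t f" "t \<le> D" and f: "f \<in> Fil \<eta> (Suc D)"
  shows "f \<in> Fil \<eta> (Suc t)"
proof -
  have "f \<in> Fil \<eta> n" if "n \<le> Suc D" "t < n" for n
    using that
  proof (induction n rule: inc_induct)
    case base
    show ?case by (rule f)
  next
    case (step n)
    have "adj f - cscale (\<theta> n) f \<in> Fil \<eta> n" using step by (intro adj_shift_Fil) auto
    moreover have "adj f = cscale (\<theta> t) f" using e by (simp add: eigvec_def A_eq)
    ultimately have "cscale (complex_of_real (\<theta> t) - \<theta> n) f \<in> Fil \<eta> n"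
      by (simp add: cfun.scale_left_diff_distrib)
    hence "cscale (1 / (complex_of_real (\<theta> t) - \<theta> n)) (cscale (complex_of_real (\<theta> t) - \<theta> n) f) \<in> Fil \<eta> n"
      by (rule cfun.subspace_scale[OF subspace_Fil])
    moreover have "\<theta> t \<noteq> \<theta> n" using \<theta>_strict_antimono[of t n] step by simp
    ultimately show ?case by simp
  qed
  thus ?thesis using e by simp
qed

text \<open>The new case is dim b = dim (b \<inter> x) + \<eta> with dim (b \<inter> x) < j, by
  induction on the distance of dim (b \<inter> x) from j - 1. The base is
  \<open>ip_eq_0_below\<close>: \<open>adj h\<close> stays in \<open>W\<close>, so it vanishes below
  level j. In the step, \<open>wt\<close> multiplies \<open>h\<close> by q^j, while
  \<open>wt_vee\<close> and the induction hypothesis leave only the vectors of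
  \<open>b \<inter> x\<close>; the two factors q^j and q^(dim (b \<inter> x)) differ.\<close>

lemma ip_eq_0_level:
  assumes W: "Tmod W" and WU: "\<And>w u. w \<in> W \<Longrightarrow> u \<in> Fil \<eta> (Suc D) \<Longrightarrow> herm X w u = 0"
    and ge: "\<And>w y. w \<in> W \<Longrightarrow> w y \<noteq> 0 \<Longrightarrow> j \<le> lev y"
    and h: "h \<in> W" "\<And>y. h y \<noteq> 0 \<Longrightarrow> lev y = j" and \<eta>: "\<eta> \<le> j" and jD: "j \<le> D"
    and b: "subspace b" "dim b < dim (b \<inter> x) + Suc \<eta>" "dim b < j + \<eta>"
  shows "ip h b = 0"
proof -
  have hs: "h \<in> std_module X" using T_module_std[OF W] h by blast
  have ip0: "ip h b = 0" if "subspace b" "dim b < dim (b \<inter> x) + \<eta>" for b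
    using WU[OF h(1) vee_in_Fil_top[OF that]] by (simp add: herm_vee)
  have main: "ip h b = 0" if "subspace b" "dim b = dim (b \<inter> x) + \<eta>" "Suc (dim (b \<inter> x) + d) = j" for b d
    using that
  proof (induction d arbitrary: b)
    case 0
    show ?case
    proof (rule ip_eq_0_below[where m = "dim (b \<inter> x)" and \<eta> = \<eta>])
      show "y \<in> X \<and> lev y = Suc (dim (b \<inter> x))" if "h y \<noteq> 0" for y
        using that h(2) hs 0 by (auto simp: std_module_def)
      show "adj h z = 0" if "lev z = dim (b \<inter> x)" for z
        using ge[of "adj h" z] T_module_A[OF W h(1)] that 0 by (auto simp: A_eq)
      show "\<eta> \<le> Suc (dim (b \<inter> x))" using \<eta> 0 by simp
      show "dim (b \<inter> x) < D" using 0 jD by simp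
    qed (use 0 ip0 in auto)
  next
    case (Suc d)
    have "of_nat q ^ j * ip h b = ip (wt h) b"
      unfolding ip_def sum_distrib_left
    proof (rule sum.cong[OF refl])
      fix y
      show "of_nat q ^ j * h y = wt h y" using h(2)[of y] by (cases "h y = 0") (auto simp: wt_eq[OF hs])
    qed
    also have "\<dots> = herm X h (wt (vee b))" by (simp add: herm_wt flip: herm_vee)
    also have "\<dots> = (\<Sum>u\<in>x. ip h (span (insert u b)))"
      unfolding wt_vee herm_vee[symmetric] herm_def
      by (simp add: sum_apply sum_distrib_left sum.swap[of _ x])
    also have "\<dots> = (\<Sum>u\<in>x. if u \<in> b then ip h b else 0)"
    proof (rule sum.cong[OF refl])
      fix u assume u: "u \<in> x"
      show "ip h (span (insert u b)) = (if u \<in> b then ip h b else 0)"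
      proof (cases "u \<in> b")
        case True
        hence "span (insert u b) = b" using Suc.prems by (simp add: insert_absorb)
        thus ?thesis using True by simp
      next
        case False
        note eq = dim_span_insert[OF Suc.prems(1) False] codim_insert(2)[OF Suc.prems(1) u False]
        have "ip h (span (insert u b)) = 0"
          by (rule Suc.IH) (use eq Suc.prems in \<open>simp_all del: dim_span\<close>)
        thus ?thesis using False by simp
      qed
    qed
    also have "\<dots> = of_nat (card {u \<in> x. u \<in> b}) * ip h b"
      by (simp flip: sum.inter_filter)
    also have "{u \<in> x. u \<in> b} = b \<inter> x" by blast
    also have "card (b \<inter> x) = q ^ dim (b \<inter> x)"
      using Suc.prems subspace_x by (intro card_subspace subspace_inter)
    finally have "of_nat q ^ j * ip h b = of_nat q ^ dim (b \<inter> x) * ip h b" by simp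
    moreover have "q ^ j \<noteq> q ^ dim (b \<inter> x)" using q_ge_2 Suc.prems by (simp add: power_inject_exp)
    hence "of_nat q ^ j \<noteq> (of_nat q ^ dim (b \<inter> x) :: complex)" by (metis of_nat_eq_iff of_nat_power)
    ultimately show ?case by simp
  qed
  show ?thesis
  proof (cases "dim b < dim (b \<inter> x) + \<eta>")
    case True
    thus ?thesis using ip0 b by blast
  next
    case False
    hence "dim b = dim (b \<inter> x) + \<eta>" "dim (b \<inter> x) < j" using b by auto
    moreover from this obtain d where "Suc (dim (b \<inter> x) + d) = j" using less_imp_Suc_add by metis
    ultimately show ?thesis using main b by blast
  qed
qed

text \<open>
  The subspaces \<open>B k\<close> below are permuted by the tridiagonal actions of the adjacency operator, which
  shifts \<open>k\<close> by one upwards, and of the diagonal operator \<open>wt\<close>, which shifts it downwards.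
\<close>

lemma ortho_Fil:
  assumes W: "irred W" and WF: "W \<subseteq> Fil (Suc \<eta>) (Suc D)"
    and WU: "\<And>w u. w \<in> W \<Longrightarrow> u \<in> Fil \<eta> (Suc D) \<Longrightarrow> herm X w u = 0"
    and ge: "\<And>w y. w \<in> W \<Longrightarrow> w y \<noteq> 0 \<Longrightarrow> j \<le> lev y"
    and h: "h \<in> W" "h \<noteq> 0" "\<And>y. h y \<noteq> 0 \<Longrightarrow> lev y = j" and \<eta>: "\<eta> \<le> j"
    and w: "w \<in> W" "u \<in> Fil (Suc \<eta>) (j + \<eta>)"
  shows "herm X w u = 0"
proof -
  have T: "Tmod W" using W by (simp add: irred_T_module_def)
  note Ws = T_module_subspace[OF T] T_module_std[OF T]
  obtain y where "h y \<noteq> 0" using h(2) by (auto simp: fun_eq_iff zero_fun_apply)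
  hence jD: "j \<le> D" using h(3) lev_le by metis
  \<comment> \<open>Raising k relaxes the bound on levels and tightens the orthogonality. By
    self-adjointness, \<open>adj\<close> minus \<theta> (k + \<eta>) maps \<open>B k\<close> to
    \<open>B (Suc k)\<close>, and \<open>wt\<close> minus q^k maps \<open>B k\<close> to
    \<open>B (k - 1)\<close> for k > 0. So the sum of the \<open>B k\<close> is a module, and it
    contains \<open>h\<close>.\<close>
  define B where "B k = {w \<in> W. (\<forall>y. k < lev y \<longrightarrow> w y = 0) \<and> (\<forall>u\<in>Fil (Suc \<eta>) (k + \<eta>). herm X w u = 0)}" for k
  define K where "K = cfun.span (\<Union>k. B k)"
  have in_K: "w \<in> K" if "w \<in> B k" for w k unfolding K_def using that by (intro cfun.span_base) blast
  have BW: "B k \<subseteq> W" for k by (auto simp: B_def)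
  have KW: "K \<subseteq> W" unfolding K_def using BW Ws by (intro cfun.span_minimal) auto
  have K0: "0 \<in> K" by (simp add: K_def cfun.span_zero)
  have Kadd: "v + w \<in> K" if "v \<in> K" "w \<in> K" for v w using that unfolding K_def by (rule cfun.span_add)
  have Kscale: "cscale c w \<in> K" if "w \<in> K" for c w using that unfolding K_def by (rule cfun.span_scale)
  have adjB: "adj w \<in> K" if w: "w \<in> B k" for w k
  proof (cases "k + \<eta> \<le> D")
    case True
    have wW: "w \<in> W" using w BW by blast
    have "adj w - cscale (\<theta> (k + \<eta>)) w \<in> B (Suc k)"
      unfolding B_def
    proof (intro CollectI conjI allI impI ballI)
      show "adj w - cscale (\<theta> (k + \<eta>)) w \<in> W"
        using T_module_A[OF T wW] wW Ws by (auto simp: A_eq intro: cfun.subspace_diff cfun.subspace_scale)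
      fix y assume y: "Suc k < lev y"
      have "w z = 0" if "(y, z) \<in> R" for z
      proof -
        have "(z, y) \<in> R" using that sym_R' by (blast dest: symD)
        thus ?thesis using lev_adj[of z y] y w by (auto simp: B_def)
      qed
      hence "adj w y = 0" by (simp add: adj_def)
      moreover have "w y = 0" using w y by (auto simp: B_def)
      ultimately show "(adj w - cscale (\<theta> (k + \<eta>)) w) y = 0" by (simp add: vec_apply)
    next
      fix u assume u: "u \<in> Fil (Suc \<eta>) (Suc k + \<eta>)"
      have "herm X (adj w - cscale (\<theta> (k + \<eta>)) w) u = herm X w (adj u - cscale (\<theta> (k + \<eta>)) u)"
        using herm_A[of w u]
        by (simp add: A_eq herm_diff_left herm_diff_right herm_scale_left herm_scale_right)
      also have "\<dots> = 0" using adj_shift_Fil[of u "Suc \<eta>" "k + \<eta>"] u True w by (simp add: B_def)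
      finally show "herm X (adj w - cscale (\<theta> (k + \<eta>)) w) u = 0" .
    qed
    hence "(adj w - cscale (\<theta> (k + \<eta>)) w) + cscale (\<theta> (k + \<eta>)) w \<in> K"
      using in_K w by (intro Kadd Kscale) auto
    thus ?thesis by simp
  next
    case False
    \<comment> \<open>Past the top of the filtration the orthogonality covers \<open>W\<close>
      itself, so \<open>B k\<close> is zero.\<close>
    hence "Fil (Suc \<eta>) (Suc D) \<subseteq> Fil (Suc \<eta>) (k + \<eta>)" by (intro Fil_mono) auto
    hence "herm X w w = 0" using w WF by (auto simp: B_def)
    hence "w = 0" using herm_self_eq_0[OF finite_X, of w] w BW[of k] Ws(2) by blast
    thus ?thesis using K0 by (simp add: clinear_0[OF clinear_adj])
  qed
  have wtB: "wt w \<in> K" if w: "w \<in> B k" for w k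
  proof (cases k)
    case 0
    have wW: "w \<in> W" using w BW by blast
    \<comment> \<open>At k = 0 there is no \<open>B\<close> below; but on level 0 the weight is q^0
      = 1.\<close>
    have "wt w y = w y" for y
    proof (cases "lev y")
      case 0
      thus ?thesis using wt_eq[of w y] wW Ws by auto
    next
      case (Suc m)
      hence "w y = 0" using w \<open>k = 0\<close> by (auto simp: B_def)
      thus ?thesis by (simp add: wt_def)
    qed
    hence "wt w = w" by blast
    thus ?thesis using in_K w by simp
  next
    case (Suc k')
    have wW: "w \<in> W" using w BW by blast
    have "wt w - cscale (of_nat q ^ k) w \<in> B k'"
      unfolding B_def
    proof (intro CollectI conjI allI impI ballI)
      show "wt w - cscale (of_nat q ^ k) w \<in> W"
        using T_module_wt[OF T wW] wW Ws by (auto intro: cfun.subspace_diff cfun.subspace_scale)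
      fix y assume y: "k' < lev y"
      show "(wt w - cscale (of_nat q ^ k) w) y = 0"
      proof (cases "lev y = k")
        case True
        thus ?thesis using wt_eq[of w y] wW Ws by (auto simp: vec_apply)
      next
        case False
        hence "w y = 0" using w y Suc by (auto simp: B_def)
        thus ?thesis by (simp add: wt_def vec_apply)
      qed
    next
      fix u assume u: "u \<in> Fil (Suc \<eta>) (k' + \<eta>)"
      have "herm X (wt w - cscale (of_nat q ^ k) w) u = herm X w (wt u) - of_nat q ^ k * herm X w u"
        by (simp add: herm_diff_left herm_scale_left herm_wt)
      moreover have "wt u \<in> Fil (Suc \<eta>) (k + \<eta>)" using wt_Fil[OF u] Suc by simp
      moreover have "u \<in> Fil (Suc \<eta>) (k + \<eta>)" using u Fil_mono[of "Suc \<eta>" "Suc \<eta>" "k' + \<eta>" "k + \<eta>"] Suc by auto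
      ultimately show "herm X (wt w - cscale (of_nat q ^ k) w) u = 0" using w by (simp add: B_def)
    qed
    hence "(wt w - cscale (of_nat q ^ k) w) + cscale (of_nat q ^ k) w \<in> K"
      using in_K w by (intro Kadd Kscale) auto
    thus ?thesis by simp
  qed
  have "Tmod K"
  proof (rule T_moduleI)
    show "cfun.subspace K" by (simp add: K_def)
    show "K \<subseteq> std_module X" using KW Ws by blast
    show "adj w \<in> K" if "w \<in> K" for w
      by (rule clinear_span_into[OF clinear_adj _ _ that[unfolded K_def]]) (use adjB in \<open>auto simp: K_def\<close>)
    show "wt w \<in> K" if "w \<in> K" for w
      by (rule clinear_span_into[OF clinear_wt _ _ that[unfolded K_def]]) (use wtB in \<open>auto simp: K_def\<close>)
  qed
  moreover have "h \<in> B j"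
    unfolding B_def
  proof (intro CollectI conjI allI impI ballI)
    show "h y = 0" if "j < lev y" for y using h(3)[of y] that by auto
    fix u assume u: "u \<in> Fil (Suc \<eta>) (j + \<eta>)"
    show "herm X h u = 0"
    proof (rule herm_ortho_span[OF _ u[unfolded Fil_def]])
      fix v assume "v \<in> {vee b |b. subspace b \<and> dim b < dim (b \<inter> x) + Suc \<eta> \<and> dim b < j + \<eta>}"
      then obtain b where "v = vee b" "subspace b" "dim b < dim (b \<inter> x) + Suc \<eta>" "dim b < j + \<eta>" by blast
      thus "herm X h v = 0" using ip_eq_0_level[OF T WU ge h(1,3) \<eta> jD] by (simp add: herm_vee)
    qed
  qed (rule h)
  hence "K \<noteq> {0}" using in_K h(2) by blast
  ultimately have "K = W" using W KW by (auto simp: irred_T_module_def)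
  moreover have "K \<subseteq> {w. \<forall>u\<in>Fil (Suc \<eta>) (j + \<eta>). herm X w u = 0}"
    unfolding K_def
  proof (rule cfun.span_minimal[OF _ subspace_herm_ortho], rule subsetI)
    fix w assume "w \<in> (\<Union>k. B k)"
    then obtain k where w: "w \<in> B k" by blast
    show "w \<in> {w. \<forall>u\<in>Fil (Suc \<eta>) (j + \<eta>). herm X w u = 0}"
    \<comment> \<open>For k >= j the orthogonality in \<open>B k\<close> is at least as strong as
      required; for k < j nothing lives on levels up to k, so \<open>B k\<close> is zero.\<close>
    proof (cases "j \<le> k")
      case True
      thus ?thesis using w Fil_mono[of "Suc \<eta>" "Suc \<eta>" "j + \<eta>" "k + \<eta>"] by (auto simp: B_def)
    next
      case False
      have "w y = 0" for y
        using ge[of w y] w False by (cases "k < lev y") (auto simp: B_def)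
      hence "w = 0" by (simp add: fun_eq_iff zero_fun_apply)
      thus ?thesis by simp
    qed
  qed
  ultimately show ?thesis using w by blast
qed

text \<open>Distance and level add up to \<open>D\<close>, so the top of the support corresponds to
  the lowest level met by \<open>W\<close>.\<close>

lemma
  assumes W: "irred W"
  defines "j \<equiv> D - Max (support X R D x W)"
  shows level_ge: "w \<in> W \<Longrightarrow> w y \<noteq> 0 \<Longrightarrow> j \<le> lev y"
    and level_vec: "\<exists>h\<in>W. h \<noteq> 0 \<and> (\<forall>y. h y \<noteq> 0 \<longrightarrow> lev y = j)"
    and displacement_level: "displacement X R D \<theta> x W = int (Min (dual_support X R D \<theta> W)) - int j"
proof -
  let ?S = "support X R D x W"
  have T: "Tmod W" using W by (simp add: irred_T_module_def)
  have mx: "Max ?S \<in> ?S" using finite_support support_nonempty[OF W] by (intro Max_in) auto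
  hence mD: "Max ?S \<le> D" by (simp add: support_def)
  show "j \<le> lev y" if "w \<in> W" "w y \<noteq> 0"
  proof -
    have "y \<in> X" using that T_module_std[OF T] by (auto simp: std_module_def)
    hence "Es (D - lev y) w y \<noteq> 0" using that lev_le[of y] by (simp add: Es_eq)
    hence "Es (D - lev y) w \<noteq> 0" by (auto simp: zero_fun_apply)
    hence "D - lev y \<in> ?S" using that by (auto simp: support_eq[OF T])
    hence "D - lev y \<le> Max ?S" using finite_support by simp
    thus ?thesis by (simp add: j_def)
  qed
  obtain w where w: "w \<in> W" "Es (Max ?S) w \<noteq> 0" using mx by (auto simp: support_eq[OF T])
  have "lev y = j" if "Es (Max ?S) w y \<noteq> 0" for y
    using that mD by (simp add: Es_eq j_def split: if_splits)
  thus "\<exists>h\<in>W. h \<noteq> 0 \<and> (\<forall>y. h y \<noteq> 0 \<longrightarrow> lev y = j)"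
    using w T_module_Es[OF T w(1)] by blast
  show "displacement X R D \<theta> x W = int (Min (dual_support X R D \<theta> W)) - int j"
    using displacement_eq[OF W] mD by (simp add: j_def)
qed

lemma dual_endpoint_vec:
  assumes W: "irred W"
  obtains f where "f \<in> W" "f \<noteq> 0" "eigvec (Min (dual_support X R D \<theta> W)) f"
    "Min (dual_support X R D \<theta> W) \<le> D"
proof -
  have "Min (dual_support X R D \<theta> W) \<in> dual_support X R D \<theta> W"
    using finite_support support_nonempty[OF W] by (intro Min_in) auto
  thus thesis using that W by (auto simp: dual_support_eq irred_T_module_def)
qed

text \<open>An eigenvector for \<theta> t in \<open>W\<close> lies in
  \<open>Fil (Suc \<eta>) (Suc t)\<close>. If t were below either bound, that space would be
  orthogonal to \<open>W\<close>, and the eigenvector orthogonal to itself.\<close>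

lemma dual_endpoint_ge:
  assumes W: "irred W" and WF: "W \<subseteq> Fil (Suc \<eta>) (Suc D)"
    and WU: "\<And>w u. w \<in> W \<Longrightarrow> u \<in> Fil \<eta> (Suc D) \<Longrightarrow> herm X w u = 0"
  defines "t \<equiv> Min (dual_support X R D \<theta> W)" and "j \<equiv> D - Max (support X R D x W)"
  shows "\<eta> \<le> t" and "\<eta> \<le> j \<Longrightarrow> j + \<eta> \<le> t"
proof -
  obtain f where f: "f \<in> W" "f \<noteq> 0" "eigvec t f" "t \<le> D"
    unfolding t_def by (rule dual_endpoint_vec[OF W])
  have ft: "f \<in> Fil (Suc \<eta>) (Suc t)" using eigvec_in_Fil f WF by blast
  have fs: "f \<in> std_module X" using ft Fil_std by blast
  have ff: "herm X f f \<noteq> 0" using herm_self_eq_0[OF finite_X fs] f by blast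
  show "\<eta> \<le> t"
  proof (rule ccontr)
    assume "\<not> \<eta> \<le> t"
    \<comment> \<open>A generator \<open>vee b\<close> here has dim b <= t < \<eta>, so it meets the
      sharper bound dim b < dim (b \<inter> x) + \<eta> trivially.\<close>
    hence "Fil (Suc \<eta>) (Suc t) \<subseteq> Fil \<eta> (Suc D)"
      by (intro Fil_subset subspace_Fil vee_in_Fil_top) auto
    thus False using WU[OF f(1)] ft ff by blast
  qed
  assume \<eta>: "\<eta> \<le> j"
  obtain h where h: "h \<in> W" "h \<noteq> 0" "\<And>y. h y \<noteq> 0 \<Longrightarrow> lev y = j"
    using level_vec[OF W] unfolding j_def by blast
  have ge: "j \<le> lev y" if "w \<in> W" "w y \<noteq> 0" for w y
    using level_ge[OF W that] by (simp add: j_def)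
  show "j + \<eta> \<le> t"
  proof (rule ccontr)
    assume "\<not> j + \<eta> \<le> t"
    hence "f \<in> Fil (Suc \<eta>) (j + \<eta>)" using ft Fil_mono[of "Suc \<eta>" "Suc \<eta>" "Suc t" "j + \<eta>"] by auto
    hence "herm X f f = 0"
      by (rule ortho_Fil[where \<eta> = \<eta> and j = j and h = h, rotated -1])
        (use W WF WU ge h \<eta> f(1) in blast)+
    thus False using ff by blast
  qed
qed

text \<open>For \<eta> = 1 the generators come from subspaces of \<open>x\<close>, and whether
  \<open>y\<close> contains such a subspace depends on \<open>y \<inter> x\<close> only.\<close>

lemma Fil_1_const:
  assumes "f \<in> Fil 1 n" "y \<in> X" "z \<in> X" "y \<inter> x = z \<inter> x"
  shows "f y = f z"
proof -
  have "Fil 1 n \<subseteq> {f. f y = f z}"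
  proof (rule Fil_subset)
    show "cfun.subspace {f. f y = f z}" by (auto simp: cfun.subspace_def vec_apply)
    fix b assume b: "subspace b" "dim b < dim (b \<inter> x) + 1"
    hence "b \<inter> x = b" using subspace_x by (intro subspace_eqI) (auto simp: subspace_inter)
    hence "b \<subseteq> y \<longleftrightarrow> b \<subseteq> z" using assms by blast
    thus "vee b \<in> {f. f y = f z}" using assms by (simp add: vee_apply)
  qed
  thus ?thesis using assms by blast
qed

text \<open>By triangularity \<open>Fil \<eta> n\<close> splits into eigenvectors for \<theta> 0,
  ..., \<theta> (n - 1), whereas \<open>W\<close> involves only eigenvalues from its dual endpoint
  on.\<close>

lemma ortho_Fil_below_dual_endpoint:
  assumes W: "irred W" and w: "w \<in> W" and n: "n \<le> Min (dual_support X R D \<theta> W)"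
    and u: "u \<in> Fil \<eta> n"
  shows "herm X w u = 0"
proof -
  let ?t = "Min (dual_support X R D \<theta> W)"
  have T: "Tmod W" using W by (simp add: irred_T_module_def)
  have tD: "?t \<le> D" by (rule dual_endpoint_vec[OF W])
  have "\<exists>v. (\<forall>i<n. v i \<in> std_module X \<and> adj (v i) = cscale (complex_of_real (\<theta> i)) (v i))
      \<and> u = (\<Sum>i<n. v i)"
  proof (rule filtration_eigen_decomposition[OF clinear_adj subspace_std_module, where P = "Fil \<eta>"])
    show "inj_on (\<lambda>i. complex_of_real (\<theta> i)) {..<n}"
      using inj_\<theta> n tD by (auto simp: inj_on_def)
    show "adj v - cscale (complex_of_real (\<theta> m)) v \<in> Fil \<eta> m" if "m < n" "v \<in> Fil \<eta> (Suc m)" for m v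
      using adj_shift_Fil[OF that(2)] that(1) n tD by simp
    show "u \<in> std_module X" using u Fil_std by blast
  qed (use u A_std in \<open>auto simp: A_eq[symmetric] Fil_0\<close>)
  then obtain v where v: "\<And>i. i < n \<Longrightarrow> eigvec i (v i)" "u = (\<Sum>i<n. v i)"
    by (auto simp: eigvec_def A_eq)
  obtain z where z: "\<And>i. i \<le> D \<Longrightarrow> z i \<in> W \<and> eigvec i (z i)" "w = (\<Sum>i\<le>D. z i)"
    using eigen_decomposition[OF T w] by blast
  have "herm X (z i) (v k) = 0" if "i \<le> D" "k < n" for i k
  proof (cases "z i = 0")
    case False
    hence "i \<in> dual_support X R D \<theta> W" using z(1) that by (auto simp: dual_support_eq[OF T])
    hence "?t \<le> i" using finite_support by simp
    thus ?thesis using eigvec_ortho[of i "z i" k "v k"] z(1) v(1) that n tD by auto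
  qed simp
  hence "herm X w (v k) = 0" if "k < n" for k
    unfolding z(2) herm_sum_left using that by (intro sum.neutral) auto
  thus ?thesis
    unfolding v(2) by (induction n) (auto simp: herm_add_right)
qed

text \<open>Otherwise a vector \<open>h\<close> of \<open>W\<close> on the lowest level j is
  orthogonal to \<open>vee a\<close>, where a = y \<inter> x for a vertex \<open>y\<close> with h y
  nonzero. But \<open>h\<close> is constant on the vertices meeting \<open>x\<close> in a, and the
  other vertices above a have a higher level, so the inner product is a positive multiple of h
  y.\<close>

lemma dual_endpoint_le:
  assumes W: "irred W" and WF: "W \<subseteq> Fil 1 (Suc D)"
  shows "Min (dual_support X R D \<theta> W) \<le> D - Max (support X R D x W)" (is "?t \<le> ?j")
proof (rule ccontr)
  assume t: "\<not> ?t \<le> ?j"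
  obtain h where h: "h \<in> W" "h \<noteq> 0" "\<And>y. h y \<noteq> 0 \<Longrightarrow> lev y = ?j"
    using level_vec[OF W] by blast
  have hX: "y \<in> X" if "h y \<noteq> 0" for y
    using that h WF Fil_std by (fastforce simp: std_module_def)
  obtain y where y: "h y \<noteq> 0" using h(2) by (auto simp: fun_eq_iff zero_fun_apply)
  let ?a = "y \<inter> x"
  have ys: "subspace y" using hX[OF y] by (simp add: X_iff)
  have a: "subspace ?a" "dim ?a = ?j" using ys subspace_x h(3)[OF y] by (auto simp: subspace_inter lev_def)
  have "vee ?a \<in> Fil 1 (Suc ?j)" using a by (intro vee_in_Fil) (auto simp: Int_assoc)
  moreover have "Suc ?j \<le> ?t" using t by simp
  ultimately have "herm X h (vee ?a) = 0"
    by (intro ortho_Fil_below_dual_endpoint[OF W h(1)])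
  hence "ip h ?a = 0" by (simp add: herm_vee)
  moreover have "ip h ?a = (\<Sum>z | z \<in> X \<and> ?a \<subseteq> z. if z \<inter> x = ?a then h y else 0)"
    unfolding ip_def
  proof (rule sum.cong[OF refl])
    fix z assume z: "z \<in> {z. z \<in> X \<and> ?a \<subseteq> z}"
    show "h z = (if z \<inter> x = ?a then h y else 0)"
    proof (cases "z \<inter> x = ?a")
      case True
      thus ?thesis using Fil_1_const[of h "Suc D" z y] h(1) WF z hX[OF y] by auto
    next
      case False
      have "subspace (z \<inter> x)" using z subspace_x by (auto simp: subspace_inter X_iff)
      hence "\<not> dim (z \<inter> x) \<le> dim ?a" using False z subspace_eqI[OF a(1), of "z \<inter> x"] by auto
      hence "lev z \<noteq> ?j" using a by (simp add: lev_def)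
      thus ?thesis using h(3)[of z] False by auto
    qed
  qed
  moreover have "\<dots> = of_nat (card {z \<in> {z. z \<in> X \<and> ?a \<subseteq> z}. z \<inter> x = ?a}) * h y"
    by (simp flip: sum.inter_filter)
  moreover have "y \<in> {z \<in> {z. z \<in> X \<and> ?a \<subseteq> z}. z \<inter> x = ?a}" using hX[OF y] by auto
  hence "card {z \<in> {z. z \<in> X \<and> ?a \<subseteq> z}. z \<inter> x = ?a} \<noteq> 0" by auto
  ultimately show False using y by simp
qed

lemma nucleus_eq: "nucleus X R D \<theta> x = Fil 1 (Suc D)"
proof
  show "Fil 1 (Suc D) \<subseteq> nucleus X R D \<theta> x"
  proof (rule order_trans[OF completely_reducible[OF Tmod_Fil]])
    have "displacement X R D \<theta> x W = 0" if W: "irred W" "W \<subseteq> Fil 1 (Suc D)" for W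
    proof -
      \<comment> \<open>With \<eta> = 0 the orthogonality hypothesis is about
        \<open>Fil 0 (Suc D)\<close>, which is zero.\<close>
      have "D - Max (support X R D x W) \<le> Min (dual_support X R D \<theta> W)"
        using dual_endpoint_ge(2)[OF W(1), of 0] W(2) by (simp add: Fil_0)
      moreover have "Min (dual_support X R D \<theta> W) \<le> D - Max (support X R D x W)"
        by (rule dual_endpoint_le[OF W])
      ultimately show ?thesis by (simp add: displacement_level[OF W(1)])
    qed
    thus "cfun.span (\<Union>{W. irred W \<and> W \<subseteq> Fil 1 (Suc D)}) \<subseteq> nucleus X R D \<theta> x"
      unfolding nucleus_def by (intro cfun.span_mono) blast
  qed
  have "W \<subseteq> Fil 1 (Suc D)" if W: "irred W" "displacement X R D \<theta> x W = 0" for W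
  proof -
    have T: "Tmod W" using W by (simp add: irred_T_module_def)
    define \<eta> where "\<eta> = (LEAST \<eta>. W \<subseteq> Fil (Suc \<eta>) (Suc D))"
    have "W \<subseteq> Fil (Suc D) (Suc D)" using T_module_std[OF T] by (simp add: Fil_top)
    hence WF: "W \<subseteq> Fil (Suc \<eta>) (Suc D)" unfolding \<eta>_def by (rule LeastI)
    show ?thesis
    proof (cases \<eta>)
      case 0
      thus ?thesis using WF by simp
    next
      case (Suc \<eta>')
      have not: "\<not> W \<subseteq> Fil \<eta> (Suc D)"
        using not_less_Least[of \<eta>' "\<lambda>\<eta>. W \<subseteq> Fil (Suc \<eta>) (Suc D)"] Suc by (simp add: \<eta>_def)
      obtain W' where W': "irred W'" "\<And>w u. w \<in> W' \<Longrightarrow> u \<in> Fil \<eta> (Suc D) \<Longrightarrow> herm X w u = 0"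
        "\<And>V. Tmod V \<Longrightarrow> W \<subseteq> V \<Longrightarrow> Fil \<eta> (Suc D) \<subseteq> V \<Longrightarrow> W' \<subseteq> V"
        "support X R D x W' = support X R D x W" "dual_support X R D \<theta> W' = dual_support X R D \<theta> W"
        using irred_projection[OF W(1) Tmod_Fil not] by metis
      have "W' \<subseteq> Fil (Suc \<eta>) (Suc D)" by (intro W'(3) Tmod_Fil WF Fil_mono) auto
      note ge = dual_endpoint_ge[OF W'(1) this W'(2), unfolded W'(4,5)]
      have "Min (dual_support X R D \<theta> W) = D - Max (support X R D x W)"
        using displacement_level[OF W(1)] W(2) by simp
      \<comment> \<open>Displacement 0 means t = j. If \<eta> > j this contradicts t >= \<eta>;
        otherwise it contradicts t >= j + \<eta>, as \<eta> > 0.\<close>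
      thus ?thesis using ge Suc by (cases "\<eta> \<le> D - Max (support X R D x W)") auto
    qed
  qed
  thus "nucleus X R D \<theta> x \<subseteq> Fil 1 (Suc D)"
    unfolding nucleus_def by (intro cfun.span_minimal subspace_Fil) blast
qed

text \<open>Enlarge \<open>a\<close> by vectors outside the join with \<open>x\<close>. There is
  room up to dimension \<open>D\<close>, because before the last step the join has dimension below
  2D < N.\<close>

lemma exists_Int_eq:
  assumes a: "subspace a" "a \<subseteq> x"
  shows "\<exists>y\<in>X. y \<inter> x = a"
proof -
  have "\<exists>h. subspace h \<and> dim h = n \<and> h \<inter> x = a" if "dim a \<le> n" "n \<le> D" for n
    using that
  proof (induction n rule: dec_induct)
    case base
    show ?case using a by (intro exI[of _ a]) auto
  next
    case (step n)
    then obtain h where h: "subspace h" "dim h = n" "h \<inter> x = a" by auto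
    have "dim (h \<squnion> x) \<le> n + D" using dim_join_Int[OF h(1) subspace_x] h dim_x by simp
    hence "dim (h \<squnion> x) < dim UNIV" using step N_gt unfolding dim_UNIV_eq by simp
    hence "h \<squnion> x \<noteq> UNIV" by fastforce
    then obtain p where p: "p \<notin> h \<squnion> x" by blast
    hence ph: "p \<notin> h" using join_upper(1)[of h x] by blast
    have "span (insert p h) \<inter> x = a"
      using span_insert_Int_iff[OF h(1) subspace_x ph] p h by blast
    moreover have "dim (span (insert p h)) = Suc n" using dim_span_insert[OF h(1) ph] h by simp
    ultimately show ?case using subspace_span by blast
  qed
  moreover have "dim a \<le> D" using dim_subset[OF a(2)] dim_x by simp
  ultimately obtain h where "subspace h" "dim h = D" "h \<inter> x = a" by blast
  thus ?thesis by (intro bexI[of _ h]) (simp_all add: X_iff)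
qed

section \<open>The two bases\<close>

abbreviation Sub :: "'v set set" where "Sub \<equiv> {a. subspace a \<and> a \<subseteq> x}"

lemma nuc_vec_apply: "nuc_vec scale D x a y = (if y \<in> X \<and> y \<inter> x = a then 1 else 0)"
  by (simp add: nuc_vec_def vec_apply hat_def if_distrib cong: if_cong)

lemma span_vee: "cfun.span (vee ` Sub) = Fil 1 (Suc D)"
proof -
  have "b \<subseteq> x \<and> dim b \<le> D \<longleftrightarrow> dim b < dim (b \<inter> x) + 1 \<and> dim b < Suc D" if b: "subspace b" for b
  proof
    assume "b \<subseteq> x \<and> dim b \<le> D"
    thus "dim b < dim (b \<inter> x) + 1 \<and> dim b < Suc D" by (simp add: Int_absorb2)
  next
    assume *: "dim b < dim (b \<inter> x) + 1 \<and> dim b < Suc D"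
    hence "b \<inter> x = b" using b subspace_x by (intro subspace_eqI) (auto simp: subspace_inter)
    thus "b \<subseteq> x \<and> dim b \<le> D" using * by auto
  qed
  moreover have "dim b \<le> D" if "b \<subseteq> x" for b using dim_subset[OF that] dim_x by simp
  ultimately have "vee ` Sub = {vee b |b. subspace b \<and> dim b < dim (b \<inter> x) + 1 \<and> dim b < Suc D}"
    by blast
  thus ?thesis by (simp add: Fil_def)
qed

lemma vee_eq_sum_nuc:
  assumes "a \<subseteq> x"
  shows "vee a = (\<Sum>b | b \<in> Sub \<and> a \<subseteq> b. nuc_vec scale D x b)"
proof
  fix y
  show "vee a y = (\<Sum>b | b \<in> Sub \<and> a \<subseteq> b. nuc_vec scale D x b) y"
  proof (cases "y \<in> X")
    case True
    hence "y \<inter> x \<in> Sub" using subspace_x by (auto simp: X_iff subspace_inter)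
    moreover have "(\<Sum>b | b \<in> Sub \<and> a \<subseteq> b. nuc_vec scale D x b) y =
        (\<Sum>b | b \<in> Sub \<and> a \<subseteq> b. if b = y \<inter> x then 1 else 0)"
      unfolding sum_apply by (intro sum.cong) (auto simp: nuc_vec_apply True)
    ultimately show ?thesis using True assms by (simp add: vee_apply)
  qed (simp add: vee_apply sum_apply nuc_vec_apply)
qed

text \<open>The expansion \<open>vee_eq_sum_nuc\<close> is unitriangular for inclusion, so it is
  inverted from the largest subspaces of \<open>x\<close> downwards.\<close>

lemma nuc_in_span_vee:
  assumes "a \<in> Sub"
  shows "nuc_vec scale D x a \<in> cfun.span (vee ` Sub)"
  using assms
proof (induction "D - dim a" arbitrary: a rule: less_induct)
  case less
  let ?I = "{b. b \<in> Sub \<and> a \<subseteq> b}"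
  have "vee a = nuc_vec scale D x a + (\<Sum>b\<in>?I - {a}. nuc_vec scale D x b)"
    using less.prems by (subst vee_eq_sum_nuc, blast, intro sum.remove) auto
  hence "nuc_vec scale D x a = vee a - (\<Sum>b\<in>?I - {a}. nuc_vec scale D x b)" by simp
  moreover have "nuc_vec scale D x b \<in> cfun.span (vee ` Sub)" if b: "b \<in> ?I - {a}" for b
  proof (rule less.hyps)
    have "\<not> dim b \<le> dim a" using b less.prems subspace_eqI[of a b] by auto
    moreover have "dim b \<le> D" using b dim_subset[of b x] dim_x by auto
    ultimately show "D - dim b < D - dim a" by simp
  qed (use b in auto)
  moreover have "vee a \<in> cfun.span (vee ` Sub)" using less.prems by (intro cfun.span_base) auto
  ultimately show ?case by (simp only: cfun.span_diff cfun.span_sum)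
qed

lemma span_nuc: "cfun.span (nuc_vec scale D x ` Sub) = Fil 1 (Suc D)"
  unfolding span_vee[symmetric]
proof
  show "cfun.span (nuc_vec scale D x ` Sub) \<subseteq> cfun.span (vee ` Sub)"
    using nuc_in_span_vee by (intro cfun.span_minimal) auto
  have "vee a \<in> cfun.span (nuc_vec scale D x ` Sub)" if "a \<in> Sub" for a
  proof -
    have "(\<Sum>b | b \<in> Sub \<and> a \<subseteq> b. nuc_vec scale D x b) \<in> cfun.span (nuc_vec scale D x ` Sub)"
      by (rule cfun.span_sum, rule cfun.span_base) blast
    thus ?thesis using that vee_eq_sum_nuc[of a] by simp
  qed
  thus "cfun.span (vee ` Sub) \<subseteq> cfun.span (nuc_vec scale D x ` Sub)"
    by (intro cfun.span_minimal) auto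
qed

text \<open>Evaluating a linear relation at a vertex that meets \<open>x\<close> in a leaves only
  the coefficients of subspaces of a; all but the one of a vanish by induction on dim a.\<close>

lemma basis_vee: "is_basis_family vee Sub (nucleus X R D \<theta> x)"
  unfolding nucleus_eq
proof (rule is_basis_familyI[OF _ span_vee])
  fix c :: "'v set \<Rightarrow> complex"
  assume c: "(\<Sum>a\<in>Sub. cscale (c a) (vee a)) = 0"
  have "c a = 0" if "a \<in> Sub" for a
    using that
  proof (induction "dim a" arbitrary: a rule: less_induct)
    case less
    then obtain y where y: "y \<in> X" "y \<inter> x = a" using exists_Int_eq by blast
    have "0 = (\<Sum>b\<in>Sub. cscale (c b) (vee b)) y" by (simp add: c zero_fun_apply)
    also have "\<dots> = (\<Sum>b\<in>Sub. if b = a then c a else 0)"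
      unfolding sum_apply
    proof (rule sum.cong[OF refl])
      fix b assume b: "b \<in> Sub"
      hence *: "b \<subseteq> y \<longleftrightarrow> b \<subseteq> a" using y by blast
      show "cscale (c b) (vee b) y = (if b = a then c a else 0)"
      proof (cases "b = a")
        case False
        have "c b = 0" if "b \<subseteq> a"
        proof (rule less.hyps[OF _ b])
          have "\<not> dim a \<le> dim b" using subspace_eqI[of b a] b less.prems that False by blast
          thus "dim b < dim a" by simp
        qed
        thus ?thesis using False * by (auto simp: cscale_apply vee_apply)
      qed (use * y in \<open>simp add: cscale_apply vee_apply\<close>)
    qed
    also have "\<dots> = c a" using less.prems by simp
    finally show ?case by simp
  qed
  thus "\<forall>a\<in>Sub. c a = 0" by blast
qed simp

text \<open>The vectors have disjoint supports, and these are nonempty by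
  \<open>exists_Int_eq\<close>.\<close>

lemma basis_nuc: "is_basis_family (nuc_vec scale D x) Sub (nucleus X R D \<theta> x)"
  unfolding nucleus_eq
proof (rule is_basis_familyI[OF _ span_nuc])
  fix c :: "'v set \<Rightarrow> complex"
  assume c: "(\<Sum>a\<in>Sub. cscale (c a) (nuc_vec scale D x a)) = 0"
  show "\<forall>a\<in>Sub. c a = 0"
  proof
    fix a assume a: "a \<in> Sub"
    then obtain y where y: "y \<in> X" "y \<inter> x = a" using exists_Int_eq by blast
    have "0 = (\<Sum>b\<in>Sub. cscale (c b) (nuc_vec scale D x b)) y" by (simp add: c zero_fun_apply)
    also have "\<dots> = (\<Sum>b\<in>Sub. if b = a then c a else 0)"
      unfolding sum_apply using y by (intro sum.cong refl) (auto simp: cscale_apply nuc_vec_apply)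
    also have "\<dots> = c a" using a by simp
    finally show "c a = 0" by simp
  qed
qed simp

end

theorem theorem9p7:
  fixes scale :: "'k::{field,finite} \<Rightarrow> 'v::ab_group_add \<Rightarrow> 'v"
    and N D :: nat and x :: "'v set"
  assumes "vector_space scale"
    and "vector_space.dim scale UNIV = N"
    and "D \<ge> 1"
    and "N > 2 * D"
    and "x \<in> grassmann_verts scale D"
  shows "is_basis_family (vee_vec scale D) {\<alpha>. module.subspace scale \<alpha> \<and> \<alpha> \<subseteq> x}
           (grassmann_nucleus scale D x)
       \<and> is_basis_family (nuc_vec scale D x) {\<alpha>. module.subspace scale \<alpha> \<and> \<alpha> \<subseteq> x}
           (grassmann_nucleus scale D x)"
proof -
  interpret vector_space scale by (rule assms(1))
  obtain B where B: "independent B" "UNIV \<subseteq> span B" "card B = N"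
    using basis_exists[of UNIV] assms(2) by metis
  \<comment> \<open>An infinite set has \<open>card\<close> 0, whereas N > 0.\<close>
  have "finite B" using B(3) assms(3,4) by (metis card.infinite not_less_zero)
  interpret grassmann scale B "CARD('k)" N D x
    by unfold_locales (use B \<open>finite B\<close> assms in \<open>auto simp: grassmann_verts_def\<close>)
  show ?thesis
    using basis_vee basis_nuc by (simp add: grassmann_nucleus_def assms(2) del: dim_UNIV)
qed

end
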